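(* Let $3\le d<n$ and let $G$ be a graph with property $P_\alpha(n,d)$ such that for every two disjoint sets $U,V\subseteq V(G)$ with $|U|,|V|\ge n(d-1)/16$ there is an edge between $U$ and $V$. Let $S\subseteq V(G)$ be any set with $|N_G(x)\cap S|\le\beta d_G(x)$ for every $x\in V(G)$, and let $P=\{\{a_i,b_i\}\}$ be a collection of at most $\frac{dn\log d}{15\log n}$ pairwise disjoint pairs of vertices from $S$. If $\beta<2\alpha-1$, then there exists a polynomial time algorithm which finds vertex-disjoint paths in $G$ between every pair $\{a_i,b_i\}$, each path having length $2\left\lceil\frac{\log(n/16)}{\log(d-1)}\right\rceil+3$. Furthermore, the algorithm works online: the pairs are given one by one, the next pair being revealed only after the connection for the previous one has been made, and established connections cannot be changed.
   Context: For a graph $G=(V,E)$, $\partial_G(x)$ is the set of edges incident with $x$, and for $X\subseteq V$, $N_G(X)=\big(\bigcup_{x\in X}N_G(x)\big)\setminus X$. $G$ has property $P_\alpha(n,d)$ if for every $X\subseteq V$ with $|X|\le n$ and every $F\subseteq E$ with $|F\cap\partial_G(x)|\le\alpha\cdot d_G(x)$ for every $x\in X$, we have $|N_{G-F}(X)|\ge 2d|X|$. $\log$ is the natural logarithm. *)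

theory Defs
  imports Complex_Main "HOL-Computational_Algebra.Polynomial"
begin

section \<open>Finite simple graphs\<close>

text \<open>A graph is given by its vertex set \<open>V\<close> and its edge set \<open>E\<close>, edges being two-element
  subsets of \<open>V\<close>.\<close>

definition simple_graph :: "'a set \<Rightarrow> 'a set set \<Rightarrow> bool" where
  "simple_graph V E \<longleftrightarrow> finite V \<and> (\<forall>e\<in>E. e \<subseteq> V \<and> card e = 2)"

definition incident_edges :: "'a set set \<Rightarrow> 'a \<Rightarrow> 'a set set" where
  "incident_edges E x = {e \<in> E. x \<in> e}"

definition vertex_degree :: "'a set set \<Rightarrow> 'a \<Rightarrow> nat" where
  "vertex_degree E x = card (incident_edges E x)"

definition neighbours :: "'a set set \<Rightarrow> 'a \<Rightarrow> 'a set" where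
  "neighbours E x = {y. {x, y} \<in> E}"

definition set_neighbours :: "'a set set \<Rightarrow> 'a set \<Rightarrow> 'a set" where
  "set_neighbours E X = (\<Union>x\<in>X. neighbours E x) - X"

definition property_P :: "real \<Rightarrow> nat \<Rightarrow> nat \<Rightarrow> 'a set \<Rightarrow> 'a set set \<Rightarrow> bool" where
  "property_P \<alpha> n d V E \<longleftrightarrow>
     (\<forall>X F. X \<subseteq> V \<and> card X \<le> n \<and> F \<subseteq> E \<and>
        (\<forall>x\<in>X. real (card (F \<inter> incident_edges E x)) \<le> \<alpha> * real (vertex_degree E x))
        \<longrightarrow> 2 * d * card X \<le> card (set_neighbours (E - F) X))"

text \<open>A path is a nonempty sequence of distinct vertices; its length is the number of edges.\<close>

definition is_path :: "'a set \<Rightarrow> 'a set set \<Rightarrow> 'a \<Rightarrow> 'a \<Rightarrow> 'a list \<Rightarrow> bool" where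
  "is_path V E a b p \<longleftrightarrow>
     p \<noteq> [] \<and> distinct p \<and> set p \<subseteq> V \<and> successively (\<lambda>u v. {u, v} \<in> E) p \<and>
     hd p = a \<and> last p = b"

definition path_length :: "'a list \<Rightarrow> int" where
  "path_length p = int (length p) - 1"

text \<open>\<open>disjoint_pairs S ps\<close>: the pairs in \<open>ps\<close> consist of two distinct vertices of \<open>S\<close> each and are
  pairwise disjoint, that is, all the listed end points are different elements of \<open>S\<close>.\<close>

definition disjoint_pairs :: "'a set \<Rightarrow> ('a \<times> 'a) list \<Rightarrow> bool" where
  "disjoint_pairs S ps \<longleftrightarrow>
     (let xs = concat (map (\<lambda>(a, b). [a, b]) ps) in distinct xs \<and> set xs \<subseteq> S)"

definition connected_disjointly ::
    "'a set \<Rightarrow> 'a set set \<Rightarrow> int \<Rightarrow> ('a \<times> 'a) list \<Rightarrow> 'a list list \<Rightarrow> bool" where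
  "connected_disjointly V E l ps qs \<longleftrightarrow>
     length qs = length ps \<and>
     (\<forall>i < length ps. is_path V E (fst (ps ! i)) (snd (ps ! i)) (qs ! i) \<and> path_length (qs ! i) = l) \<and>
     (\<forall>i j. i < j \<and> j < length ps \<longrightarrow> set (qs ! i) \<inter> set (qs ! j) = {})"


section \<open>Random access machine programs and their running time\<close>

text \<open>The machine has arrays of natural numbers, indexed by natural numbers; a scalar is cell 0 of
  an array. Any program mentions only finitely many arrays, so this is a random access machine with
  unit costs whose only arithmetic is addition and truncated subtraction. Without multiplication
  the bit length of the numbers grows by at most a constant per step, hence polynomial running time
  has its usual (Turing machine) meaning. One unit is charged per assignment and per test; the
  expressions in a program have constant size, so charging for their evaluation as well would only
  change running times by a constant factor.

  The arrays other than the auxiliary ones are used for input and output, see below.\<close>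

datatype array =
    Order | Size_Bound | Degree_Bound | Adjacency | Reserved
  | Source | Target | Path_Card | Path
  | Aux nat

type_synonym store = "array \<Rightarrow> nat \<Rightarrow> nat"

datatype exp = Lit nat | Get array exp | Plus exp exp | Minus exp exp

datatype com =
    Skip
  | Assign array exp exp  \<comment> \<open>\<open>Assign x i e\<close> is the assignment \<open>x[i] := e\<close>\<close>
  | Seq com com
  | Cond exp com com
  | While exp com

primrec exp_val :: "exp \<Rightarrow> store \<Rightarrow> nat" where
  "exp_val (Lit k) s = k"
| "exp_val (Get x e) s = s x (exp_val e s)"
| "exp_val (Plus e f) s = exp_val e s + exp_val f s"
| "exp_val (Minus e f) s = exp_val e s - exp_val f s"

text \<open>\<open>exec c s t s'\<close>: started in \<open>s\<close>, the program \<open>c\<close> halts after \<open>t\<close> steps in \<open>s'\<close>. A test succeeds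
  if its value is not zero.\<close>

inductive exec :: "com \<Rightarrow> store \<Rightarrow> nat \<Rightarrow> store \<Rightarrow> bool" where
  exec_Skip: "exec Skip s 1 s"
| exec_Assign: "exec (Assign x i e) s 1 (s(x := (s x)(exp_val i s := exp_val e s)))"
| exec_Seq: "exec c s t s' \<Longrightarrow> exec c' s' t' s'' \<Longrightarrow> exec (Seq c c') s (t + t') s''"
| exec_Cond_True: "exp_val b s \<noteq> 0 \<Longrightarrow> exec c s t s' \<Longrightarrow> exec (Cond b c c') s (t + 1) s'"
| exec_Cond_False: "exp_val b s = 0 \<Longrightarrow> exec c' s t s' \<Longrightarrow> exec (Cond b c c') s (t + 1) s'"
| exec_While_True:
    "exp_val b s \<noteq> 0 \<Longrightarrow> exec c s t s' \<Longrightarrow> exec (While b c) s' t' s'' \<Longrightarrow>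
     exec (While b c) s (t + t' + 1) s''"
| exec_While_False: "exp_val b s = 0 \<Longrightarrow> exec (While b c) s 1 s"

inductive_cases exec_SkipE: "exec Skip s t s'"
inductive_cases exec_AssignE: "exec (Assign x i e) s t s'"
inductive_cases exec_SeqE: "exec (Seq c c') s t s'"
inductive_cases exec_CondE: "exec (Cond b c c') s t s'"
inductive_cases exec_WhileE: "exec (While b c) s t s'"

lemma exec_deterministic:
  "exec c s t s' \<Longrightarrow> exec c s u s'' \<Longrightarrow> t = u \<and> s' = s''"
proof (induction arbitrary: u s'' rule: exec.induct)
  case (exec_Skip s)
  then show ?case by (auto elim: exec_SkipE)
next
  case (exec_Assign x i e s)
  then show ?case by (auto elim: exec_AssignE)
next
  case (exec_Seq c s t s' c' t' s1)
  from exec_Seq.prems obtain v w s2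
    where "exec c s v s2" "exec c' s2 w s''" "u = v + w"
    by (rule exec_SeqE) blast
  with exec_Seq.IH show ?case by blast
next
  case (exec_Cond_True b s c t s' c')
  from exec_Cond_True.prems exec_Cond_True.hyps(1) obtain v
    where "exec c s v s''" "u = v + 1"
    by (auto elim!: exec_CondE)
  with exec_Cond_True.IH show ?case by blast
next
  case (exec_Cond_False b s c' t s' c)
  from exec_Cond_False.prems exec_Cond_False.hyps(1) obtain v
    where "exec c' s v s''" "u = v + 1"
    by (auto elim!: exec_CondE)
  with exec_Cond_False.IH show ?case by blast
next
  case (exec_While_True b s c t s' t' s1)
  from exec_While_True.hyps(1) obtain v w s2
    where "exec c s v s2" "exec (While b c) s2 w s''" "u = v + w + 1"
    using exec_While_True.prems by (cases rule: exec_WhileE) auto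
  with exec_While_True.IH show ?case by blast
next
  case (exec_While_False b s c)
  from exec_While_False.prems show ?case
    by (rule exec_WhileE) (use exec_While_False.hyps in simp_all)
qed


section \<open>Online algorithms for connecting pairs\<close>

text \<open>Initially the store holds the graph on the vertices \<open>0, ..., N - 1\<close> by its adjacency matrix
  (row by row), the set \<open>S\<close> by its characteristic vector, and the numbers \<open>N\<close>, \<open>n\<close> and \<open>d\<close>. All other
  cells are 0.\<close>

definition scalar :: "nat \<Rightarrow> nat \<Rightarrow> nat" where
  "scalar k = (\<lambda>i. if i = 0 then k else 0)"

definition initial_store :: "nat \<Rightarrow> nat set set \<Rightarrow> nat set \<Rightarrow> nat \<Rightarrow> nat \<Rightarrow> store" where
  "initial_store N E S n d = (\<lambda>_ _. 0)
     (Order := scalar N,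
      Size_Bound := scalar n,
      Degree_Bound := scalar d,
      Adjacency := (\<lambda>i. if i < N * N \<and> {i div N, i mod N} \<in> E then 1 else 0),
      Reserved := (\<lambda>v. if v < N \<and> v \<in> S then 1 else 0))"

definition reveal_pair :: "nat \<times> nat \<Rightarrow> store \<Rightarrow> store" where
  "reveal_pair p s = s(Source := scalar (fst p), Target := scalar (snd p))"

definition output_path :: "store \<Rightarrow> nat list" where
  "output_path s = map (s Path) [0..<s Path_Card 0]"

text \<open>\<open>online_run c T s ps qs\<close>: the pairs \<open>ps\<close> are revealed one at a time; after each of them \<open>c\<close> is run
  for at most \<open>T\<close> steps, starting from the store left by the preceding round, and the path it
  outputs is appended to the list of answers \<open>qs\<close>, where it stays. As programs are deterministic,
  an answer is a function of the pairs revealed so far only; the two lemmas below make this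
  explicit.\<close>

inductive online_run :: "com \<Rightarrow> nat \<Rightarrow> store \<Rightarrow> (nat \<times> nat) list \<Rightarrow> nat list list \<Rightarrow> bool"
  for c :: com and T :: nat where
  online_run_Nil: "online_run c T s [] []"
| online_run_Cons:
    "exec c (reveal_pair p s) t s' \<Longrightarrow> t \<le> T \<Longrightarrow> online_run c T s' ps qs \<Longrightarrow>
     online_run c T s (p # ps) (output_path s' # qs)"

inductive_cases online_run_NilE: "online_run c T s [] qs"
inductive_cases online_run_ConsE: "online_run c T s (p # ps) qs"

lemma online_run_deterministic:
  "online_run c T s ps qs \<Longrightarrow> online_run c T s ps qs' \<Longrightarrow> qs = qs'"
proof (induction arbitrary: qs' rule: online_run.induct)
  case online_run_Nil
  then show ?case by (auto elim: online_run_NilE)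
next
  case (online_run_Cons p s t s' ps qs)
  from online_run_Cons.prems obtain u s'' rs
    where "exec c (reveal_pair p s) u s''" "online_run c T s'' ps rs" "qs' = output_path s'' # rs"
    by (auto elim: online_run_ConsE)
  with online_run_Cons.hyps(1) online_run_Cons.IH show ?case
    using exec_deterministic by blast
qed

lemma online_run_prefix:
  "online_run c T s (ps @ ps') qs \<Longrightarrow> online_run c T s ps (take (length ps) qs)"
proof (induction ps arbitrary: s qs)
  case Nil
  then show ?case by (simp add: online_run_Nil)
next
  case (Cons p ps)
  from Cons.prems have "online_run c T s (p # (ps @ ps')) qs"
    by simp
  then obtain t s' rs
    where "exec c (reveal_pair p s) t s'" "t \<le> T" "online_run c T s' (ps @ ps') rs"
      "qs = output_path s' # rs"
    by (rule online_run_ConsE) blast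
  with Cons.IH show ?case by (simp add: online_run_Cons)
qed

end

theory Submission
  imports Defs
begin

text \<open>Let \<open>q = d - 1\<close>, let \<open>M y\<close> be the set of the neighbours of \<open>y\<close> outside \<open>S\<close>, and call \<open>y\<close> crowded by
  a vertex set \<open>Z\<close> if at least half of \<open>M y\<close> lies in \<open>Z\<close>. Because \<open>\<beta> < 2 \<alpha> - 1\<close>, at most
  \<open>\<alpha> deg(y)\<close> edges join \<open>y\<close> to \<open>Z \<union> S\<close> if \<open>y\<close> is not crowded, and to the complement of \<open>Z\<close> if it is.
  Hence the expansion property has two consequences for sets \<open>Y\<close> of at most \<open>n\<close> vertices: if none
  of them is crowded, then \<open>Y\<close> has at least \<open>2 d |Y|\<close> neighbours outside \<open>Z \<union> S\<close>; if all of them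
  are, then \<open>|Z| \<ge> 2 d |Y|\<close>. The threshold mentions neither \<open>\<alpha>\<close> nor \<open>\<beta>\<close>, which the program does
  not know.

  A pair is connected by growing a tree from each end, every inner vertex having \<open>q\<close> children, until
  the last level has at least \<open>n q / 16\<close> vertices; then some edge joins the last levels. Throughout,
  \<open>T\<close> is the set of occupied vertices outside \<open>S\<close> and \<open>D\<close> the set of those vertices that need no
  further children. The invariant is that one can reserve, for all vertices outside \<open>D\<close> that are
  crowded by the occupied and the reserved vertices, disjoint sets of \<open>q\<close> free neighbours.
  To expand \<open>x\<close>, the reservations are computed anew with \<open>x\<close> treated like a crowded vertex, and the
  vertices reserved for \<open>x\<close> become its children. There are never more than \<open>n\<close> claimants, since
  crowded vertices are few by the second consequence, and Hall's condition follows from the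
  invariant and the first one. The reservations are found by an auction, which needs no
  augmenting paths: a claimant takes its cheapest neighbour, possibly from another claimant, and
  raises the price by one. When the path has been found, the rest of the trees is released; this
  keeps the invariant because a released inner vertex gets its children back as its reservation.\<close>

section \<open>Reservations\<close>

lemma card_UN_disjoint_ge:
  fixes A :: "'b \<Rightarrow> 'a set"
  assumes "finite I" "\<And>i. i \<in> I \<Longrightarrow> finite (A i)" "\<And>i. i \<in> I \<Longrightarrow> q \<le> card (A i)"
    and "\<And>i j. i \<in> I \<Longrightarrow> j \<in> I \<Longrightarrow> i \<noteq> j \<Longrightarrow> A i \<inter> A j = {}"
  shows "q * card I \<le> card (\<Union>i\<in>I. A i)"
proof -
  have "q * card I = (\<Sum>i\<in>I. q)"
    by simp
  also have "\<dots> \<le> (\<Sum>i\<in>I. card (A i))"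
    using assms(3) by (intro sum_mono)
  also have "\<dots> = card (\<Union>i\<in>I. A i)"
    using assms(1,2,4) by (subst card_UN_disjoint) auto
  finally show ?thesis .
qed

text \<open>The graph and the set \<open>S\<close> enter only through the sets \<open>M y\<close>,
  so that the auction can be analysed for an abstract expanding set system.\<close>

locale reservation =
  fixes N n d :: nat and M :: "nat \<Rightarrow> nat set"
  assumes M_subset: "y < N \<Longrightarrow> M y \<subseteq> {..<N}"
    and d_ge: "3 \<le> d"
    and n_less: "n < N"
    and n_pos: "0 < n"
    and expand_free: "Y \<subseteq> {..<N} \<Longrightarrow> card Y \<le> n \<Longrightarrow> (\<And>y. y \<in> Y \<Longrightarrow> card (M y \<inter> Z) \<le> card (M y - Z))
      \<Longrightarrow> 2 * d * card Y \<le> card ((\<Union>y\<in>Y. M y) - Z)"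
    and expand_taken: "Y \<subseteq> {..<N} \<Longrightarrow> card Y \<le> n \<Longrightarrow> Z \<subseteq> {..<N}
      \<Longrightarrow> (\<And>y. y \<in> Y \<Longrightarrow> card (M y - Z) \<le> card (M y \<inter> Z)) \<Longrightarrow> 2 * d * card Y \<le> card Z"
begin

abbreviation q :: nat where "q \<equiv> d - 1"

lemma finite_M: "y < N \<Longrightarrow> finite (M y)"
  using M_subset finite_subset by blast

section \<open>Reservations and the invariant of the occupied set\<close>

definition owned :: "(nat \<Rightarrow> nat) \<Rightarrow> nat \<Rightarrow> nat set" where
  "owned f y = {v. v < N \<and> f v = Suc y}"

definition taken :: "nat set \<Rightarrow> (nat \<Rightarrow> nat) \<Rightarrow> nat set" where
  "taken T f = T \<union> {v. v < N \<and> f v \<noteq> 0}"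

definition crowded :: "nat set \<Rightarrow> nat \<Rightarrow> bool" where
  "crowded Z y \<longleftrightarrow> card (M y - Z) \<le> card (M y \<inter> Z)"

text \<open>Owners are stored with an offset: \<open>f v = Suc y\<close> means that \<open>v\<close> is reserved for \<open>y\<close>, and \<open>f v = 0\<close>
  that \<open>v\<close> is not reserved.\<close>

definition good :: "nat set \<Rightarrow> nat set \<Rightarrow> bool" where
  "good T D \<longleftrightarrow> (\<exists>f. (\<forall>v<N. \<forall>y. f v = Suc y \<longrightarrow> v \<in> M y - T) \<and>
     (\<forall>y<N. y \<notin> D \<longrightarrow> q \<le> card (owned f y) \<or> \<not> crowded (taken T f) y))"

lemma finite_owned [simp]: "finite (owned f y)"
  by (simp add: owned_def)

lemma owned_disjoint: "y \<noteq> z \<Longrightarrow> owned f y \<inter> owned f z = {}"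
  by (auto simp: owned_def)

lemma crowded_mono:
  assumes "crowded Z y" "Z \<subseteq> Z'" "y < N"
  shows "crowded Z' y"
proof -
  have "card (M y - Z') \<le> card (M y - Z)" "card (M y \<inter> Z) \<le> card (M y \<inter> Z')"
    using assms finite_M by (auto intro!: card_mono)
  then show ?thesis
    using assms(1) by (simp add: crowded_def)
qed

lemma good_mono: "good T D \<Longrightarrow> D \<subseteq> D' \<Longrightarrow> good T D'"
  unfolding good_def by (meson subsetD)

text \<open>No reservations are needed at the start: the expansion of a singleton gives
  \<open>M y\<close> at least \<open>2 * d\<close> elements, and none of them is taken, so
  \<open>y\<close> is not crowded.\<close>

lemma good_empty: "good {} {}"
proof -
  have "\<not> crowded {} y" if "y < N" for y
  proof -
    have "2 * d * card {y} \<le> card ((\<Union>y\<in>{y}. M y) - {})"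
      using that n_pos by (intro expand_free) auto
    then show ?thesis
      using d_ge by (simp add: crowded_def)
  qed
  then show ?thesis
    unfolding good_def by (intro exI[of _ "\<lambda>_. 0"]) (auto simp: taken_def)
qed

text \<open>Split \<open>Y\<close> by whether \<open>y\<close> holds \<open>q\<close> reserved
  vertices. The reservations of the first part are disjoint and lie inside \<open>taken T f\<close>.
  The second part is uncrowded and expands outside \<open>taken T f\<close>, even by the factor
  \<open>2 * d\<close>, so the two contributions add up.\<close>

lemma good_Hall:
  assumes "good T D" "Y \<subseteq> {..<N} - D" "card Y \<le> n"
  shows "q * card Y \<le> card ((\<Union>y\<in>Y. M y) - T)"
proof -
  obtain f where f: "\<And>v y. v < N \<Longrightarrow> f v = Suc y \<Longrightarrow> v \<in> M y - T"
    and g: "\<And>y. y < N \<Longrightarrow> y \<notin> D \<Longrightarrow> q \<le> card (owned f y) \<or> \<not> crowded (taken T f) y"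
    using assms(1) unfolding good_def by blast
  define Y1 where "Y1 = {y \<in> Y. q \<le> card (owned f y)}"
  define Y2 where "Y2 = Y - Y1"
  define A where "A = (\<Union>y\<in>Y1. owned f y)"
  define B where "B = (\<Union>y\<in>Y2. M y) - taken T f"
  have finY: "finite Y"
    using assms(2) finite_subset by blast
  have fin: "finite Y1" "finite Y2"
    using finY by (auto simp: Y1_def Y2_def)
  have card_A: "q * card Y1 \<le> card A"
    unfolding A_def using fin owned_disjoint by (intro card_UN_disjoint_ge) (auto simp: Y1_def)
  have "card Y2 \<le> n"
    using assms(3) card_mono[OF finY, of Y2] by (auto simp: Y2_def)
  moreover have "card (M y \<inter> taken T f) \<le> card (M y - taken T f)" if "y \<in> Y2" for y
    using g[of y] that assms(2) by (auto simp: Y2_def Y1_def crowded_def)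
  ultimately have "2 * d * card Y2 \<le> card B"
    unfolding B_def using assms(2) by (intro expand_free) (auto simp: Y2_def)
  then have card_B: "q * card Y2 \<le> card B"
    by (rule order_trans[rotated]) (simp add: le_diff_conv)
  have sub: "A \<union> B \<subseteq> (\<Union>y\<in>Y. M y) - T"
    using f by (fastforce simp: A_def B_def Y1_def Y2_def owned_def taken_def)
  have "A \<inter> B = {}"
    by (auto simp: A_def B_def owned_def taken_def)
  have finM: "finite (\<Union>y\<in>Y. M y)"
    using finY finite_M assms(2) by blast
  have "q * card Y = q * card Y1 + q * card Y2"
    using fin finY card_Diff_subset[of Y1 Y] card_mono[of Y Y1]
    by (simp add: Y2_def Y1_def flip: distrib_left)
  also have "\<dots> \<le> card A + card B"
    using card_A card_B by simp
  also have "\<dots> = card (A \<union> B)"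
    using \<open>A \<inter> B = {}\<close> finM sub by (subst card_Un_disjoint) (auto intro: finite_subset)
  also have "\<dots> \<le> card ((\<Union>y\<in>Y. M y) - T)"
    using sub finM by (intro card_mono) auto
  finally show ?thesis .
qed

section \<open>The auction for reservations\<close>

definition demands :: "nat set \<Rightarrow> nat set \<Rightarrow> nat \<Rightarrow> (nat \<Rightarrow> nat) \<Rightarrow> nat set" where
  "demands T D x f = {y. y < N \<and> y \<notin> D \<and> (y = x \<or> crowded (taken T f) y)}"

text \<open>The clause on \<open>p w\<close> is approximate complementary slackness: what a claimant
  holds costs at most one unit more than its cheapest usable neighbour. A vertex with positive price
  is owned because the auction never sets a vertex free. The bound on the number of owners is part
  of the invariant to avoid a circle: it limits the taken vertices, which limits the claimants,
  which in turn limits the owners after the next bid.\<close>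

definition auction :: "nat set \<Rightarrow> nat set \<Rightarrow> nat \<Rightarrow> (nat \<Rightarrow> nat) \<Rightarrow> (nat \<Rightarrow> nat) \<Rightarrow> bool" where
  "auction T D x f p \<longleftrightarrow>
     (\<forall>v<N. \<forall>y. f v = Suc y \<longrightarrow> y \<in> demands T D x f \<and> v \<in> M y - T \<and> card (owned f y) \<le> q \<and>
        (\<forall>w\<in>M y - T. p v \<le> Suc (p w))) \<and>
     (\<forall>v<N. 0 < p v \<longrightarrow> f v \<noteq> 0) \<and> (\<forall>v<N. p v \<le> n) \<and> card {y. \<exists>v<N. f v = Suc y} \<le> n"

lemma auction_init:
  assumes "\<And>v. v < N \<Longrightarrow> f v = 0" "\<And>v. v < N \<Longrightarrow> p v = 0"
  shows "auction T D x f p"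
  using assms by (simp add: auction_def cong: conj_cong)

lemma card_owners_bound:
  assumes "auction T D x f p"
  shows "card {v. v < N \<and> f v \<noteq> 0} \<le> q * n"
proof -
  define A where "A = {y. \<exists>v<N. f v = Suc y}"
  have "A = (\<lambda>v. f v - 1) ` {v. v < N \<and> f v \<noteq> 0}"
    by (force simp: A_def image_iff)
  then have fin: "finite A"
    by simp
  have "{v. v < N \<and> f v \<noteq> 0} = (\<Union>y\<in>A. owned f y)"
    by (auto simp: A_def owned_def gr0_conv_Suc)
  then have "card {v. v < N \<and> f v \<noteq> 0} \<le> (\<Sum>y\<in>A. card (owned f y))"
    using fin by (simp add: card_UN_le)
  also have "\<dots> \<le> (\<Sum>y\<in>A. q)"
    using assms by (intro sum_mono) (auto simp: auction_def A_def)
  also have "\<dots> \<le> q * n"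
    using assms by (simp add: auction_def A_def)
  finally show ?thesis .
qed

text \<open>If \<open>n\<close> vertices were crowded, \<open>expand_taken\<close> would force
  \<open>2 * d * n\<close> taken vertices, whereas \<open>T\<close> and the at most
  \<open>q * n\<close> reservations together number less than
  \<open>(d + 1) * n + (d - 1) * n\<close>. So fewer than \<open>n\<close> vertices are crowded, and
  \<open>x\<close> adds at most one.\<close>

lemma card_demands:
  assumes "auction T D x f p" "T \<subseteq> {..<N}" "card T < (d + 1) * n"
  shows "card (demands T D x f) \<le> n"
proof -
  define C where "C = {y. y < N \<and> crowded (taken T f) y}"
  have "card C < n"
  proof (rule ccontr)
    assume "\<not> card C < n"
    then obtain Y where Y: "Y \<subseteq> C" "card Y = n"
      by (meson not_less obtain_subset_with_card_n)
    have "2 * d * card Y \<le> card (taken T f)"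
      using Y assms(2) by (intro expand_taken) (auto simp: C_def taken_def crowded_def)
    also have "\<dots> \<le> card T + q * n"
      using card_Un_le[of T "{v. v < N \<and> f v \<noteq> 0}"] card_owners_bound[OF assms(1)]
      by (simp add: taken_def)
    also have "\<dots> < (d + 1) * n + q * n"
      using assms(3) by simp
    also have "\<dots> = 2 * d * n"
      using d_ge by (cases d) (auto simp: algebra_simps)
    finally show False
      using Y by simp
  qed
  have "demands T D x f \<subseteq> insert x C"
    by (auto simp: demands_def C_def)
  then have "card (demands T D x f) \<le> card (insert x C)"
    by (intro card_mono) (auto simp: C_def)
  also have "\<dots> \<le> Suc (card C)"
    by (simp add: card_insert_if C_def)
  finally show ?thesis
    using \<open>card C < n\<close> by simp
qed

text \<open>Going from a lacking bidder to the owners of the vertices it could take, and so on, lowers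
  the prices by at most one per step, while by the Hall condition a new bidder appears in each
  step as long as the prices are positive.\<close>

lemma auction_price_bound:
  assumes auc: "auction T D x f p" and T: "T \<subseteq> {..<N}" "card T < (d + 1) * n" and "good T D"
    and y: "y \<in> demands T D x f" "card (owned f y) < q"
    and L: "\<And>w. w \<in> M y - T \<Longrightarrow> L \<le> p w"
  shows "L < n"
proof -
  note dem = card_demands[OF auc T]
  have fin_dem: "finite (demands T D x f)"
    by (simp add: demands_def)
  have "\<exists>X. X \<subseteq> demands T D x f \<and> y \<in> X \<and> card X = Suc j \<and> (\<forall>z\<in>X. \<forall>w\<in>M z - T. L - j \<le> p w)"
    if "j \<le> L" for j
    using that
  proof (induction j)
    case 0
    show ?case
      using y L by (intro exI[of _ "{y}"]) auto
  next
    case (Suc j)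
    from Suc.IH[OF Suc_leD[OF Suc.prems]]
    obtain X where X: "X \<subseteq> demands T D x f" "y \<in> X" "card X = Suc j"
      and low: "\<And>z w. z \<in> X \<Longrightarrow> w \<in> M z - T \<Longrightarrow> L - j \<le> p w"
      by blast
    have fin_X: "finite X"
      using X(1) fin_dem finite_subset by blast
    have X_N: "X \<subseteq> {..<N} - D"
      using X(1) by (auto simp: demands_def)
    \<comment> \<open>If every usable vertex of \<open>X\<close> were owned inside \<open>X\<close>,
      there would be fewer than \<open>q * card X\<close> of them, since \<open>y\<close> lacks one;
      this contradicts \<open>good_Hall\<close>.\<close>
    obtain z w where zw: "z \<in> X" "w \<in> M z - T" "\<And>u. u \<in> X \<Longrightarrow> w \<notin> owned f u"
    proof (rule ccontr)
      assume "\<not> thesis"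
      with that have "(\<Union>z\<in>X. M z) - T \<subseteq> (\<Union>u\<in>X. owned f u)"
        by blast
      then have "card ((\<Union>z\<in>X. M z) - T) \<le> card (\<Union>u\<in>X. owned f u)"
        using fin_X by (intro card_mono) auto
      also have "\<dots> \<le> (\<Sum>u\<in>X. card (owned f u))"
        using fin_X by (rule card_UN_le)
      also have "\<dots> < (\<Sum>u\<in>X. q)"
      proof (rule sum_strict_mono_ex1[OF fin_X])
        have "card (owned f u) \<le> q" for u
        proof (cases "owned f u = {}")
          case False
          then show ?thesis
            using auc by (auto simp: auction_def owned_def)
        qed simp
        then show "\<forall>u\<in>X. card (owned f u) \<le> q"
          by blast
        show "\<exists>u\<in>X. card (owned f u) < q"
          using X(2) y(2) by blast
      qed
      also have "\<dots> = q * card X"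
        by simp
      also have "\<dots> \<le> card ((\<Union>z\<in>X. M z) - T)"
        using X(1) X_N dem card_mono[OF fin_dem X(1)] by (intro good_Hall[OF \<open>good T D\<close>]) auto
      finally show False
        by simp
    qed
    \<comment> \<open>\<open>j < L\<close> keeps this price positive, so \<open>w\<close> has an
      owner \<open>u\<close>; slackness for \<open>u\<close> weakens the lower bound on prices by
      just one.\<close>
    have w: "w < N" "0 < p w"
      using zw(1,2) X_N M_subset low[OF zw(1,2)] Suc.prems by fastforce+
    then obtain u where u: "f w = Suc u"
      using auc by (metis auction_def not0_implies_Suc)
    then have u': "u \<in> demands T D x f" "\<And>w'. w' \<in> M u - T \<Longrightarrow> p w \<le> Suc (p w')"
      using auc w(1) by (auto simp: auction_def)
    have "u \<notin> X"
      using zw(3) u w(1) by (auto simp: owned_def)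
    moreover have "L - Suc j \<le> p w'" if "w' \<in> M u - T" for w'
      using u'(2)[OF that] low[OF zw(1,2)] by linarith
    moreover have "L - Suc j \<le> p w'" if "v \<in> X" "w' \<in> M v - T" for v w'
      using low[OF that] by linarith
    ultimately show ?case
      using X u'(1) fin_X by (intro exI[of _ "insert u X"]) auto
  qed
  from this[of L] obtain X where "X \<subseteq> demands T D x f" "card X = Suc L"
    by auto
  then show ?thesis
    using card_mono[OF fin_dem, of X] dem by simp
qed

lemma taken_update:
  assumes "b < N"
  shows "taken T (f(b := Suc y)) = insert b (taken T f)"
  using assms by (auto simp: taken_def)

lemma owned_update:
  assumes "b < N"
  shows "owned (f(b := Suc y)) z = (if z = y then insert b (owned f z) else owned f z - {b})"
  using assms by (auto simp: owned_def)

text \<open>Prices and the taken set only grow, so old slackness inequalities and old claims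
  persist, and \<open>b\<close> obeys slackness at its new price because it was cheapest. The price
  cap follows from \<open>auction_price_bound\<close> with \<open>L = p b\<close>. All new owners
  lie in the old set of claimants, which has at most \<open>n\<close> members.\<close>

lemma auction_step:
  assumes auc: "auction T D x f p" and T: "T \<subseteq> {..<N}" "card T < (d + 1) * n" and "good T D"
    and y: "y \<in> demands T D x f" "card (owned f y) < q"
    and b: "b \<in> M y - T" and min: "\<And>w. w \<in> M y - T \<Longrightarrow> p b \<le> p w"
  shows "auction T D x (f(b := Suc y)) (p(b := Suc (p b)))"
proof -
  let ?f = "f(b := Suc y)" and ?p = "p(b := Suc (p b))"
  have yN: "y < N"
    using y(1) by (simp add: demands_def)
  have bN: "b < N"
    using b M_subset[OF yN] by auto
  have sub: "demands T D x f \<subseteq> demands T D x ?f"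
    using taken_update[OF bN, of T f y] crowded_mono[of "taken T f" _ "taken T ?f"]
    by (auto simp: demands_def)
  have pb: "p b < n"
    using auction_price_bound[OF auc T \<open>good T D\<close> y] min by blast
  have "u \<in> demands T D x ?f \<and> v \<in> M u - T \<and> card (owned ?f u) \<le> q \<and>
      (\<forall>w\<in>M u - T. ?p v \<le> Suc (?p w))" if v: "v < N" "?f v = Suc u" for v u
  proof -
    have card_le: "card (owned ?f u) \<le> q" if "card (owned f u) \<le> q"
    proof (cases "u = y")
      \<comment> \<open>\<open>b\<close> may already belong to \<open>y\<close>; then the bid raises
        its price and nothing else.\<close>
      case True
      then show ?thesis
        using y(2) by (simp add: owned_update[OF bN] card_insert_if)
    next
      case False
      then show ?thesis
        using that card_Diff1_le[of "owned f u" b] by (simp add: owned_update[OF bN] del: card_Diff_insert)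
    qed
    show ?thesis
    proof (cases "v = b")
      case True
      then have "u = y"
        using v by simp
      have "?p v \<le> Suc (?p w)" if "w \<in> M y - T" for w
        using min[OF that] True by simp
      then show ?thesis
        using True \<open>u = y\<close> y sub b card_le by auto
    next
      case False
      then have "u \<in> demands T D x f" "v \<in> M u - T" "card (owned f u) \<le> q"
        "\<forall>w\<in>M u - T. p v \<le> Suc (p w)"
        using auc v by (auto simp: auction_def)
      then show ?thesis
        using False sub card_le by (auto simp: le_Suc_eq)
    qed
  qed
  moreover have "\<forall>v<N. 0 < ?p v \<longrightarrow> ?f v \<noteq> 0"
    using auc by (auto simp: auction_def)
  moreover have "\<forall>v<N. ?p v \<le> n"
    using auc pb by (auto simp: auction_def)
  moreover have "card {u. \<exists>v<N. ?f v = Suc u} \<le> n"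
  proof -
    have "{u. \<exists>v<N. ?f v = Suc u} \<subseteq> demands T D x f"
      using auc y(1) by (auto simp: auction_def split: if_splits)
    then have "card {u. \<exists>v<N. ?f v = Suc u} \<le> card (demands T D x f)"
      by (intro card_mono) (auto simp: demands_def)
    then show ?thesis
      using card_demands[OF auc T] by linarith
  qed
  ultimately show ?thesis
    by (auto simp: auction_def)
qed

lemma demand_nonempty:
  assumes "good T D" "y < N" "y \<notin> D"
  shows "M y - T \<noteq> {}"
proof -
  have "q * card {y} \<le> card ((\<Union>y\<in>{y}. M y) - T)"
    using assms n_pos by (intro good_Hall) auto
  then show ?thesis
    using d_ge by (intro notI) auto
qed

text \<open>The vertices reserved for \<open>x\<close> change from reserved to occupied. This leaves
  the taken set, and with it crowdedness, unchanged, and the reservations of all other vertices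
  survive.\<close>

lemma auction_final:
  assumes auc: "auction T D x f p" and x: "x < N" "x \<notin> D"
    and fin: "\<And>y. y \<in> demands T D x f \<Longrightarrow> q \<le> card (owned f y)"
  shows "card (owned f x) = q" "owned f x \<subseteq> M x - T" "good (T \<union> owned f x) (insert x D)"
proof -
  have x': "x \<in> demands T D x f"
    using x by (simp add: demands_def)
  have "owned f x \<noteq> {}"
    using fin[OF x'] d_ge by auto
  then have "card (owned f x) \<le> q"
    using auc by (auto simp: auction_def owned_def)
  then show "card (owned f x) = q"
    using fin[OF x'] by simp
  show "owned f x \<subseteq> M x - T"
    using auc by (auto simp: auction_def owned_def)
  define g where "g v = (if f v = Suc x then 0 else f v)" for v
  have 1: "owned g y = owned f y" if "y \<noteq> x" for y
    using that by (auto simp: owned_def g_def)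
  have 2: "taken (T \<union> owned f x) g = taken T f"
    by (auto simp: taken_def owned_def g_def)
  show "good (T \<union> owned f x) (insert x D)"
    unfolding good_def
  proof (intro exI[of _ g] conjI allI impI)
    fix v y assume "v < N" "g v = Suc y"
    then show "v \<in> M y - (T \<union> owned f x)"
      using auc by (auto simp: g_def auction_def owned_def split: if_splits)
  next
    fix y assume "y < N" "y \<notin> insert x D"
    then show "q \<le> card (owned g y) \<or> \<not> crowded (taken (T \<union> owned f x) g) y"
      using fin[of y] by (auto simp: 1 2 demands_def)
  qed
qed

text \<open>As every bid raises this sum by one, the bound limits the number of bids and determines
  the number of sweeps in \<open>expand\<close>.\<close>

lemma auction_total_price:
  assumes "auction T D x f p"
  shows "(\<Sum>v<N. p v) < N * N"
proof -
  have "(\<Sum>v<N. p v) \<le> N * n"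
    using sum_bounded_above[of "{..<N}" p n] assms by (auto simp: auction_def)
  also have "\<dots> < N * N"
    using n_less by simp
  finally show ?thesis .
qed

text \<open>A released vertex with \<open>g v = Suc y\<close> becomes a reservation for
  \<open>y\<close>, so a vertex leaving \<open>D\<close> owns its former children. The taken set
  does not grow; hence an uncrowded vertex stays uncrowded.\<close>

lemma good_release:
  assumes "good T D" "T' \<subseteq> T" "D' \<subseteq> D"
    and child: "\<And>y. y \<in> D - D' \<Longrightarrow> y < N \<Longrightarrow> q \<le> card {v. v < N \<and> v \<in> T - T' \<and> g v = Suc y}"
    and nb: "\<And>v y. v < N \<Longrightarrow> v \<in> T - T' \<Longrightarrow> g v = Suc y \<Longrightarrow> v \<in> M y"
  shows "good T' D'"
proof -
  obtain f where f: "\<And>v y. v < N \<Longrightarrow> f v = Suc y \<Longrightarrow> v \<in> M y - T"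
    and f': "\<And>y. y < N \<Longrightarrow> y \<notin> D \<Longrightarrow> q \<le> card (owned f y) \<or> \<not> crowded (taken T f) y"
    using assms(1) unfolding good_def by blast
  define h where "h v = (if v \<in> T - T' then g v else if v \<in> T' then 0 else f v)" for v
  have notT: "v \<notin> T" if "v < N" "f v \<noteq> 0" for v
    using f[OF that(1)] that(2) not0_implies_Suc[OF that(2)] by blast
  have tk: "taken T' h \<subseteq> taken T f"
    using assms(2) by (auto simp: taken_def h_def split: if_splits)
  have own: "owned f y \<subseteq> owned h y" for y
    using notT assms(2) by (fastforce simp: owned_def h_def)
  show ?thesis
    unfolding good_def
  proof (intro exI[of _ h] conjI allI impI)
    fix v y assume "v < N" "h v = Suc y"
    then show "v \<in> M y - T'"
      using f nb assms(2) by (auto simp: h_def split: if_splits)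
  next
    fix y assume y: "y < N" "y \<notin> D'"
    show "q \<le> card (owned h y) \<or> \<not> crowded (taken T' h) y"
    proof (cases "y \<in> D")
      case True
      have "q \<le> card {v. v < N \<and> v \<in> T - T' \<and> g v = Suc y}"
        using child True y by simp
      also have "\<dots> \<le> card (owned h y)"
        by (intro card_mono) (auto simp: owned_def h_def)
      finally show ?thesis
        by simp
    next
      case False
      then show ?thesis
        using f'[OF y(1) False] card_mono[OF _ own] crowded_mono[OF _ tk y(1)]
        by (meson finite_owned order_trans)
    qed
  qed
qed

end

section \<open>Loop programs\<close>

text \<open>The only loop runs its counter \<open>Aux k\<close> through
  \<open>0, ..., N - 1\<close>. Termination is thus built in, and a polynomial time bound can be
  read off the syntax.\<close>

datatype loop_prog =
    LSkip
  | LSet array exp exp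
  | LSeq loop_prog loop_prog (infixr ";;" 60)
  | LIf exp loop_prog loop_prog
  | LFor nat loop_prog

abbreviation cell :: "array \<Rightarrow> exp" where
  "cell A \<equiv> Get A (Lit 0)"

primrec compile :: "loop_prog \<Rightarrow> com" where
  "compile LSkip = Skip"
| "compile (LSet A i e) = Assign A i e"
| "compile (LSeq p p') = Seq (compile p) (compile p')"
| "compile (LIf b p p') = Cond b (compile p) (compile p')"
| "compile (LFor k p) = Seq (Assign (Aux k) (Lit 0) (Lit 0))
     (While (Minus (cell Order) (cell (Aux k)))
       (Seq (compile p) (Assign (Aux k) (Lit 0) (Plus (cell (Aux k)) (Lit 1)))))"

definition put :: "array \<Rightarrow> nat \<Rightarrow> nat \<Rightarrow> store \<Rightarrow> store" where
  "put A i x s = s(A := (s A)(i := x))"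

lemma put_same [simp]: "put A i x s A = (s A)(i := x)"
  and put_other [simp]: "B \<noteq> A \<Longrightarrow> put A i x s B = s B"
  by (simp_all add: put_def)

primrec run :: "nat \<Rightarrow> loop_prog \<Rightarrow> store \<Rightarrow> store" where
  "run N LSkip s = s"
| "run N (LSet A i e) s = put A (exp_val i s) (exp_val e s) s"
| "run N (LSeq p p') s = run N p' (run N p s)"
| "run N (LIf b p p') s = (if exp_val b s \<noteq> 0 then run N p s else run N p' s)"
| "run N (LFor k p) s =
     fold (\<lambda>i t. put (Aux k) 0 (Suc i) (run N p t)) [0..<N] (put (Aux k) 0 0 s)"

text \<open>The two branches of a conditional are added, an upper bound that stays a polynomial. In
  a loop, each round pays for the body, a test and an increment; the remaining \<open>2\<close> are
  the initial assignment and the failing test.\<close>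

primrec cost :: "loop_prog \<Rightarrow> nat poly" where
  "cost LSkip = 1"
| "cost (LSet A i e) = 1"
| "cost (LSeq p p') = cost p + cost p'"
| "cost (LIf b p p') = cost p + cost p' + 1"
| "cost (LFor k p) = 2 + monom 1 1 * (cost p + 2)"

primrec writes :: "loop_prog \<Rightarrow> array set" where
  "writes LSkip = {}"
| "writes (LSet A i e) = {A}"
| "writes (LSeq p p') = writes p \<union> writes p'"
| "writes (LIf b p p') = writes p \<union> writes p'"
| "writes (LFor k p) = insert (Aux k) (writes p)"

text \<open>No program may change the loop bound \<open>Order\<close>, and no loop body its own
  counter; under these conditions the \<open>While\<close> loop of \<open>compile\<close> makes
  exactly the iterations of \<open>run\<close>.\<close>

primrec safe :: "loop_prog \<Rightarrow> bool" where
  "safe LSkip = True"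
| "safe (LSet A i e) = (A \<noteq> Order)"
| "safe (LSeq p p') = (safe p \<and> safe p')"
| "safe (LIf b p p') = (safe p \<and> safe p')"
| "safe (LFor k p) = (safe p \<and> Aux k \<notin> writes p)"

section \<open>The invariant rule for loops and the correctness of the translation\<close>

lemma fold_upt_induct:
  assumes "I 0 s" "\<And>i t. i < N \<Longrightarrow> I i t \<Longrightarrow> I (Suc i) (f i t)"
  shows "I N (fold f [0..<N] s)"
proof -
  have "I k (fold f [0..<k] s)" if "k \<le> N" for k
    using that assms by (induction k) auto
  then show ?thesis
    by simp
qed

lemma run_frame: "A \<notin> writes p \<Longrightarrow> run N p s A = s A"
proof (induction p arbitrary: s)
  case (LFor k p)
  then show ?case
    by (auto intro: fold_upt_induct[where I = "\<lambda>_ t. t A = s A"])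
qed auto

text \<open>The value of the counter and the unchanged arrays are supplied to the induction step, so
  \<open>I\<close> has to describe only what the loop writes.\<close>

lemma run_For:
  assumes "I 0 (put (Aux k) 0 0 s)"
    and "\<And>i t. i < N \<Longrightarrow> t (Aux k) 0 = i \<Longrightarrow> (\<And>A. A \<notin> writes (LFor k p) \<Longrightarrow> t A = s A) \<Longrightarrow> I i t
      \<Longrightarrow> I (Suc i) (put (Aux k) 0 (Suc i) (run N p t))"
  shows "I N (run N (LFor k p) s)"
proof -
  let ?J = "\<lambda>i t. I i t \<and> t (Aux k) 0 = i \<and> (\<forall>A. A \<notin> writes (LFor k p) \<longrightarrow> t A = s A)"
  have "?J N (fold (\<lambda>i t. put (Aux k) 0 (Suc i) (run N p t)) [0..<N] (put (Aux k) 0 0 s))"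
  proof (rule fold_upt_induct[where I = ?J])
    show "?J 0 (put (Aux k) 0 0 s)"
      using assms(1) by simp
    fix i t assume "i < N" "?J i t"
    then show "?J (Suc i) (put (Aux k) 0 (Suc i) (run N p t))"
      using assms(2)[of i t] by (simp add: run_frame)
  qed
  then show ?thesis
    by simp
qed

lemma safe_Order: "safe p \<Longrightarrow> Order \<notin> writes p"
  by (induction p) auto

lemma compile_correct:
  assumes "safe p" "s Order 0 = N"
  shows "\<exists>t\<le>poly (cost p) N. exec (compile p) s t (run N p s)"
  using assms
proof (induction p arbitrary: s)
  case LSkip
  then show ?case
    by (auto intro!: exI[of _ 1] exec_Skip)
next
  case (LSet A i e)
  have "exec (Assign A i e) s 1 (put A (exp_val i s) (exp_val e s) s)"
    unfolding put_def by (rule exec_Assign)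
  then show ?case
    by auto
next
  case (LSeq p p')
  then have "run N p s Order 0 = N"
    by (simp add: run_frame safe_Order)
  then obtain t t' where "exec (compile p) s t (run N p s)" "t \<le> poly (cost p) N"
    "exec (compile p') (run N p s) t' (run N p' (run N p s))" "t' \<le> poly (cost p') N"
    using LSeq.IH(1)[of s] LSeq.IH(2)[of "run N p s"] LSeq.prems by auto
  then show ?case
    by (intro exI[of _ "t + t'"]) (simp add: exec_Seq)
next
  case (LIf b p p')
  obtain t where "exec (compile p) s t (run N p s)" "t \<le> poly (cost p) N"
    using LIf by auto
  moreover obtain t' where "exec (compile p') s t' (run N p' s)" "t' \<le> poly (cost p') N"
    using LIf by auto
  ultimately have "exec (compile (LIf b p p')) s (if exp_val b s = 0 then t' + 1 else t + 1) (run N (LIf b p p') s)"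
    "(if exp_val b s = 0 then t' + 1 else t + 1) \<le> poly (cost (LIf b p p')) N"
    by (auto intro: exec_Cond_True[simplified] exec_Cond_False[simplified])
  then show ?case
    by blast
next
  case (LFor k p)
  let ?b = "Minus (cell Order) (cell (Aux k))"
  let ?inc = "Assign (Aux k) (Lit 0) (Plus (cell (Aux k)) (Lit 1))"
  let ?c = "Seq (compile p) ?inc"
  let ?g = "\<lambda>i t. put (Aux k) 0 (Suc i) (run N p t)"
  define B where "B = poly (cost p) N + 2"
  \<comment> \<open>Induction on the number of remaining iterations; the \<open>1\<close> pays for
    the last, failing test.\<close>
  have "\<exists>t\<le>1 + (N - j) * B. exec (While ?b ?c) s' t (fold ?g [j..<N] s')"
    if "j \<le> N" "s' Order 0 = N" "s' (Aux k) 0 = j" for j s'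
    using that
  proof (induction "N - j" arbitrary: j s')
    case 0
    then show ?case
      by (auto intro!: exI[of _ "Suc 0"] exec_While_False[simplified])
  next
    case (Suc m)
    have eq: "[j..<N] = j # [Suc j..<N]"
      using Suc.hyps(2) by (intro upt_conv_Cons) linarith
    obtain t where t: "exec (compile p) s' t (run N p s')" "t \<le> poly (cost p) N"
      using LFor Suc.prems by auto
    have k: "run N p s' (Aux k) 0 = j" "run N p s' Order 0 = N"
      using LFor.prems Suc.prems by (simp_all add: run_frame safe_Order)
    have "exec ?inc (run N p s') 1 (?g j s')"
      using exec_Assign[of "Aux k" "Lit 0" "Plus (cell (Aux k)) (Lit 1)" "run N p s'"] k
      by (simp add: put_def)
    then have 1: "exec ?c s' (t + 1) (?g j s')"
      using t by (intro exec_Seq)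
    have step: "m = N - Suc j" "Suc j \<le> N" "?g j s' Order 0 = N" "?g j s' (Aux k) 0 = Suc j"
      using Suc.hyps(2) k by auto
    obtain t' where t': "exec (While ?b ?c) (?g j s') t' (fold ?g [Suc j..<N] (?g j s'))"
        "t' \<le> 1 + (N - Suc j) * B"
      using Suc.hyps(1)[of "Suc j" "?g j s'", OF step] by blast
    have "exec (While ?b ?c) s' (t + 1 + t' + 1) (fold ?g [j..<N] s')"
    proof (rule exec_While_True[OF _ 1])
      show "exp_val ?b s' \<noteq> 0"
        using Suc.prems Suc.hyps(2) by simp
      show "exec (While ?b ?c) (?g j s') t' (fold ?g [j..<N] s')"
        using t'(1) by (simp add: eq)
    qed
    moreover have "t + 1 + t' + 1 \<le> 1 + (N - j) * B"
      using t(2) t'(2) by (simp add: B_def flip: Suc.hyps(2) step(1))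
    ultimately show ?case
      by blast
  qed
  from this[of 0 "put (Aux k) 0 0 s"] obtain t where t: "t \<le> 1 + N * B"
      and "exec (While ?b ?c) (put (Aux k) 0 0 s) t (run N (LFor k p) s)"
    using LFor.prems by auto
  moreover have "exec (Assign (Aux k) (Lit 0) (Lit 0)) s 1 (put (Aux k) 0 0 s)"
    using exec_Assign[of "Aux k" "Lit 0" "Lit 0" s] by (simp add: put_def)
  ultimately have "exec (compile (LFor k p)) s (1 + t) (run N (LFor k p) s)"
    unfolding compile.simps by (intro exec_Seq)
  moreover have "1 + t \<le> poly (cost (LFor k p)) N"
    using t by (simp add: B_def poly_monom)
  ultimately show ?case
    by blast
qed

section \<open>The auction as a program\<close>

abbreviation "Kept \<equiv> Aux 0"
abbreviation "Parent \<equiv> Aux 18"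
abbreviation "Dead \<equiv> Aux 2"
abbreviation "Row \<equiv> Aux 3"
abbreviation "Owner \<equiv> Aux 4"
abbreviation "Price \<equiv> Aux 5"
abbreviation "LevA \<equiv> Aux 6"
abbreviation "LevB \<equiv> Aux 7"
abbreviation "Goal \<equiv> Aux 8"
abbreviation "Width \<equiv> Aux 9"
abbreviation "Next \<equiv> Aux 10"
abbreviation "Height \<equiv> Aux 11"
abbreviation "TakenNb \<equiv> Aux 12"
abbreviation "FreeNb \<equiv> Aux 13"
abbreviation "Count \<equiv> Aux 14"
abbreviation "Best \<equiv> Aux 15"
abbreviation "EndA \<equiv> Aux 16"
abbreviation "EndB \<equiv> Aux 17"
abbreviation "vV \<equiv> Aux 20"
abbreviation "vY \<equiv> Aux 21"
abbreviation "vX \<equiv> Aux 24"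
abbreviation "vL \<equiv> Aux 25"
abbreviation "vI \<equiv> Aux 26"

text \<open>The matrix is stored row by row. As the machine cannot multiply, the offset
  \<open>y * N\<close> of row \<open>y\<close> is looked up in \<open>Row\<close>.\<close>

definition adj :: "array \<Rightarrow> array \<Rightarrow> exp" where
  "adj A B = Get Adjacency (Plus (Get Row (cell A)) (cell B))"

definition differ :: "exp \<Rightarrow> exp \<Rightarrow> exp" where
  "differ e f = Plus (Minus e f) (Minus f e)"

text \<open>The value is the minimum, so it is nonzero iff both values are.\<close>

definition both :: "exp \<Rightarrow> exp \<Rightarrow> exp" where
  "both e f = Minus e (Minus e f)"

definition incr :: "array \<Rightarrow> loop_prog" where
  "incr A = LSet A (Lit 0) (Plus (cell A) (Lit 1))"

abbreviation succ :: "exp \<Rightarrow> exp" where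
  "succ e \<equiv> Plus e (Lit 1)"

lemma differ_val [simp]: "exp_val (differ e f) s = 0 \<longleftrightarrow> exp_val e s = exp_val f s"
  by (auto simp: differ_def)

lemma both_val [simp]: "exp_val (both e f) s = 0 \<longleftrightarrow> exp_val e s = 0 \<or> exp_val f s = 0"
  by (auto simp: both_def)

lemma run_incr [simp]: "run N (incr A) s = put A 0 (Suc (s A 0)) s"
  by (simp add: incr_def)

lemma writes_incr [simp]: "writes (incr A) = {A}"
  by (simp add: incr_def)

text \<open>A nonzero \<open>Parent\<close> marks an occupied vertex and a nonzero
  \<open>Owner\<close> one held in the auction, so \<open>TakenNb\<close> and \<open>FreeNb\<close>
  are the two numbers compared in \<open>crowded\<close>.\<close>

definition scan :: loop_prog where
  "scan = LSet TakenNb (Lit 0) (Lit 0) ;; LSet FreeNb (Lit 0) (Lit 0) ;; LSet Count (Lit 0) (Lit 0) ;;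
     LFor 20
       (LIf (adj vY vV)
          (LIf (Get Reserved (cell vV)) LSkip
            (LIf (Plus (Get Parent (cell vV)) (Get Owner (cell vV))) (incr TakenNb) (incr FreeNb)))
          LSkip ;;
        LIf (differ (Get Owner (cell vV)) (succ (cell vY))) LSkip (incr Count))"

text \<open>The cell \<open>N\<close> of \<open>Price\<close> is a sentinel that exceeds the prices of all vertices.\<close>

definition select :: loop_prog where
  "select = LSet Best (Lit 0) (cell Order) ;;
     LFor 20
       (LIf (adj vY vV)
          (LIf (Plus (Get Reserved (cell vV)) (Get Parent (cell vV))) LSkip
            (LIf (Minus (Get Price (cell Best)) (Get Price (cell vV)))
               (LSet Best (Lit 0) (cell vV)) LSkip))
          LSkip)"

text \<open>The guards together say that \<open>y\<close> is a claimant in the sense of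
  \<open>demands\<close> with fewer than \<open>q\<close> vertices; the compound one skips a
  \<open>y\<close> that differs from \<open>x\<close> and is not crowded.\<close>

definition bid :: loop_prog where
  "bid = LIf (Get Dead (cell vY)) LSkip
     (scan ;;
      LIf (Minus (Minus (cell Degree_Bound) (Lit 1)) (cell Count))
        (LIf (both (differ (cell vY) (cell vX)) (Minus (cell FreeNb) (cell TakenNb))) LSkip
          (select ;;
           LSet Owner (cell Best) (succ (cell vY)) ;;
           LSet Price (cell Best) (succ (Get Price (cell Best)))))
        LSkip)"

text \<open>The counters 22 and 23 serve only to repeat the sweep over all \<open>y\<close> for
  \<open>N * N\<close> times, which is enough because an unsettled sweep raises the total
  price.\<close>

definition expand :: "array \<Rightarrow> loop_prog" where
  "expand lev =
     LFor 20 (LSet Owner (cell vV) (Lit 0) ;; LSet Price (cell vV) (Lit 0)) ;;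
     LSet Price (cell Order) (succ (cell Order)) ;;
     LFor 22 (LFor 23 (LFor 21 bid)) ;;
     LFor 20
       (LIf (differ (Get Owner (cell vV)) (succ (cell vX))) LSkip
         (LSet Parent (cell vV) (succ (cell vX)) ;;
          LSet lev (cell vV) (succ (Get lev (cell vX))))) ;;
     LSet Dead (cell vX) (Lit 1)"

lemma writes_scan: "writes scan = {TakenNb, FreeNb, Count, vV}"
  by (auto simp: scan_def)

lemma writes_select: "writes select = {Best, vV}"
  by (auto simp: select_def)

lemma writes_bid: "writes bid = {TakenNb, FreeNb, Count, vV, Best, Owner, Price}"
  by (auto simp: bid_def writes_scan writes_select)

lemma writes_expand: "writes (expand lev) =
    {TakenNb, FreeNb, Count, vV, Best, Owner, Price, Parent, lev, Dead, vY, Aux 22, Aux 23}"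
  by (auto simp: expand_def writes_bid)

lemma level_cases:
  fixes x :: nat
  obtains "x = 0" | "x = 1" | j where "x = Suc (Suc j)"
proof (cases x)
  case (Suc y)
  then show ?thesis
    using that by (cases y) simp_all
qed (use that in simp)

lemma card_Int_lessThan_Suc:
  "card (A \<inter> {..<Suc i}) = card (A \<inter> {..<i}) + (if i \<in> A then 1 else (0::nat))"
  by (simp add: lessThan_Suc Int_insert_right)

section \<open>Bidding and expanding on a graph held in the store\<close>

locale network = reservation N n d "\<lambda>y. neighbours E y - S"
  for N n d :: nat and E :: "nat set set" and S :: "nat set" +
  assumes graph: "simple_graph {..<N} E"
    and S_subset: "S \<subseteq> {..<N}"
begin

abbreviation M :: "nat \<Rightarrow> nat set" where
  "M y \<equiv> neighbours E y - S"

definition loaded :: "store \<Rightarrow> bool" where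
  "loaded s \<longleftrightarrow> s Order 0 = N \<and> s Size_Bound 0 = n \<and> s Degree_Bound 0 = d \<and>
     (\<forall>y<N. \<forall>v<N. s Adjacency (y * N + v) \<noteq> 0 \<longleftrightarrow> {y, v} \<in> E) \<and>
     (\<forall>v<N. s Reserved v \<noteq> 0 \<longleftrightarrow> v \<in> S)"

definition ready :: "store \<Rightarrow> bool" where
  "ready s \<longleftrightarrow> loaded s \<and> (\<forall>y<N. s Row y = y * N)"

text \<open>End points of finished paths also get a nonzero \<open>Parent\<close>, but they lie in
  \<open>S\<close>; the invariant \<open>good\<close> concerns occupied vertices outside
  \<open>S\<close> only.\<close>

definition occ :: "store \<Rightarrow> nat set" where
  "occ s = {v. v < N \<and> v \<notin> S \<and> s Parent v \<noteq> 0}"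

definition dead :: "store \<Rightarrow> nat set" where
  "dead s = {v. v < N \<and> s Dead v \<noteq> 0}"

lemma ready_frame:
  assumes "ready s"
    and "t Order = s Order" "t Size_Bound = s Size_Bound" "t Degree_Bound = s Degree_Bound"
      "t Adjacency = s Adjacency" "t Reserved = s Reserved" "t Row = s Row"
  shows "ready t"
  using assms by (simp add: ready_def loaded_def)

lemma adj_val:
  assumes "ready s" "s A 0 < N" "s B 0 < N"
  shows "exp_val (adj A B) s \<noteq> 0 \<longleftrightarrow> s B 0 \<in> neighbours E (s A 0)"
  using assms by (auto simp: ready_def loaded_def adj_def neighbours_def)

lemma M_less: "v \<in> M y \<Longrightarrow> y < N \<and> v < N \<and> v \<noteq> y"
  using graph by (force simp: simple_graph_def neighbours_def)

lemma scan_correct: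
  assumes "ready s" "s vY 0 = y" "y < N"
  defines "Z \<equiv> taken (occ s) (s Owner)"
  shows "run N scan s TakenNb 0 = card (M y \<inter> Z)" "run N scan s FreeNb 0 = card (M y - Z)"
    "run N scan s Count 0 = card (owned (s Owner) y)"
proof -
  let ?s = "put Count 0 0 (put FreeNb 0 0 (put TakenNb 0 0 s))"
  let ?body = "LIf (adj vY vV)
          (LIf (Get Reserved (cell vV)) LSkip
            (LIf (Plus (Get Parent (cell vV)) (Get Owner (cell vV))) (incr TakenNb) (incr FreeNb)))
          LSkip ;;
        LIf (differ (Get Owner (cell vV)) (succ (cell vY))) LSkip (incr Count)"
  let ?I = "\<lambda>i t. t TakenNb 0 = card (M y \<inter> Z \<inter> {..<i}) \<and> t FreeNb 0 = card ((M y - Z) \<inter> {..<i}) \<and>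
    t Count 0 = card (owned (s Owner) y \<inter> {..<i})"
  have "?I N (run N (LFor 20 ?body) ?s)"
  proof (rule run_For[where I = ?I])
    show "?I 0 (put vV 0 0 ?s)"
      by simp
  next
    fix i t
    assume i: "i < N" "t vV 0 = i" and frame: "\<And>A. A \<notin> writes (LFor 20 ?body) \<Longrightarrow> t A = ?s A" and I: "?I i t"
    have fr: "t A = s A" if "A \<notin> {TakenNb, FreeNb, Count, vV}" for A
      using frame[of A] that by simp
    have "ready t"
      using assms(1) by (rule ready_frame) (simp_all add: fr)
    then have adj: "exp_val (adj vY vV) t \<noteq> 0 \<longleftrightarrow> i \<in> neighbours E y"
      using adj_val[of t vY vV] i assms(2,3) by (simp add: fr)
    have res: "s Reserved i \<noteq> 0 \<longleftrightarrow> i \<in> S"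
      using assms(1) i by (simp add: ready_def loaded_def)
    have Z: "i \<notin> S \<Longrightarrow> i \<in> Z \<longleftrightarrow> s Parent i \<noteq> 0 \<or> s Owner i \<noteq> 0"
      using i by (auto simp: Z_def taken_def occ_def)
    have own: "i \<in> owned (s Owner) y \<longleftrightarrow> s Owner i = Suc y"
      using i by (simp add: owned_def)
    show "?I (Suc i) (put vV 0 (Suc i) (run N ?body t))"
      using I adj res Z i assms(2) by (auto simp: card_Int_lessThan_Suc fr own)
  qed
  moreover have "A \<subseteq> {..<N} \<Longrightarrow> A \<inter> {..<N} = A" for A
    by auto
  moreover have "M y \<inter> Z \<subseteq> {..<N}" "M y - Z \<subseteq> {..<N}" "owned (s Owner) y \<subseteq> {..<N}"
    using M_less by (auto simp: owned_def)
  ultimately show "run N scan s TakenNb 0 = card (M y \<inter> Z)" "run N scan s FreeNb 0 = card (M y - Z)"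
    "run N scan s Count 0 = card (owned (s Owner) y)"
    by (simp_all add: scan_def del: run.simps(5))
qed

text \<open>The candidate starts at the sentinel \<open>N\<close>. Some usable vertex is cheaper
  than the sentinel, so the final candidate, being at least as cheap as every usable vertex, cannot
  be the sentinel itself.\<close>

lemma select_correct:
  assumes "ready s" "s vY 0 = y" "y < N"
    and price: "\<And>v. v < N \<Longrightarrow> s Price v < s Price N"
    and ne: "M y - occ s \<noteq> {}"
  defines "b \<equiv> run N select s Best 0"
  shows "b \<in> M y - occ s" "\<And>w. w \<in> M y - occ s \<Longrightarrow> s Price b \<le> s Price w"
proof -
  let ?s = "put Best 0 (s Order 0) s"
  let ?body = "LIf (adj vY vV)
          (LIf (Plus (Get Reserved (cell vV)) (Get Parent (cell vV))) LSkip
            (LIf (Minus (Get Price (cell Best)) (Get Price (cell vV)))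
               (LSet Best (Lit 0) (cell vV)) LSkip))
          LSkip"
  let ?A = "M y - occ s"
  let ?I = "\<lambda>i t. t Best 0 \<in> insert N ?A \<and> (\<forall>w\<in>insert N (?A \<inter> {..<i}). s Price (t Best 0) \<le> s Price w)"
  have "?I N (run N (LFor 20 ?body) ?s)"
  proof (rule run_For[where I = ?I])
    show "?I 0 (put vV 0 0 ?s)"
      using assms(1) by (simp add: ready_def loaded_def)
  next
    fix i t
    assume i: "i < N" "t vV 0 = i" and frame: "\<And>A. A \<notin> writes (LFor 20 ?body) \<Longrightarrow> t A = ?s A" and I: "?I i t"
    have fr: "t A = s A" if "A \<notin> {Best, vV}" for A
      using frame[of A] that by simp
    have "ready t"
      using assms(1) by (rule ready_frame) (simp_all add: fr)
    then have adj: "exp_val (adj vY vV) t \<noteq> 0 \<longleftrightarrow> i \<in> neighbours E y"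
      using adj_val[of t vY vV] i assms(2,3) by (simp add: fr)
    have res: "s Reserved i \<noteq> 0 \<longleftrightarrow> i \<in> S"
      using assms(1) i by (simp add: ready_def loaded_def)
    have A: "i \<in> ?A \<longleftrightarrow> i \<in> neighbours E y \<and> i \<notin> S \<and> s Parent i = 0"
      using i by (auto simp: occ_def)
    define c where "c = run N ?body t Best 0"
    have best: "c = (if i \<in> ?A \<and> s Price i < s Price (t Best 0) then i else t Best 0)"
      using adj res A i by (simp add: c_def fr)
    have "s Price c \<le> s Price w" if "w \<in> insert N (?A \<inter> {..<Suc i})" for w
    proof (cases "w = i")
      case True
      then have "i \<in> ?A"
        using that i by auto
      then show ?thesis
        using best True by (simp add: not_less)
    next
      case False
      then have "w \<in> insert N (?A \<inter> {..<i})"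
        using that by (auto simp: less_Suc_eq)
      then have "s Price (t Best 0) \<le> s Price w"
        using I by blast
      moreover have "s Price c \<le> s Price (t Best 0)"
        unfolding best by (simp add: less_imp_le)
      ultimately show ?thesis
        by (rule order_trans[rotated])
    qed
    moreover have "c \<in> insert N ?A"
      unfolding best using I by (simp only: split: if_split) blast
    ultimately show "?I (Suc i) (put vV 0 (Suc i) (run N ?body t))"
      by (simp add: c_def del: run.simps insert_iff Int_iff)
  qed
  moreover have "b = run N (LFor 20 ?body) ?s Best 0"
    by (simp add: b_def select_def del: run.simps(5))
  ultimately have b: "b \<in> insert N ?A" "\<And>w. w \<in> insert N (?A \<inter> {..<N}) \<Longrightarrow> s Price b \<le> s Price w"
    by blast+
  have lt: "w \<in> ?A \<Longrightarrow> w < N" for w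
    using M_less by blast
  show "s Price b \<le> s Price w" if "w \<in> ?A" for w
    using b(2)[of w] that lt by blast
  obtain w where "w \<in> ?A"
    using ne by blast
  then have "s Price b < s Price N"
    using b(2)[of w] lt price[of w] by auto
  then show "b \<in> ?A"
    using b(1) by auto
qed

definition bidding :: "nat set \<Rightarrow> nat set \<Rightarrow> nat \<Rightarrow> store \<Rightarrow> bool" where
  "bidding T D x s \<longleftrightarrow> ready s \<and> occ s = T \<and> dead s = D \<and> s vX 0 = x \<and> s Price N = Suc N \<and>
     auction T D x (s Owner) (s Price)"

definition settled :: "nat set \<Rightarrow> nat set \<Rightarrow> nat \<Rightarrow> store \<Rightarrow> bool" where
  "settled T D x s \<longleftrightarrow> (\<forall>y\<in>demands T D x (s Owner). q \<le> card (owned (s Owner) y))"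

definition total_price :: "store \<Rightarrow> nat" where
  "total_price s = (\<Sum>v<N. s Price v)"

lemma occ_cong: "t Parent = s Parent \<Longrightarrow> occ t = occ s"
  by (simp add: occ_def)

lemma dead_cong: "t Dead = s Dead \<Longrightarrow> dead t = dead s"
  by (simp add: dead_def)

text \<open>The numbers found by \<open>scan\<close> decide whether \<open>y\<close> is a claimant
  lacking vertices. If so, \<open>demand_nonempty\<close> provides a candidate, the updates are
  those of \<open>auction_step\<close>, and exactly one price rises by one. Otherwise only scratch
  cells change.\<close>

lemma bid_correct:
  assumes bidding: "bidding T D x s" and y: "s vY 0 = y" "y < N"
    and T: "card T < (d + 1) * n" "good T D"
  defines "t \<equiv> run N bid s"
  shows "bidding T D x t"
    "if y \<in> demands T D x (s Owner) \<and> card (owned (s Owner) y) < q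
     then total_price t = Suc (total_price s) else t Owner = s Owner \<and> t Price = s Price"
proof -
  note b = bidding[unfolded bidding_def]
  define u where "u = run N scan s"
  define w where "w = run N select u"
  have u: "A \<notin> {TakenNb, FreeNb, Count, vV} \<Longrightarrow> u A = s A" for A
    by (simp add: u_def run_frame writes_scan)
  have w: "A \<notin> {Best, vV} \<Longrightarrow> w A = u A" for A
    by (simp add: w_def run_frame writes_select)
  have ready_u: "ready u"
    using b by (auto simp: u intro: ready_frame)
  have fr: "t A = s A" if "A \<notin> {TakenNb, FreeNb, Count, vV, Best, Owner, Price}" for A
    using that by (simp add: t_def run_frame writes_bid)
  have static: "ready t" "occ t = T" "dead t = D" "t vX 0 = x"
    using b by (auto simp: fr cong: occ_cong dead_cong intro: ready_frame)
  have scan: "u TakenNb 0 = card (M y \<inter> taken T (s Owner))" "u FreeNb 0 = card (M y - taken T (s Owner))"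
    "u Count 0 = card (owned (s Owner) y)"
    using scan_correct[of s y] b y by (simp_all add: u_def)
  have deg: "u Degree_Bound 0 = d"
    using b by (simp add: u ready_def loaded_def)
  have dead: "s Dead y \<noteq> 0 \<longleftrightarrow> y \<in> D"
    using b y by (auto simp: dead_def)
  have cond: "y \<in> demands T D x (s Owner) \<longleftrightarrow> y \<notin> D \<and> (y = x \<or> u FreeNb 0 \<le> u TakenNb 0)"
    using y by (simp add: demands_def crowded_def scan)
  show "if y \<in> demands T D x (s Owner) \<and> card (owned (s Owner) y) < q
     then total_price t = Suc (total_price s) else t Owner = s Owner \<and> t Price = s Price"
     and "bidding T D x t"
  proof -
    consider (no) "\<not> (y \<in> demands T D x (s Owner) \<and> card (owned (s Owner) y) < q)"
      | (yes) "y \<in> demands T D x (s Owner)" "card (owned (s Owner) y) < q"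
      by blast
    then have "(if y \<in> demands T D x (s Owner) \<and> card (owned (s Owner) y) < q
     then total_price t = Suc (total_price s) else t Owner = s Owner \<and> t Price = s Price) \<and> bidding T D x t"
    proof cases
      case no
      then have "t = (if s Dead y \<noteq> 0 then s else u)"
        using cond dead b y deg scan(3) by (auto simp: t_def bid_def u_def[symmetric] u)
      then have "t Owner = s Owner" "t Price = s Price"
        by (auto simp: u)
      then show ?thesis
        using no b static by (auto simp: bidding_def)
    next
      case yes
      define c where "c = w Best 0"
      have "t = put Price c (Suc (s Price c)) (put Owner c (Suc y) w)"
        using cond dead b y deg scan(3) yes
        by (auto simp: t_def bid_def u_def[symmetric] w_def[symmetric] u w c_def)
      then have t: "t Owner = (s Owner)(c := Suc y)" "t Price = (s Price)(c := Suc (s Price c))"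
        by (simp_all add: u w fun_eq_iff)
      have auc: "auction T D x (s Owner) (s Price)"
        using b by simp
      have lt: "u Price v < u Price N" if "v < N" for v
        using auc b that n_less by (auto simp: auction_def u intro: le_less_trans)
      have yD: "y \<notin> D"
        using yes by (simp add: demands_def)
      have T': "T \<subseteq> {..<N}"
        using b by (auto simp: occ_def)
      have occ_u: "occ u = T"
        using b by (simp add: u cong: occ_cong)
      have c: "c \<in> M y - T" "\<And>v. v \<in> M y - T \<Longrightarrow> s Price c \<le> s Price v"
        using select_correct[OF ready_u _ y(2) lt] demand_nonempty[OF T(2) y(2) yD] y(1)
        by (simp_all add: c_def w_def occ_u u)
      then have cN: "c < N"
        using M_less by blast
      have "auction T D x (t Owner) (t Price)"
        unfolding t using auction_step[OF auc T' T yes c] .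
      moreover have "total_price t = Suc (total_price s)"
      proof -
        have "total_price t = (\<Sum>v<N. s Price v + (if v = c then 1 else 0))"
          unfolding total_price_def t by (intro sum.cong) auto
        then show ?thesis
          using cN by (simp add: sum.distrib total_price_def)
      qed
      ultimately show ?thesis
        using yes static b cN by (auto simp: bidding_def t)
    qed
    then show "if y \<in> demands T D x (s Owner) \<and> card (owned (s Owner) y) < q
     then total_price t = Suc (total_price s) else t Owner = s Owner \<and> t Price = s Price"
     "bidding T D x t" by auto
  qed
qed

lemma bidding_frame:
  assumes "bidding T D x s"
    and "\<And>A. A \<in> {Order, Size_Bound, Degree_Bound, Adjacency, Reserved, Row, Parent, Dead, vX, Owner, Price}
      \<Longrightarrow> t A = s A"
  shows "bidding T D x t"
  using assms by (auto simp: bidding_def cong: occ_cong dead_cong intro: ready_frame)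

text \<open>While no bid occurs, \<open>Owner\<close> stays as it was at the start of the sweep. The
  checks made for the different \<open>y\<close> then refer to the same assignment and together show
  that it is settled.\<close>

lemma sweep_correct:
  assumes bidding: "bidding T D x s" and T: "card T < (d + 1) * n" "good T D"
  defines "t \<equiv> run N (LFor 21 bid) s"
  shows "bidding T D x t" "settled T D x t \<or> total_price s < total_price t"
    "settled T D x s \<Longrightarrow> settled T D x t"
proof -
  let ?I = "\<lambda>i t. bidding T D x t \<and> (settled T D x s \<longrightarrow> t Owner = s Owner) \<and>
    (total_price s < total_price t \<or> t Owner = s Owner \<and> t Price = s Price \<and>
      (\<forall>y<i. y \<in> demands T D x (s Owner) \<longrightarrow> q \<le> card (owned (s Owner) y)))"
  have "?I N (run N (LFor 21 bid) s)"
  proof (rule run_For[where I = ?I])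
    show "?I 0 (put vY 0 0 s)"
      using bidding by (auto intro: bidding_frame)
  next
    fix i r
    assume i: "i < N" "r vY 0 = i" and I: "?I i r"
    define r' where "r' = put vY 0 (Suc i) (run N bid r)"
    have r': "r' Owner = run N bid r Owner" "r' Price = run N bid r Price"
      by (simp_all add: r'_def)
    have bid': "bidding T D x r'"
      unfolding r'_def using bid_correct(1)[of T D x r] I i T by (auto intro: bidding_frame)
    have eq: "u Price = v Price \<Longrightarrow> total_price u = total_price v" for u v
      by (simp add: total_price_def)
    have "?I (Suc i) r'"
    proof (cases "i \<in> demands T D x (r Owner) \<and> card (owned (r Owner) i) < q")
      case True
      then have "total_price r' = Suc (total_price r)"
        using bid_correct(2)[of T D x r i] I i T eq[of r' "run N bid r"] r' by simp
      moreover have "total_price s \<le> total_price r"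
        using I eq[of s r] by auto
      moreover have "\<not> settled T D x s"
      proof
        assume "settled T D x s"
        moreover from this have "r Owner = s Owner"
          using I by blast
        ultimately have "q \<le> card (owned (r Owner) i)"
          using True by (simp only: settled_def)
        then show False
          using True by linarith
      qed
      ultimately show ?thesis
        using bid' by simp
    next
      case False
      then have same: "r' Owner = r Owner" "r' Price = r Price"
        using bid_correct(2)[of T D x r i] I i T r' by (simp_all only: if_False)
      have "total_price s < total_price r \<or> (r Owner = s Owner \<and> r Price = s Price \<and>
          (\<forall>y<Suc i. y \<in> demands T D x (s Owner) \<longrightarrow> q \<le> card (owned (s Owner) y)))"
        using I False by (auto simp: less_Suc_eq not_less)
      then show ?thesis
        using I bid' eq[of r' r, OF same(2)] by (simp only: same) blast
    qed
    then show "?I (Suc i) (put vY 0 (Suc i) (run N bid r))"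
      unfolding r'_def .
  qed
  note I = this[folded t_def]
  show "bidding T D x t"
    using I by blast
  show "settled T D x t \<or> total_price s < total_price t"
    using I by (auto simp: settled_def demands_def)
  show "settled T D x s \<Longrightarrow> settled T D x t"
    using I by (auto simp: settled_def)
qed

text \<open>After \<open>c\<close> sweeps the auction is settled, and then stays so, or the total
  price is at least \<open>c\<close>. For \<open>c = N * N\<close> the second alternative
  contradicts \<open>auction_total_price\<close>.\<close>

lemma sweeps_correct:
  assumes bidding: "bidding T D x s" and T: "card T < (d + 1) * n" "good T D"
  defines "t \<equiv> run N (LFor 22 (LFor 23 (LFor 21 bid))) s"
  shows "bidding T D x t" "settled T D x t"
proof -
  let ?I = "\<lambda>c t. bidding T D x t \<and> (settled T D x t \<or> c \<le> total_price t)"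
  have fr: "?I c (put (Aux k) 0 i r)" if "?I c r" "k \<in> {22, 23}" for c i r k
    using that by (auto simp: settled_def total_price_def intro: bidding_frame)
  have inner: "?I (c + N) (run N (LFor 23 (LFor 21 bid)) r)" if "?I c r" for c r
  proof (rule run_For[where I = "\<lambda>i. ?I (c + i)"])
    show "?I (c + 0) (put (Aux 23) 0 0 r)"
      using fr[OF that] by simp
  next
    fix i r
    assume "?I (c + i) r"
    then have "?I (c + Suc i) (run N (LFor 21 bid) r)"
      using sweep_correct[of T D x r] T by (auto simp del: run.simps)
    from fr[OF this] show "?I (c + Suc i) (put (Aux 23) 0 (Suc i) (run N (LFor 21 bid) r))"
      by blast
  qed
  have "?I (N * N) (run N (LFor 22 (LFor 23 (LFor 21 bid))) s)"
  proof (rule run_For[where I = "\<lambda>i. ?I (i * N)"])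
    show "?I (0 * N) (put (Aux 22) 0 0 s)"
      using fr[where c = 0 and r = s] bidding by simp
  next
    fix i r
    assume "?I (i * N) r"
    from fr[OF inner[OF this]]
    show "?I (Suc i * N) (put (Aux 22) 0 (Suc i) (run N (LFor 23 (LFor 21 bid)) r))"
      by (simp only: mult_Suc add.commute[of N]) blast
  qed
  note I = this[folded t_def]
  show "bidding T D x t"
    using I by blast
  then have "total_price t < N * N"
    unfolding total_price_def by (intro auction_total_price) (auto simp: bidding_def)
  then show "settled T D x t"
    using I by auto
qed

lemma expand_correct:
  assumes ready: "ready s" and x: "s vX 0 = x" "x < N" "s Dead x = 0"
    and T: "card (occ s) < (d + 1) * n" "good (occ s) (dead s)"
    and lev: "lev \<in> {LevA, LevB}"
  defines "t \<equiv> run N (expand lev) s"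
  shows "\<exists>C. C \<subseteq> M x - occ s \<and> card C = q \<and>
    t Parent = (\<lambda>v. if v \<in> C then Suc x else s Parent v) \<and>
    t lev = (\<lambda>v. if v \<in> C then Suc (s lev x) else s lev v) \<and>
    t Dead = (s Dead)(x := 1) \<and> good (occ t) (dead t)"
proof -
  let ?init = "LSet Owner (cell vV) (Lit 0) ;; LSet Price (cell vV) (Lit 0)"
  let ?copy = "LIf (differ (Get Owner (cell vV)) (succ (cell vX))) LSkip
         (LSet Parent (cell vV) (succ (cell vX)) ;;
          LSet lev (cell vV) (succ (Get lev (cell vX))))"
  define s1 where "s1 = run N (LFor 20 ?init) s"
  define s2 where "s2 = put Price (s1 Order 0) (Suc (s1 Order 0)) s1"
  define s3 where "s3 = run N (LFor 22 (LFor 23 (LFor 21 bid))) s2"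
  define s4 where "s4 = run N (LFor 20 ?copy) s3"
  have t: "t = put Dead (s4 vX 0) 1 s4"
    by (simp add: t_def expand_def s1_def s2_def s3_def s4_def del: run.simps(5))
  have s1: "\<forall>v<N. s1 Owner v = 0 \<and> s1 Price v = 0"
    unfolding s1_def by (rule run_For[where I = "\<lambda>i r. \<forall>v<i. r Owner v = 0 \<and> r Price v = 0"])
      (auto simp: less_Suc_eq)
  have fr1: "A \<notin> {vV, Owner, Price} \<Longrightarrow> s1 A = s A" for A
    unfolding s1_def by (rule run_frame) auto
  have Order: "s Order 0 = N"
    using ready by (simp add: ready_def loaded_def)
  have "auction (occ s) (dead s) x (s2 Owner) (s2 Price)"
    using s1 by (intro auction_init) (simp_all add: s2_def fr1 Order)
  moreover have "ready s2"
    using ready by (rule ready_frame) (simp_all add: s2_def fr1)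
  moreover have "occ s2 = occ s" "dead s2 = dead s"
    by (rule occ_cong dead_cong, simp add: s2_def fr1)+
  ultimately have "bidding (occ s) (dead s) x s2"
    using x by (simp add: bidding_def s2_def fr1 Order)
  from sweeps_correct[OF this T, folded s3_def]
  have s3: "bidding (occ s) (dead s) x s3" "settled (occ s) (dead s) x s3" .
  have fr3: "A \<notin> {TakenNb, FreeNb, Count, vV, Best, Owner, Price, vY, Aux 22, Aux 23} \<Longrightarrow> s3 A = s A" for A
    unfolding s3_def by (subst run_frame) (auto simp: writes_bid s2_def fr1)
  define C where "C = owned (s3 Owner) x"
  have xD: "x \<notin> dead s"
    using x by (simp add: dead_def)
  have auc: "auction (occ s) (dead s) x (s3 Owner) (s3 Price)"
    using s3 by (simp add: bidding_def)
  have C: "card C = q" "C \<subseteq> M x - occ s" "good (occ s \<union> C) (insert x (dead s))"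
    using auction_final[OF auc x(2) xD] s3(2) by (auto simp: settled_def C_def)
  \<comment> \<open>The copying loop reads the level of \<open>x\<close> while it writes the levels
    of \<open>C\<close>, so \<open>x\<close> must not be overwritten.\<close>
  have xC: "x \<notin> C"
    using C(2) M_less by blast
  let ?I = "\<lambda>i r. r Parent = (\<lambda>v. if v \<in> C \<and> v < i then Suc x else s Parent v) \<and>
    r lev = (\<lambda>v. if v \<in> C \<and> v < i then Suc (s lev x) else s lev v)"
  have "?I N s4"
    unfolding s4_def
  proof (rule run_For[where I = ?I])
    show "?I 0 (put vV 0 0 s3)"
      using lev by (auto simp: fr3)
  next
    fix i r
    assume i: "i < N" "r vV 0 = i" and frame: "\<And>A. A \<notin> writes (LFor 20 ?copy) \<Longrightarrow> r A = s3 A" and I: "?I i r"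
    have r: "r Owner = s3 Owner" "r vX 0 = x"
      using frame lev x by (auto simp: fr3)
    have "i \<in> C \<longleftrightarrow> s3 Owner i = Suc x"
      using i by (simp add: C_def owned_def)
    then show "?I (Suc i) (put vV 0 (Suc i) (run N ?copy r))"
      using I r i xC lev by (auto simp: fun_eq_iff less_Suc_eq)
  qed
  moreover have "v \<in> C \<Longrightarrow> v < N" for v
    by (simp add: C_def owned_def)
  ultimately have s4: "s4 Parent = (\<lambda>v. if v \<in> C then Suc x else s Parent v)"
    "s4 lev = (\<lambda>v. if v \<in> C then Suc (s lev x) else s lev v)"
    by (auto simp: fun_eq_iff)
  have fr4: "A \<notin> {vV, Parent, lev} \<Longrightarrow> s4 A = s3 A" for A
    unfolding s4_def by (subst run_frame) auto
  have "s4 vX 0 = x" "s4 Dead = s Dead"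
    using lev x by (auto simp: fr4 fr3)
  then have t': "t Parent = s4 Parent" "t lev = s4 lev" "t Dead = (s Dead)(x := 1)"
    using lev by (auto simp: t)
  have "occ t = occ s \<union> C"
    using C(2) M_less by (auto simp: occ_def t' s4)
  moreover have "dead t = insert x (dead s)"
    using x by (auto simp: dead_def t')
  ultimately show ?thesis
    using C s4 t' by (intro exI[of _ C]) auto
qed

end

section \<open>Growing a tree\<close>

definition sixteen :: "exp \<Rightarrow> exp" where
  "sixteen e = (let dbl = \<lambda>e. Plus e e in dbl (dbl (dbl (dbl e))))"

lemma sixteen_val [simp]: "exp_val (sixteen e) s = 16 * exp_val e s"
  by (simp add: sixteen_def Let_def)

text \<open>A level is expanded vertex by vertex and only until the goal is met, so the next level
  exceeds \<open>n * q / 16\<close> by less than \<open>q\<close>. Comparing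
  \<open>16 * Next\<close> with \<open>n * q\<close> avoids a division. New children carry the next
  level number and are not visited in the same pass.\<close>

definition grow_level :: "array \<Rightarrow> loop_prog" where
  "grow_level lev =
     LSet Next (Lit 0) (Lit 0) ;;
     LFor 24
       (LIf (differ (Get lev (cell vX)) (succ (cell vL))) LSkip
         (LIf (Minus (cell Goal) (sixteen (cell Next)))
           (expand lev ;;
            LSet Next (Lit 0) (Plus (cell Next) (Minus (cell Degree_Bound) (Lit 1)))) LSkip)) ;;
     LSet Width (Lit 0) (cell Next) ;;
     LSet Height (Lit 0) (succ (cell vL))"

text \<open>The loop always makes \<open>N\<close> rounds; those after the goal has been reached do
  nothing.\<close>

definition grow :: "array \<Rightarrow> array \<Rightarrow> loop_prog" where
  "grow base lev =
     LFor 20 (LSet lev (cell vV) (Lit 0)) ;;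
     LSet lev (cell base) (Lit 1) ;;
     LSet Width (Lit 0) (Lit 1) ;;
     LSet Height (Lit 0) (Lit 0) ;;
     LFor 25 (LIf (Minus (cell Goal) (sixteen (cell Width))) (grow_level lev) LSkip)"

lemma writes_grow_level: "writes (grow_level lev) =
    {TakenNb, FreeNb, Count, vV, Best, Owner, Price, Parent, lev, Dead, vY, Aux 22, Aux 23,
     vX, Next, Width, Height}"
  by (auto simp: grow_level_def writes_expand)

lemma writes_grow: "writes (grow base lev) =
    {TakenNb, FreeNb, Count, vV, Best, Owner, Price, Parent, lev, Dead, vY, Aux 22, Aux 23,
     vX, Next, Width, Height, vL}"
  by (auto simp: grow_def writes_grow_level)

section \<open>Forest and tree invariants and the growth of one tree\<close>

context network
begin

text \<open>\<open>Parent v = Suc y\<close> if \<open>v\<close> is a child of \<open>y\<close> in one of the current trees; on the vertices of the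
  paths found so far, which are marked in \<open>Kept\<close>, the nonzero value of \<open>Parent\<close> has no meaning.\<close>

definition forest :: "store \<Rightarrow> bool" where
  "forest s \<longleftrightarrow> ready s \<and> s Goal 0 = n * q \<and> good (occ s) (dead s) \<and>
     (\<forall>v<N. s Kept v \<noteq> 0 \<longrightarrow> s Parent v \<noteq> 0 \<and> s Dead v \<noteq> 0) \<and>
     (\<forall>v<N. v \<notin> S \<and> s Dead v \<noteq> 0 \<longrightarrow> s Parent v \<noteq> 0) \<and>
     (\<forall>v<N. s Kept v = 0 \<and> s Parent v \<noteq> 0 \<longrightarrow>
        (\<exists>y. s Parent v = Suc y \<and> v \<in> M y \<and> s Dead y \<noteq> 0)) \<and>
     (\<forall>y<N. s Kept y = 0 \<and> s Dead y \<noteq> 0 \<longrightarrow>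
        card {v. v < N \<and> s Kept v = 0 \<and> s Parent v = Suc y} = q)"

text \<open>\<open>s0\<close> is the store before the tree was grown; in the array \<open>lev\<close> the root has level 1, and 0 means
  that a vertex is not in the tree.\<close>

definition tree :: "store \<Rightarrow> nat \<Rightarrow> array \<Rightarrow> store \<Rightarrow> bool" where
  "tree s0 r lev s \<longleftrightarrow> forest s \<and> s lev r = 1 \<and>
     (\<forall>v<N. s lev v = 1 \<longrightarrow> v = r) \<and>
     (\<forall>v<N. \<forall>j. s lev v = Suc (Suc j) \<longrightarrow> v \<notin> S \<and> s0 Parent v = 0 \<and>
        (\<exists>y<N. s Parent v = Suc y \<and> s lev y = Suc j \<and> v \<in> M y)) \<and>
     (\<forall>v<N. s lev v < 2 \<longrightarrow> s Parent v = s0 Parent v) \<and>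
     (\<forall>v<N. v \<in> S \<and> v \<noteq> r \<longrightarrow> s Dead v = s0 Dead v)"

lemma forest_child:
  assumes "forest s" "v < N" "s Kept v = 0" "s Parent v = Suc y"
  shows "v \<in> M y" "s Dead y \<noteq> 0"
proof -
  have "s Parent v \<noteq> 0"
    using assms(4) by simp
  then obtain z where "s Parent v = Suc z" "v \<in> M z" "s Dead z \<noteq> 0"
    using assms(1-3) unfolding forest_def by blast
  then show "v \<in> M y" "s Dead y \<noteq> 0"
    using assms(4) by simp_all
qed

lemma forest_frame:
  assumes "forest s"
    and "\<And>A. A \<in> {Order, Size_Bound, Degree_Bound, Adjacency, Reserved, Row, Goal, Kept, Parent, Dead}
      \<Longrightarrow> t A = s A"
  shows "forest t"
proof -
  have "ready t" "occ t = occ s" "dead t = dead s"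
    using assms ready_frame[of s t] by (auto simp: forest_def intro!: occ_cong dead_cong)
  then show ?thesis
    using assms by (simp add: forest_def)
qed

lemma tree_root:
  assumes "tree s0 r lev s"
  shows "s lev r = 1" "v < N \<Longrightarrow> s lev v = 1 \<Longrightarrow> v = r"
  using assms by (simp_all add: tree_def)

lemma tree_parent:
  assumes "tree s0 r lev s" "v < N" "s lev v = Suc (Suc j)"
  obtains y where "y < N" "s Parent v = Suc y" "s lev y = Suc j" "v \<in> M y" "v \<notin> S" "s0 Parent v = 0"
  using assms unfolding tree_def by blast

lemma tree_frame:
  assumes "tree s0 r lev s"
    and "\<And>A. A \<in> {Order, Size_Bound, Degree_Bound, Adjacency, Reserved, Row, Goal, Kept, Parent, Dead, lev}
      \<Longrightarrow> t A = s A"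
  shows "tree s0 r lev t"
proof -
  have "forest t"
    using assms by (auto simp: tree_def intro: forest_frame)
  moreover have eq: "t lev = s lev" "t Parent = s Parent" "t Dead = s Dead"
    using assms(2) by simp_all
  ultimately show ?thesis
    using assms(1) unfolding tree_def eq by blast
qed

lemma tree_put:
  assumes "tree s0 r lev s" "A \<notin> {Order, Size_Bound, Degree_Bound, Adjacency, Reserved, Row, Goal, Kept, Parent, Dead, lev}"
  shows "tree s0 r lev (put A j i s)"
proof (rule tree_frame[OF assms(1)])
  fix B
  assume "B \<in> {Order, Size_Bound, Degree_Bound, Adjacency, Reserved, Row, Goal, Kept, Parent, Dead, lev}"
  then have "B \<noteq> A"
    using assms(2) by blast
  then show "put A j i s B = s B"
    by simp
qed

text \<open>The children of \<open>x\<close> are free vertices outside \<open>S\<close>: they have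
  no parent, are neither dead nor kept and lie on no earlier level, so the child sets of other
  vertices are unaffected. The only vertex of \<open>S\<close> that a tree expands is its root,
  which leaves the other end of the pair untouched.\<close>

lemma tree_expand:
  assumes tree: "tree s0 r lev s" and r: "r < N" "r \<in> S"
    and x: "s vX 0 = x" "x < N" "s lev x = Suc l" "s Dead x = 0"
    and T: "card (occ s) < (d + 1) * n" and lev: "lev \<in> {LevA, LevB}"
  defines "t \<equiv> run N (expand lev) s"
  shows "tree s0 r lev t \<and> (\<exists>C. C \<subseteq> {v. v < N \<and> s lev v = 0 \<and> s Dead v = 0} \<and> card C = q \<and>
    t lev = (\<lambda>v. if v \<in> C then Suc (Suc l) else s lev v) \<and> t Dead = (s Dead)(x := 1) \<and>
    card (occ t) = card (occ s) + q)"
proof -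
  have forest: "forest s"
    using tree by (simp add: tree_def)
  then have "ready s" "good (occ s) (dead s)"
    by (simp_all add: forest_def)
  from expand_correct[OF this(1) x(1,2,4) T this(2) lev, folded t_def, unfolded x(3)]
  obtain C where C: "C \<subseteq> M x - occ s" "card C = q"
    and t: "t Parent = (\<lambda>v. if v \<in> C then Suc x else s Parent v)"
      "t lev = (\<lambda>v. if v \<in> C then Suc (Suc l) else s lev v)"
      "t Dead = (s Dead)(x := 1)" and good: "good (occ t) (dead t)"
    by blast
  have fr: "A \<in> {Order, Size_Bound, Degree_Bound, Adjacency, Reserved, Row, Goal, Kept} \<Longrightarrow> t A = s A" for A
    unfolding t_def using lev by (intro run_frame) (auto simp: writes_expand)
  have "ready t"
    using forest by (auto simp: forest_def fr intro: ready_frame)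
  have CN: "v < N" "v \<in> M x" "v \<notin> S" "v \<noteq> x" "s Parent v = 0" "s Dead v = 0" "s Kept v = 0" "s lev v = 0"
    if "v \<in> C" for v
  proof -
    show v: "v < N" "v \<in> M x" "v \<notin> S" "v \<noteq> x"
      using that C(1) M_less by blast+
    show P: "s Parent v = 0"
      using v that C(1) by (auto simp: occ_def)
    show "s Dead v = 0"
      using forest v P unfolding forest_def by blast
    show "s Kept v = 0"
      using forest v P unfolding forest_def by blast
    show "s lev v = 0"
    proof (rule ccontr)
      assume "s lev v \<noteq> 0"
      then consider "s lev v = 1" | j where "s lev v = Suc (Suc j)"
        by (metis One_nat_def not0_implies_Suc)
      then show False
      proof cases
        case 1
        then have "v = r"
          using tree v(1) by (simp add: tree_def)
        then show False
          using v(3) r(2) by simp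
      next
        case 2
        then obtain y where "s Parent v = Suc y"
          using tree v(1) unfolding tree_def by blast
        then show False
          using P by simp
      qed
    qed
  qed
  \<comment> \<open>This preserves the clause that dead vertices outside \<open>S\<close> are
    occupied: \<open>x\<close> is about to become dead.\<close>
  have xP: "x \<in> S \<or> s Parent x \<noteq> 0"
  proof (cases l)
    case 0
    then have "x = r"
      using tree x unfolding tree_def by simp
    then show ?thesis
      using r by simp
  next
    case (Suc j)
    then obtain y where "s Parent x = Suc y"
      using tree x(2,3) unfolding tree_def by blast
    then show ?thesis
      by simp
  qed
  have xC: "x \<notin> C"
    using CN(4) by blast
  have child: "{v. v < N \<and> t Kept v = 0 \<and> t Parent v = Suc y} =
      (if y = x then C else {v. v < N \<and> s Kept v = 0 \<and> s Parent v = Suc y})" for y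
  proof -
    have "s Parent v \<noteq> Suc x" if "v < N" "s Kept v = 0" for v
      using forest_child(2)[OF forest that] x(4) by blast
    then show ?thesis
      using CN by (auto simp: t fr)
  qed
  have "forest t"
    unfolding forest_def
  proof (intro conjI allI impI)
    fix v assume v: "v < N" "t Kept v = 0 \<and> t Parent v \<noteq> 0"
    show "\<exists>y. t Parent v = Suc y \<and> v \<in> M y \<and> t Dead y \<noteq> 0"
    proof (cases "v \<in> C")
      case True
      then show ?thesis
        using CN by (auto simp: t)
    next
      case False
      then have P: "t Parent v = s Parent v" "s Kept v = 0" "s Parent v \<noteq> 0"
        using v by (simp_all add: t fr)
      then obtain y where "s Parent v = Suc y" "v \<in> M y" "s Dead y \<noteq> 0"
        using forest v(1) unfolding forest_def by blast
      then show ?thesis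
        using P by (auto simp: t)
    qed
  next
    fix y assume y: "y < N" "t Kept y = 0 \<and> t Dead y \<noteq> 0"
    show "card {v. v < N \<and> t Kept v = 0 \<and> t Parent v = Suc y} = q"
    proof (cases "y = x")
      case False
      then have "s Kept y = 0" "s Dead y \<noteq> 0"
        using y by (simp_all add: t fr)
      then show ?thesis
        using forest y(1) False unfolding child forest_def by simp
    qed (simp add: child C(2))
  next
    fix v assume "v < N" "t Kept v \<noteq> 0"
    then have "s Parent v \<noteq> 0" "s Dead v \<noteq> 0"
      using forest unfolding forest_def by (simp_all add: fr)
    then show "t Parent v \<noteq> 0" "t Dead v \<noteq> 0"
      by (simp_all add: t)
  next
    fix v assume v: "v < N" "v \<notin> S \<and> t Dead v \<noteq> 0"
    show "t Parent v \<noteq> 0"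
    proof (cases "v = x")
      case True
      then show ?thesis
        using xP v by (simp add: t)
    next
      case False
      then have "s Parent v \<noteq> 0"
        using forest v unfolding forest_def by (simp add: t)
      then show ?thesis
        by (simp add: t)
    qed
  next
    show "t Goal 0 = n * q"
      using forest fr[of Goal] by (simp add: forest_def)
  qed (fact \<open>ready t\<close> good)+
  moreover have "\<exists>y<N. t Parent v = Suc y \<and> t lev y = Suc j \<and> v \<in> M y" "v \<notin> S" "s0 Parent v = 0"
    if v: "v < N" "t lev v = Suc (Suc j)" for v j
  proof -
    have "(\<exists>y<N. t Parent v = Suc y \<and> t lev y = Suc j \<and> v \<in> M y) \<and> v \<notin> S \<and> s0 Parent v = 0"
    proof (cases "v \<in> C")
      case True
      then have "s0 Parent v = 0"
        using tree CN[OF True] by (auto simp: tree_def)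
      then show ?thesis
        using True CN[OF True] v x xC by (auto simp: t)
    next
      case False
      then obtain y where "y < N" "s Parent v = Suc y" "s lev y = Suc j" "v \<in> M y" "v \<notin> S" "s0 Parent v = 0"
        using tree_parent[OF tree v(1)] v(2) by (auto simp: t)
      then show ?thesis
        using False CN(8)[of y] by (auto simp: t)
    qed
    then show "\<exists>y<N. t Parent v = Suc y \<and> t lev y = Suc j \<and> v \<in> M y" "v \<notin> S" "s0 Parent v = 0"
      by auto
  qed
  moreover have "r \<notin> C"
    using CN(3) r by blast
  moreover have "x \<in> S \<Longrightarrow> x = r"
  proof -
    assume "x \<in> S"
    then have "l = 0"
      using tree x unfolding tree_def by (cases l) auto
    then show "x = r"
      using tree x unfolding tree_def by simp
  qed
  moreover have "t lev r = 1" "\<forall>v<N. t lev v = 1 \<longrightarrow> v = r"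
    using tree \<open>r \<notin> C\<close> by (auto simp: tree_def t)
  moreover have "\<forall>v<N. t lev v < 2 \<longrightarrow> t Parent v = s0 Parent v"
    using tree by (auto simp: tree_def t)
  moreover have "\<forall>v<N. v \<in> S \<and> v \<noteq> r \<longrightarrow> t Dead v = s0 Dead v"
    using tree \<open>x \<in> S \<Longrightarrow> x = r\<close> by (auto simp: tree_def t)
  ultimately have "tree s0 r lev t"
    unfolding tree_def by blast
  moreover have "occ t = occ s \<union> C"
    using CN by (auto simp: occ_def t)
  then have "card (occ t) = card (occ s) + q"
  proof -
    have "finite C"
      using CN(1) by (meson finite_nat_iff_bounded lessThan_iff subsetI)
    then show ?thesis
      using C \<open>occ t = occ s \<union> C\<close> by (subst \<open>occ t = occ s \<union> C\<close>, subst card_Un_disjoint) (auto simp: occ_def)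
  qed
  ultimately show ?thesis
    using C CN t by (intro conjI exI[of _ C]) auto
qed

text \<open>An expansion takes place only while \<open>16 * Next < n * q\<close>, so by
  \<open>T\<close> the occupied set is smaller than \<open>(d + 1) * n\<close> at each call, as
  \<open>tree_expand\<close> requires, and only the last call can overshoot the goal. Either the
  whole level is expanded, giving \<open>q * c\<close> children, or the goal has been
  reached.\<close>

lemma grow_level_correct:
  assumes tree: "tree s0 r lev s" and r: "r < N" "r \<in> S" and lev: "lev \<in> {LevA, LevB}"
    and l: "s vL 0 = l" and levels: "\<forall>v<N. s lev v \<le> Suc l"
    and front: "\<forall>v<N. s lev v = Suc l \<longrightarrow> s Dead v = 0"
    and T: "16 * card (occ s) + n * q \<le> 16 * ((d + 1) * n)"
  defines "t \<equiv> run N (grow_level lev) s" and "c \<equiv> card {v. v < N \<and> s lev v = Suc l}"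
  shows "tree s0 r lev t" "t Height 0 = Suc l"
    "t Width 0 = card {v. v < N \<and> t lev v = Suc (Suc l)}"
    "\<And>v. v < N \<Longrightarrow> t lev v \<le> Suc (Suc l)"
    "\<And>v. v < N \<Longrightarrow> t lev v = Suc (Suc l) \<Longrightarrow> t Dead v = 0"
    "card (occ t) = card (occ s) + t Width 0"
    "t Width 0 = q * c \<or> n * q \<le> 16 * t Width 0 \<and> t Width 0 \<le> q * c"
    "16 * t Width 0 < n * q + 16 * q"
proof -
  let ?body = "LIf (differ (Get lev (cell vX)) (succ (cell vL))) LSkip
         (LIf (Minus (cell Goal) (sixteen (cell Next)))
           (expand lev ;;
            LSet Next (Lit 0) (Plus (cell Next) (Minus (cell Degree_Bound) (Lit 1)))) LSkip)"
  define F where "F = {v. v < N \<and> s lev v = Suc l}"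
  define s' where "s' = put Next 0 0 s"
  define u where "u = run N (LFor 24 ?body) s'"
  have t: "t = put Height 0 (Suc (u vL 0)) (put Width 0 (u Next 0) u)"
    by (simp add: t_def grow_level_def s'_def u_def del: run.simps(5))
  have writes: "writes ?body = {TakenNb, FreeNb, Count, vV, Best, Owner, Price, Parent, lev, Dead, vY,
      Aux 22, Aux 23, Next}"
    by (auto simp: writes_expand)
  let ?I = "\<lambda>x u. tree s0 r lev u \<and> u Next 0 = card {v. v < N \<and> u lev v = Suc (Suc l)} \<and>
    (\<forall>v<N. u lev v \<le> Suc (Suc l)) \<and> {v. v < N \<and> u lev v = Suc l} = F \<and>
    (\<forall>v<N. u lev v = Suc (Suc l) \<longrightarrow> u Dead v = 0) \<and> (\<forall>v\<in>F. x \<le> v \<longrightarrow> u Dead v = 0) \<and>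
    card (occ u) = card (occ s) + u Next 0 \<and>
    (u Next 0 = q * card (F \<inter> {..<x}) \<or> n * q \<le> 16 * u Next 0 \<and> u Next 0 \<le> q * card (F \<inter> {..<x})) \<and>
    16 * u Next 0 < n * q + 16 * q"
  have I_frame: "?I x (put A 0 i u)" if "?I x u" "A \<in> {vX, Width, Height}" for x A i u
  proof -
    have tr: "tree s0 r lev u"
      using that(1) by blast
    have A: "A \<notin> {Order, Size_Bound, Degree_Bound, Adjacency, Reserved, Row, Goal, Kept, Parent, Dead, Next, lev}"
      using that(2) lev by auto
    have eq: "put A 0 i u Next = u Next" "put A 0 i u lev = u lev" "put A 0 i u Dead = u Dead"
      by (rule put_other, use A in blast)+
    have eq': "occ (put A 0 i u) = occ u"
      by (rule occ_cong, rule put_other, use A in blast)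
    have "tree s0 r lev (put A 0 i u)"
      using A by (intro tree_put[OF tr]) blast
    then show ?thesis
      using that(1) unfolding eq eq' by blast
  qed
  have "?I N u"
    unfolding u_def
  proof (rule run_For[where I = ?I])
    have eq: "s' lev = s lev" "s' Dead = s Dead" "occ s' = occ s" "s' Next 0 = 0"
      using lev by (auto simp: s'_def occ_def)
    have no: "{v. v < N \<and> s lev v = Suc (Suc l)} = {}"
      using levels by auto
    have "?I 0 s'"
      unfolding eq no
    proof (intro conjI)
      show "tree s0 r lev s'"
        unfolding s'_def by (rule tree_put[OF tree]) (use lev in auto)
      show "\<forall>v<N. s lev v \<le> Suc (Suc l)"
        using levels le_SucI by blast
      show "\<forall>v<N. s lev v = Suc (Suc l) \<longrightarrow> s Dead v = 0"
        using no by blast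
      show "\<forall>v\<in>F. 0 \<le> v \<longrightarrow> s Dead v = 0"
        using front by (simp add: F_def)
      show "{v. v < N \<and> s lev v = Suc l} = F"
        by (simp only: F_def)
      show "16 * 0 < n * q + 16 * q"
        using d_ge by simp
      show "0 = q * card (F \<inter> {..<0}) \<or> n * q \<le> 16 * 0 \<and> 0 \<le> q * card (F \<inter> {..<0})"
        by simp
    qed simp_all
    then show "?I 0 (put vX 0 0 s')"
      by (rule I_frame) simp
  next
    fix x u
    assume x: "x < N" "u vX 0 = x" and frame: "\<And>A. A \<notin> writes (LFor 24 ?body) \<Longrightarrow> u A = s' A" and I: "?I x u"
    have uL: "u vL 0 = l"
      using frame[of vL] lev l by (auto simp: writes_expand s'_def)
    have tr: "tree s0 r lev u"
      and I2: "u Next 0 = card {v. v < N \<and> u lev v = Suc (Suc l)}"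
      and I3: "\<forall>v<N. u lev v \<le> Suc (Suc l)"
      and I4: "{v. v < N \<and> u lev v = Suc l} = F"
      and I5: "\<forall>v<N. u lev v = Suc (Suc l) \<longrightarrow> u Dead v = 0"
      and I6: "\<forall>v\<in>F. x \<le> v \<longrightarrow> u Dead v = 0"
      and I7: "card (occ u) = card (occ s) + u Next 0"
      and I8: "u Next 0 = q * card (F \<inter> {..<x}) \<or> n * q \<le> 16 * u Next 0 \<and> u Next 0 \<le> q * card (F \<inter> {..<x})"
      and I9: "16 * u Next 0 < n * q + 16 * q"
      using I by blast+
    then have forest: "forest u"
      by (simp add: tree_def)
    then have Goal: "u Goal 0 = n * q" and deg: "u Degree_Bound 0 = d"
      by (simp_all add: forest_def ready_def loaded_def)
    have xF: "x \<in> F \<longleftrightarrow> u lev x = Suc l"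
    proof -
      have "x \<in> F \<longleftrightarrow> x \<in> {v. v < N \<and> u lev v = Suc l}"
        by (simp only: I4)
      then show ?thesis
        using x by simp
    qed
    have "?I (Suc x) (run N ?body u)"
    proof (cases "x \<in> F \<and> 16 * u Next 0 < n * q")
      case False
      then have "run N ?body u = u"
        using xF Goal x uL by auto
      moreover have "card (F \<inter> {..<x}) \<le> card (F \<inter> {..<Suc x})"
        by (simp add: card_Int_lessThan_Suc)
      then have "q * card (F \<inter> {..<x}) \<le> q * card (F \<inter> {..<Suc x})"
        by (rule mult_le_mono2)
      moreover have "card (F \<inter> {..<Suc x}) = card (F \<inter> {..<x})" if "x \<notin> F"
        using that by (simp add: card_Int_lessThan_Suc)
      moreover have "\<forall>v\<in>F. Suc x \<le> v \<longrightarrow> u Dead v = 0"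
        using I6 by simp
      moreover have "u Next 0 = q * card (F \<inter> {..<Suc x}) \<or> n * q \<le> 16 * u Next 0 \<and> u Next 0 \<le> q * card (F \<inter> {..<Suc x})"
      proof (cases "x \<in> F")
        case True
        then have "n * q \<le> 16 * u Next 0"
          using False by linarith
        moreover have "u Next 0 \<le> q * card (F \<inter> {..<x})"
          using I8 by linarith
        ultimately show ?thesis
          using \<open>q * card (F \<inter> {..<x}) \<le> _\<close> by linarith
      next
        case False
        from I8 show ?thesis
          unfolding \<open>x \<notin> F \<Longrightarrow> _\<close>[OF False] .
      qed
      ultimately show ?thesis
        using tr I2 I3 I4 I5 I7 I9 by (simp only: simp_thms)
    next
      case True
      then have lx: "u lev x = Suc l"
        using xF by simp
      have dx: "u Dead x = 0"
        using I6 True by simp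
      have "16 * card (occ u) < 16 * ((d + 1) * n)"
        using I7 True T by (auto simp: algebra_simps)
      then have "card (occ u) < (d + 1) * n"
        by simp
      from tree_expand[OF tr r x(2,1) lx dx this lev]
      obtain C w where w: "w = run N (expand lev) u" "tree s0 r lev w"
        and C: "C \<subseteq> {v. v < N \<and> u lev v = 0 \<and> u Dead v = 0}" "card C = q"
          "w lev = (\<lambda>v. if v \<in> C then Suc (Suc l) else u lev v)"
          "w Dead = (u Dead)(x := 1)" "card (occ w) = card (occ u) + q"
        by blast
      have wfr: "w Next = u Next" "w Degree_Bound = u Degree_Bound"
        unfolding w(1) using lev by (auto simp: run_frame writes_expand)
      have run: "run N ?body u = put Next 0 (u Next 0 + q) w"
        using True Goal x uL lx deg by (simp add: w(1)[symmetric] wfr)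
      have xC: "x \<notin> C"
        using C(1) lx by auto
      have finC: "finite C"
        by (rule finite_subset[OF C(1)]) simp
      have un: "{v. v < N \<and> w lev v = Suc (Suc l)} = {v. v < N \<and> u lev v = Suc (Suc l)} \<union> C"
        using C by auto
      have next': "u Next 0 = q * card (F \<inter> {..<x})"
        using I8 True by linarith
      have eq: "put Next 0 (u Next 0 + q) w lev = w lev" "put Next 0 (u Next 0 + q) w Dead = w Dead"
        "put Next 0 (u Next 0 + q) w Next 0 = u Next 0 + q"
        using lev by auto
      have eq': "occ (put Next 0 (u Next 0 + q) w) = occ w"
        by (simp add: occ_def)
      have card': "card (F \<inter> {..<Suc x}) = Suc (card (F \<inter> {..<x}))"
        using True by (simp add: card_Int_lessThan_Suc)
      show ?thesis
        unfolding run eq eq'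
      proof (intro conjI)
        show "tree s0 r lev (put Next 0 (u Next 0 + q) w)"
          by (rule tree_put[OF w(2)]) (use lev in auto)
        have "finite {v. v < N \<and> u lev v = Suc (Suc l)}" "{v. v < N \<and> u lev v = Suc (Suc l)} \<inter> C = {}"
          using C(1) by auto
        then show "u Next 0 + q = card {v. v < N \<and> w lev v = Suc (Suc l)}"
          unfolding un I2 using C(2) finC by (simp add: card_Un_disjoint)
        show "{v. v < N \<and> w lev v = Suc l} = F"
          using C(1) unfolding C(3) I4[symmetric] by auto
        show "\<forall>v<N. w lev v \<le> Suc (Suc l)"
          using I3 by (simp add: C(3))
        show "\<forall>v<N. w lev v = Suc (Suc l) \<longrightarrow> w Dead v = 0"
          using I5 C(1) lx xC by (auto simp: C(3,4))
        show "\<forall>v\<in>F. Suc x \<le> v \<longrightarrow> w Dead v = 0"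
          using I6 by (simp add: C(4))
        show "card (occ w) = card (occ s) + (u Next 0 + q)"
          using C(5) I7 by linarith
        show "u Next 0 + q = q * card (F \<inter> {..<Suc x}) \<or>
            n * q \<le> 16 * (u Next 0 + q) \<and> u Next 0 + q \<le> q * card (F \<inter> {..<Suc x})"
          unfolding card' next' by simp
        show "16 * (u Next 0 + q) < n * q + 16 * q"
          using True by (simp only: distrib_left add_less_cancel_right)
      qed
    qed
    then show "?I (Suc x) (put vX 0 (Suc x) (run N ?body u))"
      by (rule I_frame) simp
  qed
  then have "?I N (put Width 0 (u Next 0) u)"
    by (rule I_frame) simp
  then have "?I N t"
    unfolding t by (rule I_frame) simp
  moreover have W: "t Next 0 = t Width 0"
    by (simp add: t)
  moreover have FN: "F \<inter> {..<N} = F"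
    by (auto simp: F_def)
  ultimately show "tree s0 r lev t"
    "t Width 0 = card {v. v < N \<and> t lev v = Suc (Suc l)}"
    "\<And>v. v < N \<Longrightarrow> t lev v \<le> Suc (Suc l)"
    "\<And>v. v < N \<Longrightarrow> t lev v = Suc (Suc l) \<Longrightarrow> t Dead v = 0"
    "card (occ t) = card (occ s) + t Width 0"
    "t Width 0 = q * c \<or> n * q \<le> 16 * t Width 0 \<and> t Width 0 \<le> q * c"
    "16 * t Width 0 < n * q + 16 * q"
    unfolding c_def F_def[symmetric] W FN by blast+
  have "u vL = s vL"
    unfolding u_def by (subst run_frame) (use lev in \<open>auto simp: writes_expand s'_def\<close>)
  then show "t Height 0 = Suc l"
    using l by (simp add: t)
qed

text \<open>A completely expanded tree has \<open>q ^ h\<close> vertices at depth \<open>h\<close>.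
  As levels before the last are complete, every tree stops at this same depth, which makes all the
  paths equally long.\<close>

definition height :: nat where
  "height = (LEAST h. n * q \<le> 16 * q ^ h)"

text \<open>Together with \<open>n < N\<close> the first bound shows that the \<open>N\<close>
  rounds of \<open>grow\<close> suffice. Already \<open>n < 2 ^ n\<close> gives
  \<open>n \<le> 2 * q ^ (n - 1)\<close>, well below what is needed.\<close>

lemma height_le: "height \<le> n" and height_reached: "n * q \<le> 16 * q ^ height"
proof -
  have "n < 2 ^ n"
    by (rule less_exp)
  have "n \<le> 2 * 2 ^ (n - 1)"
    using \<open>n < 2 ^ n\<close> n_pos by (simp flip: power_Suc)
  also have "(2::nat) ^ (n - 1) \<le> q ^ (n - 1)"
    using d_ge by (intro power_mono) auto
  finally have "n * q \<le> (2 * q ^ (n - 1)) * q"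
    by simp
  also have "\<dots> = 2 * q ^ Suc (n - 1)"
    by (simp only: power_Suc2 mult.assoc)
  also have "\<dots> \<le> 16 * q ^ n"
    using n_pos by simp
  finally have "n * q \<le> 16 * q ^ n" .
  then show "height \<le> n" "n * q \<le> 16 * q ^ height"
    unfolding height_def by (rule Least_le, rule LeastI)
qed

lemma height_eqI:
  assumes "\<And>j. j < h \<Longrightarrow> 16 * q ^ j < n * q" "n * q \<le> 16 * q ^ h"
  shows "h = height"
  unfolding height_def using assms by (intro Least_equality[symmetric]) (auto simp: not_le[symmetric])

lemma below_height: "j < height \<Longrightarrow> 16 * q ^ j < n * q"
  unfolding height_def by (auto dest: not_less_Least)

text \<open>Before the goal is reached the widths are exact powers of \<open>q\<close>, and by
  \<open>2 \<le> q\<close> all levels so far occupy at most twice the current width, which is below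
  \<open>n * q / 16\<close>. The final level adds less than \<open>n * q / 16 + q\<close>. Hence one
  tree occupies at most \<open>3 * (n * q) / 16 + q\<close> vertices.\<close>

lemma grow_correct:
  assumes forest: "forest s" and r: "s A 0 = r" "r < N" "r \<in> S" "s Dead r = 0" and A: "A \<in> {Source, Target}"
    and lev: "lev \<in> {LevA, LevB}"
    and T: "16 * card (occ s) + 3 * (n * q) \<le> 16 * ((d + 1) * n)"
  defines "t \<equiv> run N (grow A lev) s"
  shows "tree s r lev t" "t Height 0 = height"
    "n * q \<le> 16 * card {v. v < N \<and> t lev v = Suc height}"
    "16 * card (occ t) \<le> 16 * card (occ s) + 3 * (n * q) + 16 * q"
proof -
  let ?clear = "LSet lev (cell vV) (Lit 0)"
  let ?body = "LIf (Minus (cell Goal) (sixteen (cell Width))) (grow_level lev) LSkip"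
  define s1 where "s1 = run N (LFor 20 ?clear) s"
  define s2 where "s2 = put Height 0 0 (put Width 0 1 (put lev r 1 s1))"
  have s1_fr: "B \<notin> {vV, lev} \<Longrightarrow> s1 B = s B" for B
    unfolding s1_def by (rule run_frame) auto
  have t: "t = run N (LFor 25 ?body) s2"
    using A lev r(1) by (auto simp: t_def grow_def s2_def s1_def[symmetric] s1_fr simp del: run.simps(5))
  have s1_lev: "\<forall>v<N. s1 lev v = 0"
    unfolding s1_def using lev
    by (intro run_For[where I = "\<lambda>i u. \<forall>v<i. u lev v = 0"]) (auto simp: less_Suc_eq)
  have s2_lev: "s2 lev v = (if v = r then 1 else 0)" if "v < N" for v
    using s1_lev that lev by (auto simp: s2_def)
  have s2_fr: "B \<notin> {vV, lev, Height, Width} \<Longrightarrow> s2 B = s B" for B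
    by (simp add: s2_def s1_fr)
  have forest2: "forest s2"
    by (rule forest_frame[OF forest], rule s2_fr) (use lev in auto)
  have s2_eq: "s2 Parent = s Parent" "s2 Dead = s Dead"
    by (rule s2_fr, use lev in force)+
  have tree2: "tree s r lev s2"
    unfolding tree_def using forest2 s2_lev r by (auto simp: s2_eq split: if_splits)
  have occ2: "occ s2 = occ s"
    using s2_eq by (rule_tac occ_cong)
  let ?I = "\<lambda>l u. tree s r lev u \<and> u Width 0 = card {v. v < N \<and> u lev v = Suc (u Height 0)} \<and>
    (\<forall>j<u Height 0. 16 * q ^ j < n * q) \<and>
    (16 * u Width 0 < n * q \<and> u Height 0 = l \<and> u Width 0 = q ^ l \<and> (\<forall>v<N. u lev v \<le> Suc l) \<and>
       (\<forall>v<N. u lev v = Suc l \<longrightarrow> u Dead v = 0) \<and> card (occ u) \<le> card (occ s) + 2 * u Width 0 \<or>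
     n * q \<le> 16 * u Width 0 \<and> n * q \<le> 16 * q ^ u Height 0 \<and>
       16 * card (occ u) \<le> 16 * card (occ s) + 3 * (n * q) + 16 * q)"
  have I_frame: "?I l (put vL 0 i u)" if "?I l u" for l i u
  proof -
    have tr: "tree s r lev u"
      using that by blast
    have "tree s r lev (put vL 0 i u)"
      by (rule tree_put[OF tr]) (use lev in auto)
    moreover have eq: "put vL 0 i u Width = u Width" "put vL 0 i u Height = u Height"
      "put vL 0 i u lev = u lev" "put vL 0 i u Dead = u Dead"
      using lev by auto
    moreover have eq': "occ (put vL 0 i u) = occ u"
      by (rule occ_cong) simp
    ultimately show ?thesis
      using that unfolding eq eq' by blast
  qed
  have "?I N t"
    unfolding t
  proof (rule run_For[where I = ?I])
    have W: "s2 Width 0 = 1" "s2 Height 0 = 0"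
      using lev by (auto simp: s2_def)
    have "{v. v < N \<and> s2 lev v = Suc 0} = {r}"
      using s2_lev r by (auto split: if_splits)
    then have c: "card {v. v < N \<and> s2 lev v = Suc 0} = 1"
      by simp
    have "?I 0 s2"
      unfolding W occ2 c
    proof (intro conjI)
      show "tree s r lev s2"
        by (rule tree2)
      have 1: "\<forall>v<N. s2 lev v \<le> Suc 0" "\<forall>v<N. s2 lev v = Suc 0 \<longrightarrow> s2 Dead v = 0"
        using s2_lev r(4) s2_eq by (auto split: if_splits)
      have 2: "n * q \<le> 16 * 1 \<Longrightarrow> n * q \<le> 16 * q ^ 0"
        by simp
      have 3: "(1::nat) = q ^ 0" "card (occ s) \<le> card (occ s) + 2 * 1"
        "16 * card (occ s) \<le> 16 * card (occ s) + 3 * (n * q) + 16 * q"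
        by simp_all
      show "16 * 1 < n * q \<and> 0 = 0 \<and> 1 = q ^ 0 \<and> (\<forall>v<N. s2 lev v \<le> Suc 0) \<and>
          (\<forall>v<N. s2 lev v = Suc 0 \<longrightarrow> s2 Dead v = 0) \<and> card (occ s) \<le> card (occ s) + 2 * 1 \<or>
        n * q \<le> 16 * 1 \<and> n * q \<le> 16 * q ^ 0 \<and>
          16 * card (occ s) \<le> 16 * card (occ s) + 3 * (n * q) + 16 * q"
        using 1 2 3 by (metis not_le)
    qed simp_all
    then show "?I 0 (put vL 0 0 s2)"
      by (rule I_frame)
  next
    fix l u
    assume l: "l < N" "u vL 0 = l" and I: "?I l u"
    then have tr: "tree s r lev u"
      and W: "u Width 0 = card {v. v < N \<and> u lev v = Suc (u Height 0)}"
      and H: "\<forall>j<u Height 0. 16 * q ^ j < n * q"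
      by blast+
    have Goal: "u Goal 0 = n * q"
      using tr by (simp add: tree_def forest_def)
    have "?I (Suc l) (run N ?body u)"
    proof (cases "n * q \<le> 16 * u Width 0")
      case True
      then have "run N ?body u = u"
        using Goal by simp
      moreover have "n * q \<le> 16 * q ^ u Height 0"
        "16 * card (occ u) \<le> 16 * card (occ s) + 3 * (n * q) + 16 * q"
        using I True by (meson not_le)+
      ultimately show ?thesis
        using tr W H True by (simp only: simp_thms)
    next
      case False
      then have act: "u Height 0 = l" "u Width 0 = q ^ l" "\<forall>v<N. u lev v \<le> Suc l"
        "\<forall>v<N. u lev v = Suc l \<longrightarrow> u Dead v = 0"
        "card (occ u) \<le> card (occ s) + 2 * u Width 0"
        using I by blast+
      define w where "w = run N (grow_level lev) u"
      have run: "run N ?body u = w"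
        using False Goal by (simp add: w_def)
      have bound: "16 * card (occ u) + n * q \<le> 16 * ((d + 1) * n)"
        using T act(5) False by linarith
      note g = grow_level_correct[OF tr r(2,3) lev l(2) act(3,4) bound, folded w_def]
      have c: "card {v. v < N \<and> u lev v = Suc l} = q ^ l"
        using W act(1,2) by simp
      have q2: "2 * q ^ l \<le> q ^ Suc l"
        using d_ge by simp
      have occ_w: "card (occ w) \<le> card (occ s) + 2 * q ^ l + w Width 0"
        using g(6) act(5) unfolding act(2) by linarith
      have old: "16 * q ^ l < n * q"
        using False act(2) by simp
      \<comment> \<open>\<open>W\<close> is the new width, \<open>Q\<close> and \<open>Q'\<close>
        are the full widths of the old and the new level, \<open>m\<close> is \<open>n * q\<close>,
        and \<open>x\<close> and \<open>x'\<close> count the occupied vertices before the tree was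
        begun and now.\<close>
      have arith: "16 * W < m \<and> W = Q' \<and> x' \<le> x + 2 * W \<or>
        m \<le> 16 * W \<and> m \<le> 16 * Q' \<and> 16 * x' \<le> 16 * x + 3 * m + 16 * r"
        if "W = Q' \<or> m \<le> 16 * W \<and> W \<le> Q'" "x' \<le> x + 2 * Q + W" "2 * Q \<le> Q'" "16 * Q < m"
          "16 * W < m + 16 * r" for W Q Q' m x x' r :: nat
        using that by linarith
      have W': "w Width 0 = q ^ Suc l \<or> n * q \<le> 16 * w Width 0 \<and> w Width 0 \<le> q ^ Suc l"
        using g(7) unfolding c power_Suc .
      have "16 * w Width 0 < n * q \<and> w Width 0 = q ^ Suc l \<and> card (occ w) \<le> card (occ s) + 2 * w Width 0 \<or>
        n * q \<le> 16 * w Width 0 \<and> n * q \<le> 16 * q ^ Suc l \<and>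
        16 * card (occ w) \<le> 16 * card (occ s) + 3 * (n * q) + 16 * q"
        by (rule arith[OF W' occ_w q2 old g(8)])
      moreover have "\<forall>j<Suc l. 16 * q ^ j < n * q"
        using H old unfolding act(1) by (metis less_Suc_eq)
      moreover have "\<forall>v<N. w lev v \<le> Suc (Suc l)" "\<forall>v<N. w lev v = Suc (Suc l) \<longrightarrow> w Dead v = 0"
        using g(4,5) by blast+
      ultimately show ?thesis
        unfolding run g(2) using g(1,3) by (intro conjI; (assumption | blast))
    qed
    then show "?I (Suc l) (put vL 0 (Suc l) (run N ?body u))"
      by (rule I_frame)
  qed
  then have tr: "tree s r lev t"
    and W: "t Width 0 = card {v. v < N \<and> t lev v = Suc (t Height 0)}"
    and H: "\<And>j. j < t Height 0 \<Longrightarrow> 16 * q ^ j < n * q"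
    and fin: "16 * t Width 0 < n * q \<and> t Height 0 = N \<and> t Width 0 = q ^ N \<or>
     n * q \<le> 16 * t Width 0 \<and> n * q \<le> 16 * q ^ t Height 0 \<and>
       16 * card (occ t) \<le> 16 * card (occ s) + 3 * (n * q) + 16 * q"
    by blast+
  \<comment> \<open>A tree still below the goal after all rounds would have width
    \<open>q ^ N\<close>, which meets the goal.\<close>
  have "q ^ height \<le> q ^ N"
    using height_le n_less d_ge by (intro power_increasing) auto
  then have "n * q \<le> 16 * q ^ N"
    using height_reached by linarith
  then have fin': "n * q \<le> 16 * t Width 0" "n * q \<le> 16 * q ^ t Height 0"
    "16 * card (occ t) \<le> 16 * card (occ s) + 3 * (n * q) + 16 * q"
    using fin by auto
  show "tree s r lev t"
    by (rule tr)
  show h: "t Height 0 = height"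
    using H fin'(2) by (rule height_eqI)
  show "n * q \<le> 16 * card {v. v < N \<and> t lev v = Suc height}"
    using fin'(1) W unfolding h by simp
  show "16 * card (occ t) \<le> 16 * card (occ s) + 3 * (n * q) + 16 * q"
    by (rule fin')
qed

end

section \<open>Connecting one pair\<close>

definition connect :: loop_prog where
  "connect = LFor 20 (LFor 21
     (LIf (differ (Get LevA (cell vV)) (succ (cell Height))) LSkip
       (LIf (differ (Get LevB (cell vY)) (succ (cell Height))) LSkip
         (LIf (adj vV vY) (LSet EndA (Lit 0) (cell vV) ;; LSet EndB (Lit 0) (cell vY)) LSkip))))"

text \<open>Both branches are climbed simultaneously. The joining edge occupies the positions
  \<open>height\<close> and \<open>height + 1\<close> of \<open>Path\<close>, and the ancestors are
  written outwards, so that the roots come first and last.\<close>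

definition record_path :: loop_prog where
  "record_path = LFor 26
     (LIf (Minus (succ (cell Height)) (cell vI))
       (LSet Path (Minus (cell Height) (cell vI)) (cell EndA) ;;
        LSet Path (Plus (succ (cell Height)) (cell vI)) (cell EndB) ;;
        LSet Kept (cell EndA) (Lit 1) ;;
        LSet Kept (cell EndB) (Lit 1) ;;
        LSet EndA (Lit 0) (Minus (Get Parent (cell EndA)) (Lit 1)) ;;
        LSet EndB (Lit 0) (Minus (Get Parent (cell EndB)) (Lit 1))) LSkip)"

text \<open>Products are computed by repeated addition. Resetting \<open>Parent\<close> and
  \<open>Dead\<close> to \<open>Kept\<close> releases everything that the preceding round occupied
  except for the path it found.\<close>

definition prepare :: loop_prog where
  "prepare =
     LSet Row (Lit 0) (Lit 0) ;;
     LFor 20 (LSet Row (succ (cell vV)) (Plus (Get Row (cell vV)) (cell Order))) ;;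
     LSet Goal (Lit 0) (Lit 0) ;;
     LFor 20 (LIf (Minus (cell Size_Bound) (cell vV))
       (LSet Goal (Lit 0) (Plus (cell Goal) (Minus (cell Degree_Bound) (Lit 1)))) LSkip) ;;
     LFor 20 (LSet Parent (cell vV) (Get Kept (cell vV)) ;; LSet Dead (cell vV) (Get Kept (cell vV)))"

definition round_prog :: loop_prog where
  "round_prog = prepare ;; grow Source LevA ;; grow Target LevB ;; connect ;; record_path ;;
     LSet Path_Card (Lit 0) (Plus (succ (cell Height)) (succ (cell Height)))"

lemma writes_connect: "writes connect = {EndA, EndB, vV, vY}"
  by (auto simp: connect_def)

lemma writes_record_path: "writes record_path = {vI, Path, Kept, EndA, EndB}"
  by (auto simp: record_path_def)

lemma writes_prepare: "writes prepare = {vV, Row, Goal, Parent, Dead}"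
  by (auto simp: prepare_def)

lemma safe_round_prog: "safe round_prog"
  by (simp add: round_prog_def prepare_def connect_def record_path_def grow_def grow_level_def expand_def bid_def
      scan_def select_def incr_def)

definition ancestor :: "(nat \<Rightarrow> nat) \<Rightarrow> nat \<Rightarrow> nat \<Rightarrow> nat" where
  "ancestor P i v = ((\<lambda>v. P v - 1) ^^ i) v"

lemma ancestor_simps [simp]:
  "ancestor P 0 v = v"
  "ancestor P (Suc i) v = P (ancestor P i v) - 1"
  by (simp_all add: ancestor_def)

lemma record_path_correct:
  assumes h: "s Height 0 = h" "h < N" and uw: "s EndA 0 = u" "s EndB 0 = w"
  defines "t \<equiv> run N record_path s"
  shows "i \<le> h \<Longrightarrow> t Path (h - i) = ancestor (s Parent) i u"
    "i \<le> h \<Longrightarrow> t Path (Suc h + i) = ancestor (s Parent) i w"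
    "t Kept = (\<lambda>v. if \<exists>i\<le>h. v = ancestor (s Parent) i u \<or> v = ancestor (s Parent) i w then 1 else s Kept v)"
proof -
  let ?body = "LIf (Minus (succ (cell Height)) (cell vI))
       (LSet Path (Minus (cell Height) (cell vI)) (cell EndA) ;;
        LSet Path (Plus (succ (cell Height)) (cell vI)) (cell EndB) ;;
        LSet Kept (cell EndA) (Lit 1) ;;
        LSet Kept (cell EndB) (Lit 1) ;;
        LSet EndA (Lit 0) (Minus (Get Parent (cell EndA)) (Lit 1)) ;;
        LSet EndB (Lit 0) (Minus (Get Parent (cell EndB)) (Lit 1))) LSkip"
  let ?a = "\<lambda>i. ancestor (s Parent) i u" and ?b = "\<lambda>i. ancestor (s Parent) i w"
  let ?I = "\<lambda>i t. t EndA 0 = ?a (min i (Suc h)) \<and> t EndB 0 = ?b (min i (Suc h)) \<and>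
    (\<forall>j<min i (Suc h). t Path (h - j) = ?a j \<and> t Path (Suc h + j) = ?b j) \<and>
    t Kept = (\<lambda>v. if \<exists>j<min i (Suc h). v = ?a j \<or> v = ?b j then 1 else s Kept v)"
  have "?I N (run N (LFor 26 ?body) s)"
  proof (rule run_For[where I = ?I])
    show "?I 0 (put vI 0 0 s)"
      using uw by simp
  next
    fix i t
    assume i: "i < N" "t vI 0 = i" and frame: "\<And>A. A \<notin> writes (LFor 26 ?body) \<Longrightarrow> t A = s A" and I: "?I i t"
    have fr: "t Height = s Height" "t Parent = s Parent"
      by (simp_all add: frame)
    show "?I (Suc i) (put vI 0 (Suc i) (run N ?body t))"
    proof (cases "i \<le> h")
      case False
      then have "run N ?body t = t" "min (Suc i) (Suc h) = min i (Suc h)"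
        using i h by (auto simp: fr)
      then show ?thesis
        using I by (simp del: run.simps)
    next
      case True
      then have m: "min (Suc i) (Suc h) = Suc i" "min i (Suc h) = i"
        by auto
      have I': "t EndA 0 = ?a i" "t EndB 0 = ?b i" "\<forall>j<i. t Path (h - j) = ?a j \<and> t Path (Suc h + j) = ?b j"
        "t Kept = (\<lambda>v. if \<exists>j<i. v = ?a j \<or> v = ?b j then 1 else s Kept v)"
        using I unfolding m by blast+
      define r where "r = put vI 0 (Suc i) (run N ?body t)"
      have r: "r EndA 0 = ?a (Suc i)" "r EndB 0 = ?b (Suc i)"
        "r Path = (t Path)(h - i := ?a i, Suc h + i := ?b i)" "r Kept = (t Kept)(?a i := 1, ?b i := 1)"
        using True i h I'(1,2) by (simp_all add: fr r_def fun_eq_iff)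
      have "r Path (h - j) = ?a j \<and> r Path (Suc h + j) = ?b j" if "j < Suc i" for j
      proof (cases "j = i")
        case True
        have "h - i < Suc h + i"
          by simp
        then show ?thesis
          using True by (simp add: r(3))
      next
        case False
        then have "h - j \<noteq> h - i" "h - j \<noteq> Suc h + i" "Suc h + j \<noteq> h - i" "Suc h + j \<noteq> Suc h + i" "j < i"
          using that True by auto
        then show ?thesis
          using I'(3) by (simp add: r(3))
      qed
      moreover have "r Kept = (\<lambda>v. if \<exists>j<Suc i. v = ?a j \<or> v = ?b j then 1 else s Kept v)"
        by (auto simp: r(4) I'(4) less_Suc_eq fun_eq_iff)
      ultimately show ?thesis
        unfolding r_def[symmetric] m using r(1,2) by blast
    qed
  qed
  moreover have "min N (Suc h) = Suc h" "run N (LFor 26 ?body) s = t"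
    using h by (simp_all add: t_def record_path_def)
  ultimately have "\<forall>j<Suc h. t Path (h - j) = ?a j \<and> t Path (Suc h + j) = ?b j"
    "t Kept = (\<lambda>v. if \<exists>j<Suc h. v = ?a j \<or> v = ?b j then 1 else s Kept v)"
    by metis+
  then show "i \<le> h \<Longrightarrow> t Path (h - i) = ?a i" "i \<le> h \<Longrightarrow> t Path (Suc h + i) = ?b i"
    "t Kept = (\<lambda>v. if \<exists>i\<le>h. v = ?a i \<or> v = ?b i then 1 else s Kept v)"
    by (simp_all add: less_Suc_eq_le)
qed

section \<open>Correctness of one round\<close>

context network
begin

text \<open>A later edge may overwrite an earlier one, so the invariant says only that, once some
  edge between the last levels has been met, the stored pair is such an edge.\<close>

lemma connect_correct:
  assumes ready: "ready s" and uw: "u < N" "w < N" "s LevA u = Suc (s Height 0)"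
    "s LevB w = Suc (s Height 0)" "{u, w} \<in> E"
  defines "t \<equiv> run N connect s"
  shows "t EndA 0 < N" "t EndB 0 < N" "s LevA (t EndA 0) = Suc (s Height 0)"
    "s LevB (t EndB 0) = Suc (s Height 0)" "{t EndA 0, t EndB 0} \<in> E"
proof -
  let ?body = "LIf (differ (Get LevA (cell vV)) (succ (cell Height))) LSkip
       (LIf (differ (Get LevB (cell vY)) (succ (cell Height))) LSkip
         (LIf (adj vV vY) (LSet EndA (Lit 0) (cell vV) ;; LSet EndB (Lit 0) (cell vY)) LSkip))"
  define pair where "pair u w \<longleftrightarrow> u < N \<and> w < N \<and> s LevA u = Suc (s Height 0) \<and>
    s LevB w = Suc (s Height 0) \<and> {u, w} \<in> E" for u w
  let ?ok = "\<lambda>t. pair (t EndA 0) (t EndB 0)"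
  have "(\<exists>u<N. \<exists>w. pair u w) \<longrightarrow> ?ok (run N (LFor 20 (LFor 21 ?body)) s)"
  proof (rule run_For[where I = "\<lambda>i t. (\<exists>u<i. \<exists>w. pair u w) \<longrightarrow> ?ok t"])
    show "(\<exists>u<0. \<exists>w. pair u w) \<longrightarrow> ?ok (put vV 0 0 s)"
      by simp
  next
    fix i t
    assume i: "i < N" "t vV 0 = i" and frame: "\<And>A. A \<notin> writes (LFor 20 (LFor 21 ?body)) \<Longrightarrow> t A = s A"
      and I: "(\<exists>u<i. \<exists>w. pair u w) \<longrightarrow> ?ok t"
    have "(\<exists>u<i. \<exists>w. pair u w) \<or> (\<exists>w<N. pair i w) \<longrightarrow> ?ok (run N (LFor 21 ?body) t)"
    proof (rule run_For[where I = "\<lambda>j t. (\<exists>u<i. \<exists>w. pair u w) \<or> (\<exists>w<j. pair i w) \<longrightarrow> ?ok t"])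
      show "(\<exists>u<i. \<exists>w. pair u w) \<or> (\<exists>w<0. pair i w) \<longrightarrow> ?ok (put vY 0 0 t)"
        using I by simp
    next
      fix j r
      assume j: "j < N" "r vY 0 = j" and frame': "\<And>A. A \<notin> writes (LFor 21 ?body) \<Longrightarrow> r A = t A"
        and J: "(\<exists>u<i. \<exists>w. pair u w) \<or> (\<exists>w<j. pair i w) \<longrightarrow> ?ok r"
      have fr: "r A = s A" if "A \<notin> {EndA, EndB, vV, vY}" for A
        using that frame frame' by simp
      have rV: "r vV 0 = i"
        using frame'[of vV] i by simp
      have "ready r"
        using ready by (rule ready_frame) (simp_all add: fr)
      then have "exp_val (adj vV vY) r \<noteq> 0 \<longleftrightarrow> {i, j} \<in> E"
        using adj_val[of r vV vY] i j rV by (simp add: neighbours_def)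
      then have "?ok (run N ?body r) \<longleftrightarrow> pair i j \<or> ?ok r"
        "pair i j \<Longrightarrow> ?ok (run N ?body r)"
        using i j rV by (auto simp: fr pair_def)
      then show "(\<exists>u<i. \<exists>w. pair u w) \<or> (\<exists>w<Suc j. pair i w) \<longrightarrow> ?ok (put vY 0 (Suc j) (run N ?body r))"
        using J by (auto simp: less_Suc_eq simp del: run.simps)
    qed
    moreover have "pair u w \<Longrightarrow> w < N" for u w
      by (simp add: pair_def)
    ultimately show "(\<exists>u<Suc i. \<exists>w. pair u w) \<longrightarrow> ?ok (put vV 0 (Suc i) (run N (LFor 21 ?body) t))"
      by (auto simp: less_Suc_eq simp del: run.simps)
  qed
  moreover have "pair u w"
    using uw by (simp add: pair_def)
  ultimately have "?ok t"
    using uw(1) unfolding t_def connect_def by blast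
  then show "t EndA 0 < N" "t EndB 0 < N" "s LevA (t EndA 0) = Suc (s Height 0)"
    "s LevB (t EndB 0) = Suc (s Height 0)" "{t EndA 0, t EndB 0} \<in> E"
    by (simp_all add: pair_def)
qed

text \<open>Each step to the parent lowers the level by one. So no vertex repeats on a branch, and
  step \<open>h\<close> arrives at level 1, the root.\<close>

lemma branch:
  assumes parent: "\<And>v j. v < N \<Longrightarrow> L v = Suc (Suc j) \<Longrightarrow> \<exists>y<N. P v = Suc y \<and> L y = Suc j \<and> v \<in> M y"
    and u: "u < N" "L u = Suc h"
  shows "i \<le> h \<Longrightarrow> ancestor P i u < N \<and> L (ancestor P i u) = Suc (h - i)"
    "i < h \<Longrightarrow> P (ancestor P i u) = Suc (ancestor P (Suc i) u) \<and> ancestor P i u \<in> M (ancestor P (Suc i) u)"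
proof -
  have step: "P v = Suc (P v - 1)" "P v - 1 < N" "L (P v - 1) = Suc j" "v \<in> M (P v - 1)"
    if "v < N" "L v = Suc (Suc j)" for v j
    using parent[OF that] by auto
  show *: "ancestor P i u < N \<and> L (ancestor P i u) = Suc (h - i)" if "i \<le> h" for i
    using that
  proof (induction i)
    case 0
    then show ?case
      using u by simp
  next
    case (Suc i)
    then have "ancestor P i u < N" "L (ancestor P i u) = Suc (Suc (h - Suc i))"
      by (simp_all add: Suc_diff_Suc)
    from step[OF this] show ?case
      by simp
  qed
  show "P (ancestor P i u) = Suc (ancestor P (Suc i) u) \<and> ancestor P i u \<in> M (ancestor P (Suc i) u)" if "i < h"
  proof -
    have "ancestor P i u < N" "L (ancestor P i u) = Suc (Suc (h - Suc i))"
      using *[of i] that by (simp_all add: Suc_diff_Suc)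
    from step[OF this] show ?thesis
      by simp
  qed
qed

lemma prepare_correct:
  assumes loaded: "loaded s" and K: "K = {v. v < N \<and> s Kept v \<noteq> 0}" and good: "good (K - S) K"
  defines "t \<equiv> run N prepare s"
  shows "forest t" "occ t = K - S" "dead t = K"
proof -
  let ?row = "LSet Row (succ (cell vV)) (Plus (Get Row (cell vV)) (cell Order))"
  let ?goal = "LIf (Minus (cell Size_Bound) (cell vV))
       (LSet Goal (Lit 0) (Plus (cell Goal) (Minus (cell Degree_Bound) (Lit 1)))) LSkip"
  let ?copy = "LSet Parent (cell vV) (Get Kept (cell vV)) ;; LSet Dead (cell vV) (Get Kept (cell vV))"
  define s1 where "s1 = run N (LFor 20 ?row) (put Row 0 0 s)"
  define s2 where "s2 = run N (LFor 20 ?goal) (put Goal 0 0 s1)"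
  have t: "t = run N (LFor 20 ?copy) s2"
    by (simp add: t_def prepare_def s1_def s2_def del: run.simps(5))
  have base: "s Order 0 = N" "s Size_Bound 0 = n" "s Degree_Bound 0 = d"
    using loaded by (simp_all add: loaded_def)
  have row: "\<forall>y\<le>N. s1 Row y = y * N"
    unfolding s1_def
  proof (rule run_For[where I = "\<lambda>i u. \<forall>y\<le>i. u Row y = y * N"])
    show "\<forall>y\<le>0. put vV 0 0 (put Row 0 0 s) Row y = y * N"
      by simp
  next
    fix i u
    assume i: "i < N" "u vV 0 = i" and frame: "\<And>A. A \<notin> writes (LFor 20 ?row) \<Longrightarrow> u A = put Row 0 0 s A"
      and I: "\<forall>y\<le>i. u Row y = y * N"
    have "u Order 0 = N"
      using frame[of Order] base by simp
    then show "\<forall>y\<le>Suc i. put vV 0 (Suc i) (run N ?row u) Row y = y * N"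
      using i I by (auto simp: le_Suc_eq)
  qed
  have fr1: "A \<notin> {vV, Row} \<Longrightarrow> s1 A = s A" for A
    unfolding s1_def by (subst run_frame) auto
  have goal: "s2 Goal 0 = min N n * q"
    unfolding s2_def
  proof (rule run_For[where I = "\<lambda>i u. u Goal 0 = min i n * q"])
    show "put vV 0 0 (put Goal 0 0 s1) Goal 0 = min 0 n * q"
      by simp
  next
    fix i u
    assume i: "i < N" "u vV 0 = i" and frame: "\<And>A. A \<notin> writes (LFor 20 ?goal) \<Longrightarrow> u A = put Goal 0 0 s1 A"
      and I: "u Goal 0 = min i n * q"
    have "u Size_Bound 0 = n" "u Degree_Bound 0 = d"
      using frame[of Size_Bound] frame[of Degree_Bound] base by (simp_all add: fr1)
    then show "put vV 0 (Suc i) (run N ?goal u) Goal 0 = min (Suc i) n * q"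
      using i I by (cases "i < n") (auto simp: min_def)
  qed
  have fr2: "A \<notin> {vV, Row, Goal} \<Longrightarrow> s2 A = s A" for A
    unfolding s2_def by (subst run_frame) (auto simp: fr1)
  have copy: "\<forall>v<N. t Parent v = s Kept v \<and> t Dead v = s Kept v"
    unfolding t
  proof (rule run_For[where I = "\<lambda>i u. \<forall>v<i. u Parent v = s Kept v \<and> u Dead v = s Kept v"])
    show "\<forall>v<0. put vV 0 0 s2 Parent v = s Kept v \<and> put vV 0 0 s2 Dead v = s Kept v"
      by simp
  next
    fix i u
    assume i: "i < N" "u vV 0 = i" and frame: "\<And>A. A \<notin> writes (LFor 20 ?copy) \<Longrightarrow> u A = s2 A"
      and I: "\<forall>v<i. u Parent v = s Kept v \<and> u Dead v = s Kept v"
    have "u Kept = s Kept"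
      using frame[of Kept] by (simp add: fr2)
    then show "\<forall>v<Suc i. put vV 0 (Suc i) (run N ?copy u) Parent v = s Kept v \<and>
        put vV 0 (Suc i) (run N ?copy u) Dead v = s Kept v"
      using i I by (auto simp: less_Suc_eq)
  qed
  have fr: "A \<notin> {vV, Parent, Dead} \<Longrightarrow> t A = s2 A" for A
    unfolding t by (subst run_frame) auto
  have "loaded t"
    using loaded by (simp add: loaded_def fr fr2)
  moreover have "s2 Row = s1 Row"
    unfolding s2_def by (subst run_frame) auto
  ultimately have "ready t"
    using row by (simp add: ready_def fr)
  moreover show occ: "occ t = K - S"
    using copy by (auto simp: occ_def K)
  moreover show dead: "dead t = K"
    using copy by (auto simp: dead_def K)
  moreover have "t Goal 0 = n * q"
    using goal n_less by (simp add: fr)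
  moreover have "t Kept = s Kept"
    by (simp add: fr fr2)
  moreover have "0 < q"
    using d_ge by simp
  ultimately show "forest t"
    using copy good unfolding forest_def by auto
qed

text \<open>The state between rounds. \<open>Parent\<close> and \<open>Dead\<close> may still show
  abandoned trees, since these are discarded only by the next \<open>prepare\<close>; the path
  vertices themselves need no further children.\<close>

definition resting :: "nat set \<Rightarrow> store \<Rightarrow> bool" where
  "resting K s \<longleftrightarrow> loaded s \<and> K = {v. v < N \<and> s Kept v \<noteq> 0} \<and> good (K - S) K"

text \<open>Multiplied by sixteen, the first tree costs at most \<open>3 * (n * q) + 16 * q\<close>,
  and growing the second requires room for another \<open>3 * (n * q)\<close>; this is the budget
  \<open>T\<close>. Discarding the trees except for the path is an instance of
  \<open>good_release\<close>.\<close>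

lemma round_correct:
  assumes rest: "resting K s" and a: "s Source 0 = a" "a \<in> S - K" and b: "s Target 0 = b" "b \<in> S - K"
    and ab: "a \<noteq> b" and T: "16 * card (K - S) + 6 * (n * q) + 16 * q \<le> 16 * ((d + 1) * n)"
    and join: "\<forall>U W. U \<subseteq> {..<N} \<and> W \<subseteq> {..<N} \<and> U \<inter> W = {} \<and> n * q \<le> 16 * card U \<and>
      n * q \<le> 16 * card W \<longrightarrow> (\<exists>u\<in>U. \<exists>w\<in>W. {u, w} \<in> E)"
  defines "t \<equiv> run N round_prog s" and "p \<equiv> output_path (run N round_prog s)"
  shows "is_path {..<N} E a b p" "length p = 2 * height + 2" "set p \<inter> K = {}"
    "set p \<inter> S = {a, b}" "resting (K \<union> set p) t"
proof -
  define s1 where "s1 = run N prepare s"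
  define t1 where "t1 = run N (grow Source LevA) s1"
  define t2 where "t2 = run N (grow Target LevB) t1"
  define t3 where "t3 = run N connect t2"
  define t4 where "t4 = run N record_path t3"
  have t: "t = put Path_Card 0 (2 * t4 Height 0 + 2) t4"
    by (simp add: t_def round_prog_def s1_def t1_def t2_def t3_def t4_def mult_2)
  have K: "K = {v. v < N \<and> s Kept v \<noteq> 0}" and loaded: "loaded s" and good: "good (K - S) K"
    using rest unfolding resting_def by blast+
  note prep = prepare_correct[OF loaded K good, folded s1_def]
  have fr1: "A \<notin> {vV, Row, Goal, Parent, Dead} \<Longrightarrow> s1 A = s A" for A
    by (simp add: s1_def run_frame writes_prepare)
  have aN: "a < N" "a \<in> S" and bN: "b < N" "b \<in> S"
    using a b S_subset by auto
  have "s1 Dead a = 0" "s1 Dead b = 0"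
    using prep(3) a b aN bN by (auto simp: dead_def)
  have "s1 Source 0 = a"
    using a by (simp add: fr1)
  have T1: "16 * card (occ s1) + 3 * (n * q) \<le> 16 * ((d + 1) * n)"
    using T unfolding prep(2) by linarith
  note A = grow_correct[OF prep(1) \<open>s1 Source 0 = a\<close> aN \<open>s1 Dead a = 0\<close> _ _ T1, of LevA, folded t1_def, simplified]
  have frA: "B \<notin> writes (grow Source LevA) \<Longrightarrow> t1 B = s1 B" for B
    by (simp add: t1_def run_frame)
  have "t1 Target 0 = b"
    using b by (subst frA) (auto simp: writes_grow fr1)
  have "t1 Dead b = 0"
    using A(1) bN ab \<open>s1 Dead b = 0\<close> by (simp add: tree_def)
  have T2: "16 * card (occ t1) + 3 * (n * q) \<le> 16 * ((d + 1) * n)"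
    using A(4) T unfolding prep(2) by simp
  have "forest t1"
    using A(1) by (simp add: tree_def)
  note B = grow_correct[OF \<open>forest t1\<close> \<open>t1 Target 0 = b\<close> bN \<open>t1 Dead b = 0\<close> _ _ T2, of LevB, folded t2_def, simplified]
  have frB: "A \<notin> writes (grow Target LevB) \<Longrightarrow> t2 A = t1 A" for A
    by (simp add: t2_def run_frame)
  have LevA: "t2 LevA = t1 LevA"
    by (rule frB) (simp add: writes_grow)
  have Kept2: "t2 Kept = s Kept"
    by (subst frB, simp add: writes_grow, subst frA, simp add: writes_grow, simp add: fr1)
  have forest: "forest t2"
    using B(1) by (simp add: tree_def)
  then have ready2: "ready t2"
    by (simp add: forest_def)
  have parA: "\<exists>y<N. t2 Parent v = Suc y \<and> t2 LevA y = Suc j \<and> v \<in> M y"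
    and parA': "v \<notin> S \<and> t2 LevB v = 0 \<and> t2 Kept v = 0" if vj: "v < N" "t2 LevA v = Suc (Suc j)" for v j
  proof -
    obtain y where y: "y < N" "t1 Parent v = Suc y" "t1 LevA y = Suc j" "v \<in> M y" "v \<notin> S" "s1 Parent v = 0"
      by (rule tree_parent[OF A(1) vj(1) vj(2)[unfolded LevA]])
    have "t2 LevB v = 0"
    proof (cases "t2 LevB v" rule: level_cases)
      case 2
      then have "v = b"
        using B(1) vj(1) unfolding tree_def by blast
      then show ?thesis
        using y(5) bN by simp
    next
      case (3 i)
      then have "t1 Parent v = 0"
        using B(1) vj(1) unfolding tree_def by simp
      then show ?thesis
        using y(2) by simp
    qed
    then have "t2 Parent v = t1 Parent v"
      using B(1) vj(1) unfolding tree_def by simp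
    then show "\<exists>y<N. t2 Parent v = Suc y \<and> t2 LevA y = Suc j \<and> v \<in> M y"
      using y LevA by auto
    have "s1 Kept v = 0"
      using prep(1) vj(1) y(6) unfolding forest_def by auto
    then show "v \<notin> S \<and> t2 LevB v = 0 \<and> t2 Kept v = 0"
      using y(5) \<open>t2 LevB v = 0\<close> Kept2 by (simp add: fr1)
  qed
  have parB: "\<exists>y<N. t2 Parent v = Suc y \<and> t2 LevB y = Suc j \<and> v \<in> M y"
    and parB': "v \<notin> S \<and> t2 Kept v = 0" if vj: "v < N" "t2 LevB v = Suc (Suc j)" for v j
  proof -
    obtain y where y: "y < N" "t2 Parent v = Suc y" "t2 LevB y = Suc j" "v \<in> M y" "v \<notin> S" "t1 Parent v = 0"
      by (rule tree_parent[OF B(1) vj])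
    then show "\<exists>y<N. t2 Parent v = Suc y \<and> t2 LevB y = Suc j \<and> v \<in> M y"
      by blast
    have "t1 Kept v = 0"
      using \<open>forest t1\<close> vj(1) y(6) unfolding forest_def by auto
    then show "v \<notin> S \<and> t2 Kept v = 0"
      using y(5) frB[of Kept] by (simp add: writes_grow)
  qed
  have rootA: "t2 LevA a = 1" "\<And>v. v < N \<Longrightarrow> t2 LevA v = 1 \<Longrightarrow> v = a"
    unfolding LevA using tree_root[OF A(1)] by blast+
  have rootB: "t2 LevB b = 1" "\<And>v. v < N \<Longrightarrow> t2 LevB v = 1 \<Longrightarrow> v = b"
    using tree_root[OF B(1)] by blast+
  \<comment> \<open>Apart from its root, the second tree takes only vertices that had no parent when
    the first was complete; roots lie in \<open>S\<close>, other tree vertices do not.\<close>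
  have disj: "t2 LevB v = 0" if v: "v < N" "t2 LevA v \<noteq> 0" for v
  proof (cases "t2 LevA v" rule: level_cases)
    case 2
    then have "v = a"
      using rootA v(1) by blast
    show ?thesis
    proof (cases "t2 LevB v" rule: level_cases)
      case 2
      then have "v = b"
        by (rule rootB(2)[OF v(1)])
      then show ?thesis
        using \<open>v = a\<close> ab by simp
    next
      case (3 j)
      then show ?thesis
        using parB'[OF v(1)] \<open>v = a\<close> aN by simp
    qed
  next
    case (3 j)
    then show ?thesis
      using parA'[OF v(1)] by simp
  qed (use v in simp)
  define U where "U = {v. v < N \<and> t2 LevA v = Suc height}"
  define W where "W = {v. v < N \<and> t2 LevB v = Suc height}"
  have "\<exists>u\<in>U. \<exists>w\<in>W. {u, w} \<in> E"
    using disj A(3) B(3) by (intro join[rule_format] conjI) (auto simp: U_def W_def LevA)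
  then obtain u' w' where "u' \<in> U" "w' \<in> W" "{u', w'} \<in> E"
    by blast
  then have uw': "u' < N" "w' < N" "t2 LevA u' = Suc (t2 Height 0)" "t2 LevB w' = Suc (t2 Height 0)" "{u', w'} \<in> E"
    by (auto simp: U_def W_def B(2))
  define u where "u = t3 EndA 0"
  define w where "w = t3 EndB 0"
  have uw: "u < N" "w < N" "t2 LevA u = Suc height" "t2 LevB w = Suc height" "{u, w} \<in> E"
    using connect_correct[OF ready2 uw'] by (simp_all add: u_def w_def t3_def B(2))
  have fr3: "A \<notin> {EndA, EndB, vV, vY} \<Longrightarrow> t3 A = t2 A" for A
    by (simp add: t3_def run_frame writes_connect)
  have fr4: "A \<notin> {vI, Path, Kept, EndA, EndB} \<Longrightarrow> t4 A = t3 A" for A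
    by (simp add: t4_def run_frame writes_record_path)
  define P where "P = t2 Parent"
  have h3: "t3 Height 0 = height"
    by (simp add: fr3 B(2))
  have hN: "height < N"
    using height_le n_less by simp
  have P3: "t3 Parent = P"
    by (simp add: fr3 P_def)
  note rec = record_path_correct[of t3, OF h3 hN u_def[symmetric] w_def[symmetric], folded t4_def, unfolded P3]
  define us where "us = map (\<lambda>i. ancestor P i u) [0..<Suc height]"
  define ws where "ws = map (\<lambda>i. ancestor P i w) [0..<Suc height]"
  have p: "p = rev us @ ws"
  proof (rule nth_equalityI)
    have len: "length p = 2 * height + 2"
      by (simp add: p_def t_def[symmetric] t output_path_def fr4 fr3 B(2))
    then show "length p = length (rev us @ ws)"
      by (simp add: us_def ws_def)
    fix k assume "k < length p"
    then have k: "k < 2 * height + 2"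
      by (simp add: len)
    have nth: "p ! k = t4 Path k"
      using k by (simp add: p_def t_def[symmetric] t output_path_def fr4 fr3 B(2) del: upt_Suc)
    show "p ! k = (rev us @ ws) ! k"
    proof (cases "k \<le> height")
      case True
      then have "t4 Path k = ancestor P (height - k) u"
        using rec(1)[of "height - k"] by simp
      moreover have "(rev us @ ws) ! k = us ! (height - k)"
        using True by (simp add: nth_append rev_nth us_def del: upt_Suc)
      moreover have "us ! (height - k) = ancestor P (height - k) u"
        by (simp add: us_def less_Suc_eq_le del: upt_Suc)
      ultimately show ?thesis
        using nth by simp
    next
      case False
      then have "t4 Path k = ancestor P (k - Suc height) w"
        using rec(2)[of "k - Suc height"] k by simp
      moreover have "(rev us @ ws) ! k = ws ! (k - Suc height)"
        using False by (simp add: nth_append us_def del: upt_Suc)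
      moreover have "k - Suc height < Suc height"
        using False k by linarith
      then have "ws ! (k - Suc height) = ancestor P (k - Suc height) w"
        by (simp add: ws_def del: upt_Suc)
      ultimately show ?thesis
        using nth by simp
    qed
  qed
  show len: "length p = 2 * height + 2"
    by (simp add: p us_def ws_def)
  have brA: "i \<le> height \<Longrightarrow> ancestor P i u < N \<and> t2 LevA (ancestor P i u) = Suc (height - i)"
    "i < height \<Longrightarrow> P (ancestor P i u) = Suc (ancestor P (Suc i) u) \<and> ancestor P i u \<in> M (ancestor P (Suc i) u)"
    for i using branch[OF parA uw(1,3)] unfolding P_def by auto
  have brB: "i \<le> height \<Longrightarrow> ancestor P i w < N \<and> t2 LevB (ancestor P i w) = Suc (height - i)"
    "i < height \<Longrightarrow> P (ancestor P i w) = Suc (ancestor P (Suc i) w) \<and> ancestor P i w \<in> M (ancestor P (Suc i) w)"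
    for i using branch[OF parB uw(2,4)] unfolding P_def by auto
  have topA: "ancestor P height u = a" and topB: "ancestor P height w = b"
    using brA(1)[of height] brB(1)[of height] rootA(2) rootB(2) by auto
  have set_us: "set us = {ancestor P i u |i. i \<le> height}" and set_ws: "set ws = {ancestor P i w |i. i \<le> height}"
    by (auto simp: us_def ws_def less_Suc_eq_le simp del: upt_Suc)
  have set_p: "set p = set us \<union> set ws"
    by (simp add: p)
  have innerA: "ancestor P i u \<notin> S \<and> t2 Kept (ancestor P i u) = 0" if "i < height" for i
    using brA(1)[of i] parA'[of "ancestor P i u" "height - Suc i"] that by (simp add: Suc_diff_Suc)
  have innerB: "ancestor P i w \<notin> S \<and> t2 Kept (ancestor P i w) = 0" if "i < height" for i
    using brB(1)[of i] parB'[of "ancestor P i w" "height - Suc i"] that by (simp add: Suc_diff_Suc)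
  \<comment> \<open>The path contains the parent of each of its vertices other than the roots. Hence
    a dead vertex off the path has all its children off the path and gets them back on
    release.\<close>
  have p_cases: "v = a \<or> v = b \<or> v < N \<and> v \<notin> S \<and> t2 Kept v = 0 \<and> (\<exists>y\<in>set p. P v = Suc y)" if "v \<in> set p" for v
  proof -
    from that consider i where "i \<le> height" "v = ancestor P i u" | i where "i \<le> height" "v = ancestor P i w"
      by (auto simp: set_p set_us set_ws)
    then show ?thesis
    proof cases
      case 1
      show ?thesis
      proof (cases "i = height")
        case True
        then show ?thesis
          using 1 topA by simp
      next
        case False
        then have "i < height"
          using 1 by simp
        then have "ancestor P (Suc i) u \<in> set p"
          unfolding set_p set_us using Suc_leI by blast
        then show ?thesis
          using brA[of i] innerA[of i] 1 \<open>i < height\<close> by blast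
      qed
    next
      case 2
      show ?thesis
      proof (cases "i = height")
        case True
        then show ?thesis
          using 2 topB by simp
      next
        case False
        then have "i < height"
          using 2 by simp
        then have "ancestor P (Suc i) w \<in> set p"
          unfolding set_p set_ws using Suc_leI by blast
        then show ?thesis
          using brB[of i] innerB[of i] 2 \<open>i < height\<close> by blast
      qed
    qed
  qed
  have ab_p: "a \<in> set p" "b \<in> set p"
    using topA topB by (auto simp: set_p set_us set_ws)
  have pN: "set p \<subseteq> {..<N}"
    using p_cases aN bN by blast
  show "set p \<inter> S = {a, b}"
    using p_cases aN bN ab_p by blast
  have KN: "v \<in> K \<longleftrightarrow> t2 Kept v \<noteq> 0" if "v < N" for v
    using that by (simp add: K Kept2)
  show pK: "set p \<inter> K = {}"
    using p_cases KN a b by blast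
  have distinct: "distinct p"
  proof -
    have "distinct us"
      unfolding us_def distinct_map
    proof (intro conjI inj_onI)
      fix i j assume "i \<in> set [0..<Suc height]" "j \<in> set [0..<Suc height]" "ancestor P i u = ancestor P j u"
      then show "i = j"
        using brA(1)[of i] brA(1)[of j] by (simp add: less_Suc_eq_le del: upt_Suc)
    qed simp
    moreover have "distinct ws"
      unfolding ws_def distinct_map
    proof (intro conjI inj_onI)
      fix i j assume "i \<in> set [0..<Suc height]" "j \<in> set [0..<Suc height]" "ancestor P i w = ancestor P j w"
      then show "i = j"
        using brB(1)[of i] brB(1)[of j] by (simp add: less_Suc_eq_le del: upt_Suc)
    qed simp
    moreover have "set us \<inter> set ws = {}"
    proof -
      have "v < N \<and> t2 LevA v \<noteq> 0" if "v \<in> set us" for v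
        using that brA(1) by (auto simp: set_us)
      moreover have "t2 LevB v \<noteq> 0" if "v \<in> set ws" for v
        using that brB(1) by (auto simp: set_ws)
      ultimately show ?thesis
        using disj by blast
    qed
    ultimately show ?thesis
      by (simp add: p)
  qed
  have edgeA: "{ancestor P (Suc i) u, ancestor P i u} \<in> E" if "i < height" for i
    using brA(2)[OF that] by (simp add: neighbours_def)
  have edgeB: "{ancestor P i w, ancestor P (Suc i) w} \<in> E" if "i < height" for i
    using brB(2)[OF that] by (simp add: neighbours_def insert_commute)
  have "successively (\<lambda>x y. {x, y} \<in> E) p"
  proof -
    have "successively (\<lambda>x y. {y, x} \<in> E) us"
      unfolding successively_conv_nth us_def using edgeA by (auto simp del: upt_Suc ancestor_simps(2))
    moreover have "successively (\<lambda>x y. {x, y} \<in> E) ws"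
      unfolding successively_conv_nth ws_def using edgeB by (auto simp del: upt_Suc ancestor_simps(2))
    moreover have "us \<noteq> []" "hd us = u" "ws \<noteq> []" "hd ws = w"
      by (simp_all add: us_def ws_def upt_conv_Cons del: upt_Suc)
    ultimately show ?thesis
      using uw(5) by (simp add: p successively_append_iff last_rev)
  qed
  moreover have "hd p = a" "last p = b" "p \<noteq> []"
    using topA topB by (simp_all add: p us_def ws_def)
  ultimately show "is_path {..<N} E a b p"
    using distinct pN by (simp add: is_path_def)
  have Kept_t: "t Kept = (\<lambda>v. if v \<in> set p then 1 else s Kept v)"
  proof -
    have "t Kept = t4 Kept" "t3 Kept = s Kept"
      by (simp_all add: t fr3 Kept2)
    then show ?thesis
      unfolding rec(3) set_p set_us set_ws by (auto simp: fun_eq_iff)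
  qed
  have "loaded t"
    using loaded Kept_t ready2 by (simp add: ready_def loaded_def t fr4 fr3)
  moreover have "K \<union> set p = {v. v < N \<and> t Kept v \<noteq> 0}"
    using pN by (auto simp: Kept_t K)
  moreover have "good (K \<union> set p - S) (K \<union> set p)"
  proof (rule good_release)
    \<comment> \<open>The ends of the joining edge have not been expanded. As path vertices they
      need no children, so \<open>D\<close> may be enlarged by the path before the release.\<close>
    show "good (occ t2) (dead t2 \<union> set p)"
      using forest by (auto simp: forest_def intro: good_mono)
    have K2: "t2 Parent v \<noteq> 0" "t2 Dead v \<noteq> 0" if "v \<in> K" for v
    proof -
      have "v < N" "t2 Kept v \<noteq> 0"
        using that by (simp_all add: K Kept2)
      then show "t2 Parent v \<noteq> 0" "t2 Dead v \<noteq> 0"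
        using forest unfolding forest_def by blast+
    qed
    show "K \<union> set p - S \<subseteq> occ t2"
    proof
      fix v assume v: "v \<in> K \<union> set p - S"
      show "v \<in> occ t2"
      proof (cases "v \<in> K")
        case True
        then show ?thesis
          using K2(1) v by (auto simp: occ_def K)
      next
        case False
        then show ?thesis
          using p_cases[of v] v aN bN by (auto simp: occ_def P_def)
      qed
    qed
    show "K \<union> set p \<subseteq> dead t2 \<union> set p"
      using K2(2) by (auto simp: dead_def K)
    fix v y
    {
      assume y: "y \<in> dead t2 \<union> set p - (K \<union> set p)" "y < N"
      have "t2 Kept y = 0" "t2 Dead y \<noteq> 0"
        using y KN[OF y(2)] by (auto simp: dead_def)
      then have "q = card {v. v < N \<and> t2 Kept v = 0 \<and> t2 Parent v = Suc y}"
        using forest y(2) unfolding forest_def by simp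
      also have "\<dots> \<le> card {v. v < N \<and> v \<in> occ t2 - (K \<union> set p - S) \<and> P v = Suc y}"
      proof (rule card_mono)
        show "{v. v < N \<and> t2 Kept v = 0 \<and> t2 Parent v = Suc y}
            \<subseteq> {v. v < N \<and> v \<in> occ t2 - (K \<union> set p - S) \<and> P v = Suc y}"
        proof
          fix v assume "v \<in> {v. v < N \<and> t2 Kept v = 0 \<and> t2 Parent v = Suc y}"
          then have v: "v < N" "t2 Kept v = 0" "t2 Parent v = Suc y"
            by simp_all
          have "v \<notin> S"
            using forest_child(1)[OF forest v] by simp
          moreover have "v \<notin> K"
            using v KN by blast
          moreover have "v \<notin> set p"
          proof
            assume "v \<in> set p"
            then obtain z where "z \<in> set p" "P v = Suc z"
              using p_cases[of v] \<open>v \<notin> S\<close> aN bN by blast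
            then show False
              using v(3) y(1) by (simp add: P_def)
          qed
          ultimately show "v \<in> {v. v < N \<and> v \<in> occ t2 - (K \<union> set p - S) \<and> P v = Suc y}"
            using v by (simp add: occ_def P_def)
        qed
      qed simp
      finally show "q \<le> card {v. v < N \<and> v \<in> occ t2 - (K \<union> set p - S) \<and> P v = Suc y}" .
    next
      assume v: "v < N" "v \<in> occ t2 - (K \<union> set p - S)" "P v = Suc y"
      then have "v \<notin> K"
        by (auto simp: occ_def)
      then have "t2 Kept v = 0"
        using KN v(1) by blast
      then show "v \<in> M y"
        using forest_child(1)[OF forest v(1)] v(3) by (simp add: P_def)
    }
  qed
  ultimately show "resting (K \<union> set p) t"
    by (simp add: resting_def)
qed

end

section \<open>The online algorithm\<close>

lemma neighbours_subset:
  assumes "simple_graph V E"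
  shows "neighbours E x \<subseteq> V"
  using assms by (force simp: simple_graph_def neighbours_def)

lemma incident_edges_eq:
  assumes "simple_graph V E"
  shows "incident_edges E x = (\<lambda>y. {x, y}) ` neighbours E x"
proof (intro equalityI subsetI)
  fix e assume e: "e \<in> incident_edges E x"
  then have "card e = 2"
    using assms by (simp add: simple_graph_def incident_edges_def)
  then obtain a b where "e = {a, b}"
    by (auto simp: card_2_iff)
  then obtain y where "e = {x, y}"
    using e by (auto simp: incident_edges_def)
  then show "e \<in> (\<lambda>y. {x, y}) ` neighbours E x"
    using e by (simp add: incident_edges_def neighbours_def)
qed (auto simp: incident_edges_def neighbours_def)

lemma inj_doubleton: "inj_on (\<lambda>y. {x, y}) A"
  by (auto simp: inj_on_def doubleton_eq_iff)

lemma vertex_degree_eq: "simple_graph V E \<Longrightarrow> vertex_degree E x = card (neighbours E x)"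
  by (simp add: vertex_degree_def incident_edges_eq card_image inj_doubleton)

text \<open>Delete the edges from \<open>Y\<close> to \<open>A - Y\<close>. A vertex of
  \<open>Y\<close> loses at most the fraction \<open>(1 + \<beta>) / 2\<close> of its edges, which
  is below \<alpha>, and the neighbourhood that remains avoids \<open>A\<close>.\<close>

lemma property_P_expansion:
  assumes graph: "simple_graph V E" and P: "property_P \<alpha> n d V E"
    and S: "\<And>x. x \<in> V \<Longrightarrow> real (card (neighbours E x \<inter> S)) \<le> \<beta> * real (vertex_degree E x)"
    and ab: "\<beta> < 2 * \<alpha> - 1"
    and Y: "Y \<subseteq> V" "card Y \<le> n"
    and A: "\<And>y. y \<in> Y \<Longrightarrow> 2 * card (neighbours E y \<inter> A) \<le> card (neighbours E y) + card (neighbours E y \<inter> S)"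
  shows "2 * d * card Y \<le> card ((\<Union>y\<in>Y. neighbours E y) - A - Y)"
proof -
  define F where "F = {e \<in> E. \<exists>y\<in>Y. \<exists>z\<in>A - Y. e = {y, z}}"
  have fin: "finite (neighbours E x)" for x
    using graph neighbours_subset[OF graph] by (auto simp: simple_graph_def intro: finite_subset)
  have "real (card (F \<inter> incident_edges E x)) \<le> \<alpha> * real (vertex_degree E x)" if x: "x \<in> Y" for x
  proof -
    have "F \<inter> incident_edges E x \<subseteq> (\<lambda>z. {x, z}) ` (neighbours E x \<inter> A)"
      using x by (auto simp: F_def incident_edges_def neighbours_def insert_commute)
    then have "card (F \<inter> incident_edges E x) \<le> card (neighbours E x \<inter> A)"
      using surj_card_le[of "neighbours E x \<inter> A"] fin by blast
    then have "2 * card (F \<inter> incident_edges E x) \<le> vertex_degree E x + card (neighbours E x \<inter> S)"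
      using A[OF x] by (simp add: vertex_degree_eq[OF graph])
    then have "2 * real (card (F \<inter> incident_edges E x)) \<le> real (vertex_degree E x) + real (card (neighbours E x \<inter> S))"
      by linarith
    also have "\<dots> \<le> real (vertex_degree E x) + \<beta> * real (vertex_degree E x)"
      using S x Y by auto
    also have "\<dots> = (1 + \<beta>) * real (vertex_degree E x)"
      by (simp add: algebra_simps)
    also have "\<dots> \<le> 2 * \<alpha> * real (vertex_degree E x)"
      using ab by (intro mult_right_mono) auto
    finally show ?thesis
      by simp
  qed
  moreover have "F \<subseteq> E"
    by (auto simp: F_def)
  ultimately have "2 * d * card Y \<le> card (set_neighbours (E - F) Y)"
    using P Y unfolding property_P_def by blast
  also have "\<dots> \<le> card ((\<Union>y\<in>Y. neighbours E y) - A - Y)"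
  proof (rule card_mono)
    have "finite Y"
      using graph Y(1) by (auto simp: simple_graph_def intro: finite_subset)
    then show "finite ((\<Union>y\<in>Y. neighbours E y) - A - Y)"
      using fin by blast
    show "set_neighbours (E - F) Y \<subseteq> (\<Union>y\<in>Y. neighbours E y) - A - Y"
      by (auto simp: set_neighbours_def neighbours_def F_def)
  qed
  finally show ?thesis .
qed

text \<open>The set \<open>A\<close> to be avoided is \<open>Z \<union> S\<close> for
  \<open>expand_free\<close> and the complement of \<open>Z\<close> for \<open>expand_taken\<close>.
  Splitting the degree along \<open>S\<close> and \<open>Z\<close> turns either crowding condition
  into the hypothesis on \<open>A\<close>.\<close>

lemma network_of_property_P:
  assumes graph: "simple_graph {..<N} E" and P: "property_P \<alpha> n d {..<N} E" and d: "3 \<le> d" "0 < n" "0 < N"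
    and S: "\<forall>x\<in>{..<N}. real (card (neighbours E x \<inter> S)) \<le> \<beta> * real (vertex_degree E x)"
    and ab: "\<beta> < 2 * \<alpha> - 1" and sub: "S \<subseteq> {..<N}"
  shows "network N n d E S"
proof
  have fin: "finite (neighbours E x)" for x
    using neighbours_subset[OF graph] finite_subset by blast
  have split: "card (neighbours E x) = card (neighbours E x - S) + card (neighbours E x \<inter> S)" for x
    using card_Int_Diff[OF fin[of x], of S] by simp
  note exp = property_P_expansion[OF graph P _ ab]
  show "neighbours E y - S \<subseteq> {..<N}" for y
    using neighbours_subset[OF graph] by blast
  show "n < N"
  proof (rule ccontr)
    \<comment> \<open>Otherwise the property would apply to the whole vertex set, which has no
      outside neighbours.\<close>
    assume "\<not> n < N"
    then have "2 * d * card {..<N} \<le> card ((\<Union>y\<in>{..<N}. neighbours E y) - {} - {..<N})"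
      using S by (intro exp) auto
    also have "(\<Union>y\<in>{..<N}. neighbours E y) - {} - {..<N} = {}"
      using neighbours_subset[OF graph] by blast
    finally show False
      using d by simp
  qed
  show "2 * d * card Y \<le> card ((\<Union>y\<in>Y. neighbours E y - S) - Z)"
    if Y: "Y \<subseteq> {..<N}" "card Y \<le> n"
      and Z: "\<And>y. y \<in> Y \<Longrightarrow> card ((neighbours E y - S) \<inter> Z) \<le> card (neighbours E y - S - Z)" for Y Z
  proof -
    have "2 * d * card Y \<le> card ((\<Union>y\<in>Y. neighbours E y) - (Z \<union> S) - Y)"
    proof (rule exp)
      fix y assume y: "y \<in> Y"
      have "neighbours E y \<inter> (Z \<union> S) = ((neighbours E y - S) \<inter> Z) \<union> (neighbours E y \<inter> S)"
        by blast
      then have "card (neighbours E y \<inter> (Z \<union> S)) \<le> card ((neighbours E y - S) \<inter> Z) + card (neighbours E y \<inter> S)"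
        using card_Un_le by metis
      moreover have "card (neighbours E y - S) = card ((neighbours E y - S) \<inter> Z) + card (neighbours E y - S - Z)"
        using fin by (intro card_Int_Diff) simp
      ultimately show "2 * card (neighbours E y \<inter> (Z \<union> S)) \<le> card (neighbours E y) + card (neighbours E y \<inter> S)"
        using Z[OF y] split[of y] by linarith
    qed (use S Y in auto)
    also have "\<dots> \<le> card ((\<Union>y\<in>Y. neighbours E y - S) - Z)"
    proof (rule card_mono)
      have "finite Y"
        using Y(1) finite_subset by blast
      then show "finite ((\<Union>y\<in>Y. neighbours E y - S) - Z)"
        using fin by blast
    qed blast
    finally show ?thesis .
  qed
  show "2 * d * card Y \<le> card Z"
    if Y: "Y \<subseteq> {..<N}" "card Y \<le> n" and ZN: "Z \<subseteq> {..<N}"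
      and Z: "\<And>y. y \<in> Y \<Longrightarrow> card (neighbours E y - S - Z) \<le> card ((neighbours E y - S) \<inter> Z)" for Y Z
  proof -
    have "2 * d * card Y \<le> card ((\<Union>y\<in>Y. neighbours E y) - (- Z) - Y)"
    proof (rule exp)
      fix y assume y: "y \<in> Y"
      have "card (neighbours E y \<inter> - Z) \<le> card ((neighbours E y - S - Z) \<union> (neighbours E y \<inter> S))"
        using fin by (intro card_mono) auto
      also have "\<dots> \<le> card (neighbours E y - S - Z) + card (neighbours E y \<inter> S)"
        by (rule card_Un_le)
      finally have "card (neighbours E y \<inter> - Z) \<le> card (neighbours E y - S - Z) + card (neighbours E y \<inter> S)" .
      moreover have "card (neighbours E y - S) = card ((neighbours E y - S) \<inter> Z) + card (neighbours E y - S - Z)"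
        using fin by (intro card_Int_Diff) simp
      ultimately show "2 * card (neighbours E y \<inter> - Z) \<le> card (neighbours E y) + card (neighbours E y \<inter> S)"
        using Z[OF y] split[of y] by linarith
    qed (use S Y in auto)
    also have "\<dots> \<le> card Z"
      using ZN by (intro card_mono) (auto intro: finite_subset)
    finally show ?thesis .
  qed
qed (use graph d sub in auto)

text \<open>Up to \<open>q = 4\<close>, the summand \<open>4\<close> from rounding up the height is offset by the \<open>16\<close> in the logarithm.\<close>

lemma path_budget:
  fixes n d q m :: nat and x :: real
  assumes d: "3 \<le> d" "d < n" and q: "q = d - 1"
    and m: "real m \<le> real d * real n * ln (real d) / (15 * ln (real n))"
    and x: "x = ln (real n / 16) / ln (real q)" "0 \<le> 2 * x + 4"
  shows "(2 * x + 4) * real m \<le> 5 / 8 * (real n * real q)"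
proof -
  define A L l where "A = ln (real n)" "L = ln (real d)" "l = ln (real q)"
  have q2: "2 \<le> q" "real d = real q + 1"
    using d q by auto
  have pos: "0 < A" "0 < L" "0 < l" "L \<le> A"
    using d q2 by (auto simp: A_L_l_def)
  have "ln (16::real) = ln (2 ^ 4)"
    by simp
  also have "\<dots> = 4 * ln 2"
    by (subst ln_realpow) auto
  finally have ln16: "ln (16::real) = 4 * ln 2" .
  have x': "x = (A - 4 * ln 2) / l"
    using d by (simp add: x A_L_l_def ln_div ln16)
  \<comment> \<open>\<open>75 / 8\<close> is the desired \<open>5 / 8\<close> times the
    \<open>15\<close> in the bound on \<open>m\<close>.\<close>
  have key: "d * ((2 * x + 4) * L) \<le> 75 / 8 * A * q"
  proof (cases "q \<le> 4")
    case True
    \<comment> \<open>This yields \<open>L \<le> 8 / 5 * l\<close>; the tightest case is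
      \<open>243 \<le> 256\<close> at \<open>q = 2\<close>.\<close>
    have "(real q + 1) ^ 5 \<le> real q ^ 8"
    proof -
      consider "q = 2" | "q = 3" | "q = 4"
        using q2(1) True by linarith
      then show ?thesis
        by cases simp_all
    qed
    then have "ln ((real q + 1) ^ 5) \<le> ln (real q ^ 8)"
      using q2 by (subst ln_le_cancel_iff) auto
    then have r: "5 * L \<le> 8 * l"
      using q2 by (simp add: A_L_l_def ln_realpow)
    have "l \<le> ln (2 ^ 2)"
      using True q2 unfolding A_L_l_def by (subst ln_le_cancel_iff) auto
    also have "\<dots> = 2 * ln (2::real)"
      by (subst ln_realpow) auto
    finally have l2: "l \<le> 2 * ln 2" .
    have "(2 * x + 4) * l = 2 * A - 8 * ln 2 + 4 * l"
      using pos by (simp add: x' field_simps)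
    also have "\<dots> \<le> 2 * A"
      using l2 by simp
    finally have "(2 * x + 4) * l \<le> 2 * A" .
    then have "(2 * x + 4) * (8 * l) \<le> 16 * A"
      by (simp add: algebra_simps)
    moreover have "(2 * x + 4) * (5 * L) \<le> (2 * x + 4) * (8 * l)"
      using r x(2) by (rule mult_left_mono)
    ultimately have "(2 * x + 4) * (5 * L) \<le> 16 * A"
      by linarith
    then have a: "(2 * x + 4) * L \<le> 16 / 5 * A"
      by (simp add: algebra_simps)
    have "d * ((2 * x + 4) * L) \<le> d * (16 / 5 * A)"
      using a by (rule mult_left_mono) simp
    also have "\<dots> \<le> (3 / 2 * q) * (16 / 5 * A)"
      using q2 pos by (intro mult_right_mono) auto
    also have "\<dots> \<le> 75 / 8 * A * q"
      using pos by simp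
    finally show ?thesis .
  next
    case False
    \<comment> \<open>For \<open>q\<close> at least 5, \<open>d \<le> 6 / 5 * q\<close> and
      \<open>(6 / 5) ^ 8 < 5\<close>, which leads to \<open>L \<le> 9 / 8 * l\<close>.\<close>
    have "(real q + 1) ^ 8 \<le> (6 / 5 * real q) ^ 8"
      using False by (intro power_mono) auto
    also have "\<dots> = (6 / 5) ^ 8 * real q ^ 8"
      by (rule power_mult_distrib)
    also have "\<dots> \<le> real q * real q ^ 8"
      using False by (intro mult_right_mono) (auto simp: power_divide)
    also have "\<dots> = real q ^ 9"
      by (simp add: numeral_eq_Suc)
    finally have "ln ((real q + 1) ^ 8) \<le> ln (real q ^ 9)"
      using q2 by (subst ln_le_cancel_iff) auto
    then have r: "8 * L \<le> 9 * l"
      using q2 by (simp add: A_L_l_def ln_realpow)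
    have "x \<le> A / l"
      using pos by (simp add: x' divide_right_mono)
    then have "x * L \<le> A / l * L"
      using pos by (intro mult_right_mono) auto
    also have "\<dots> = A * (L / l)"
      by simp
    also have "\<dots> \<le> A * (9 / 8)"
      using pos r by (intro mult_left_mono) (auto simp: field_simps)
    finally have "(2 * x + 4) * L \<le> 25 / 4 * A"
      using pos by (simp add: algebra_simps)
    then have "d * ((2 * x + 4) * L) \<le> d * (25 / 4 * A)"
      by (rule mult_left_mono) simp
    also have "\<dots> \<le> (6 / 5 * q) * (25 / 4 * A)"
      using q2 pos False by (intro mult_right_mono) auto
    also have "\<dots> \<le> 75 / 8 * A * q"
      using pos by simp
    finally show ?thesis .
  qed
  have "(2 * x + 4) * real m \<le> (2 * x + 4) * (real d * real n * L / (15 * A))"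
    using m x(2) unfolding A_L_l_def by (rule mult_left_mono)
  also have "\<dots> = n * (d * ((2 * x + 4) * L)) / (15 * A)"
    by simp
  also have "\<dots> \<le> n * (75 / 8 * A * q) / (15 * A)"
    using key pos by (intro divide_right_mono mult_left_mono) auto
  also have "\<dots> = 5 / 8 * (real n * real q)"
    using pos by simp
  finally show ?thesis .
qed

section \<open>The path length and the run over all pairs\<close>

context network
begin

lemma height_ceiling:
  assumes n: "d < n" and m: "1 \<le> real d * real n * ln (real d) / (15 * ln (real n))"
  defines "x \<equiv> ln (real n / 16) / ln (real q)"
  shows "int height = \<lceil>x\<rceil> + 1"
proof -
  have q2: "2 \<le> q" "real q = real d - 1"
    using d_ge by auto
  have l: "0 < ln (real q)"
    using q2 by simp
  have n16: "ln (real n / 16) = ln (real n) - ln 16"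
    using n by (simp add: ln_div)
  have "real (n * q) \<le> real (16 * q ^ height)"
    using height_reached of_nat_le_iff by blast
  then have "ln (real n * real q) \<le> ln (16 * real q ^ height)"
    using q2 n by (subst ln_le_cancel_iff) auto
  then have "ln (real n) + ln (real q) \<le> ln 16 + height * ln (real q)"
    using q2 n by (simp add: ln_mult ln_realpow)
  then have up: "ln (real n) - ln 16 \<le> (real height - 1) * ln (real q)"
    by (simp add: algebra_simps)
  have low: "(real height - 2) * ln (real q) < ln (real n) - ln 16"
  proof (cases height)
    case 0
    have "16 < n * q ^ 2"
    proof (rule ccontr)
      assume *: "\<not> 16 < n * q ^ 2"
      have "4 \<le> n"
        using n d_ge by simp
      have "q = 2"
      proof (rule ccontr)
        assume "q \<noteq> 2"
        then have "3 ^ 2 \<le> q ^ 2"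
          using q2 by (intro power_mono) auto
        then have "4 * 9 \<le> n * q ^ 2"
          using \<open>4 \<le> n\<close> by (intro mult_le_mono) auto
        then show False
          using * by simp
      qed
      then have "n = 4" "d = 3"
        using * \<open>4 \<le> n\<close> d_ge by auto
      then have "5 * ln (4::real) \<le> 4 * ln 3"
        using m by (simp add: field_simps)
      then have "ln ((4::real) ^ 5) \<le> ln (3 ^ 4)"
        by (simp only: ln_realpow of_nat_numeral zero_less_numeral)
      then have "(4::real) ^ 5 \<le> 3 ^ 4"
        by (subst (asm) ln_le_cancel_iff) auto
      then show False
        by simp
    qed
    then have "real 16 < real (n * q ^ 2)"
      using of_nat_less_iff by blast
    then have "ln 16 < ln (real n * real q ^ 2)"
      using q2 n by (subst ln_less_cancel_iff) auto
    also have "\<dots> = ln (real n) + 2 * ln (real q)"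
      using q2 n by (simp add: ln_mult ln_realpow)
    finally show ?thesis
      using 0 by simp
  next
    case (Suc h)
    have "16 * q ^ h < n * q"
      using below_height[of h] Suc by simp
    then have "real (16 * q ^ h) < real (n * q)"
      using of_nat_less_iff by blast
    then have "ln (16 * real q ^ h) < ln (real n * real q)"
      using q2 n by (subst ln_less_cancel_iff) auto
    then have "ln 16 + h * ln (real q) < ln (real n) + ln (real q)"
      using q2 n by (simp add: ln_mult ln_realpow)
    then show ?thesis
      using Suc by (simp add: algebra_simps)
  qed
  have "\<lceil>x\<rceil> = int height - 1"
  proof (rule ceiling_unique)
    show "real_of_int (int height - 1) - 1 < x"
      using low l by (simp add: x_def n16 less_divide_eq)
    show "x \<le> real_of_int (int height - 1)"
      using up l by (simp add: x_def n16 divide_le_eq)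
  qed
  then show ?thesis
    by simp
qed

lemma resting_initial: "resting {} (initial_store N E S n d)"
proof -
  have "y * N + v < N * N" if "y < N" "v < N" for y v
  proof -
    have "Suc y * N \<le> N * N"
      using that by (intro mult_le_mono1) simp
    then show ?thesis
      using that by simp
  qed
  then have "loaded (initial_store N E S n d)"
    by (auto simp: loaded_def initial_store_def scalar_def)
  then show ?thesis
    using good_empty by (simp add: resting_def initial_store_def)
qed

lemma online_run_exists:
  assumes join: "\<forall>U W. U \<subseteq> {..<N} \<and> W \<subseteq> {..<N} \<and> U \<inter> W = {} \<and> n * q \<le> 16 * card U \<and>
      n * q \<le> 16 * card W \<longrightarrow> (\<exists>u\<in>U. \<exists>w\<in>W. {u, w} \<in> E)"
    and "resting K s" "disjoint_pairs (S - K) ps"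
    and "16 * (card (K - S) + 2 * height * length ps) + 6 * (n * q) + 16 * q \<le> 16 * ((d + 1) * n)"
  shows "\<exists>qs. online_run (compile round_prog) (poly (cost round_prog) N) s ps qs \<and>
    connected_disjointly {..<N} E (2 * int height + 1) ps qs \<and> (\<forall>p\<in>set qs. set p \<inter> K = {})"
  using assms(2-)
proof (induction ps arbitrary: K s)
  case Nil
  then show ?case
    by (intro exI[of _ "[]"]) (simp add: online_run_Nil connected_disjointly_def)
next
  case (Cons ab ps)
  obtain a b where ab: "ab = (a, b)"
    by force
  define r where "r = reveal_pair ab s"
  define t where "t = run N round_prog r"
  define p where "p = output_path t"
  have rest: "resting K r"
  proof -
    have "loaded r" and eq: "r Kept = s Kept"
      using Cons.prems(1) by (auto simp: resting_def loaded_def r_def reveal_pair_def)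
    then show ?thesis
      using Cons.prems(1) unfolding resting_def eq by blast
  qed
  have src: "r Source 0 = a" and tgt: "r Target 0 = b"
    by (simp_all add: r_def reveal_pair_def ab scalar_def)
  have ab': "a \<in> S - K" "b \<in> S - K" "a \<noteq> b" and ps: "disjoint_pairs (S - K - {a, b}) ps"
  proof -
    define xs where "xs = concat (map (\<lambda>(a, b). [a, b]) ps)"
    have "concat (map (\<lambda>(a, b). [a, b]) (ab # ps)) = a # b # xs"
      by (simp add: ab xs_def)
    then have "distinct (a # b # xs)" "set (a # b # xs) \<subseteq> S - K"
      using Cons.prems(2) by (simp_all only: disjoint_pairs_def Let_def)
    then show "a \<in> S - K" "b \<in> S - K" "a \<noteq> b" "disjoint_pairs (S - K - {a, b}) ps"
      unfolding disjoint_pairs_def Let_def xs_def[symmetric] by auto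
  qed
  have now: "16 * card (K - S) + 6 * (n * q) + 16 * q \<le> 16 * ((d + 1) * n)"
    using Cons.prems(3) by (simp add: distrib_left)
  note round = round_correct[OF rest src ab'(1) tgt ab'(2,3) now join, folded t_def, folded p_def]
  have path: "is_path {..<N} E a b p" and len: "length p = 2 * height + 2" and pK: "set p \<inter> K = {}"
    and pS: "set p \<inter> S = {a, b}" and rest': "resting (K \<union> set p) t"
    by (fact round)+
  have "card (set p) = 2 * height + 2"
    using path len by (simp add: is_path_def distinct_card)
  moreover have "card (set p) = card (set p \<inter> S) + card (set p - S)"
    by (rule card_Int_Diff) simp
  ultimately have "card (set p - S) = 2 * height"
    using ab'(3) pS by simp
  moreover have "card (K \<union> set p - S) \<le> card (K - S) + card (set p - S)"
    using card_Un_le[of "K - S" "set p - S"] by (simp add: Un_Diff)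
  ultimately have "card (K \<union> set p - S) + 2 * height * length ps \<le> card (K - S) + 2 * height * length (ab # ps)"
    by simp
  moreover have "16 * x + u + v \<le> w" if "x \<le> y" "16 * y + u + v \<le> w" for x y u v w :: nat
    using that by linarith
  ultimately have budget: "16 * (card (K \<union> set p - S) + 2 * height * length ps) + 6 * (n * q) + 16 * q \<le> 16 * ((d + 1) * n)"
    using Cons.prems(3) by blast
  have "S - (K \<union> set p) = S - K - {a, b}"
    using pS by blast
  then obtain qs where qs: "online_run (compile round_prog) (poly (cost round_prog) N) t ps qs"
    "connected_disjointly {..<N} E (2 * int height + 1) ps qs" "\<forall>q\<in>set qs. set q \<inter> (K \<union> set p) = {}"
    using Cons.IH[OF rest' _ budget] ps by auto
  have "r Order 0 = N"
    using rest by (simp add: resting_def loaded_def)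
  then obtain T where "T \<le> poly (cost round_prog) N" "exec (compile round_prog) r T t"
    using compile_correct[OF safe_round_prog] unfolding t_def by blast
  then have "online_run (compile round_prog) (poly (cost round_prog) N) s (ab # ps) (p # qs)"
    unfolding p_def r_def using qs(1) by (intro online_run_Cons)
  moreover have "connected_disjointly {..<N} E (2 * int height + 1) (ab # ps) (p # qs)"
  proof -
    have "is_path {..<N} E (fst ((ab # ps) ! i)) (snd ((ab # ps) ! i)) ((p # qs) ! i) \<and>
        path_length ((p # qs) ! i) = 2 * int height + 1" if "i < length (ab # ps)" for i
      using that path len qs(2) by (cases i) (simp_all add: connected_disjointly_def ab path_length_def)
    moreover have "set ((p # qs) ! i) \<inter> set ((p # qs) ! j) = {}" if "i < j" "j < length (ab # ps)" for i j
    proof -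
      obtain j' where j': "j = Suc j'"
        using \<open>i < j\<close> by (cases j) auto
      show ?thesis
      proof (cases i)
        case 0
        have "qs ! j' \<in> set qs"
          using qs(2) that j' by (simp add: connected_disjointly_def)
        then show ?thesis
          using qs(3) 0 j' by auto
      next
        case (Suc i')
        then show ?thesis
          using qs(2) that j' by (simp add: connected_disjointly_def)
      qed
    qed
    ultimately show ?thesis
      using qs(2) by (simp add: connected_disjointly_def)
  qed
  ultimately show ?case
    using pK qs(3) by (intro exI[of _ "p # qs"]) auto
qed

end

theorem theorem3p5:
  shows "\<exists>(c :: com) (p :: nat poly).
    \<forall>(N :: nat) (E :: nat set set) (S :: nat set) (n :: nat) (d :: nat) (\<alpha> :: real) (\<beta> :: real)
      (ps :: (nat \<times> nat) list).
      simple_graph {..<N} E \<longrightarrow>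
      3 \<le> d \<longrightarrow> d < n \<longrightarrow>
      property_P \<alpha> n d {..<N} E \<longrightarrow>
      (\<forall>U W. U \<subseteq> {..<N} \<and> W \<subseteq> {..<N} \<and> U \<inter> W = {} \<and>
             real n * (real d - 1) / 16 \<le> real (card U) \<and>
             real n * (real d - 1) / 16 \<le> real (card W)
             \<longrightarrow> (\<exists>u\<in>U. \<exists>w\<in>W. {u, w} \<in> E)) \<longrightarrow>
      S \<subseteq> {..<N} \<longrightarrow>
      (\<forall>x\<in>{..<N}. real (card (neighbours E x \<inter> S)) \<le> \<beta> * real (vertex_degree E x)) \<longrightarrow>
      \<beta> < 2 * \<alpha> - 1 \<longrightarrow>
      disjoint_pairs S ps \<longrightarrow>
      real (length ps) \<le> real d * real n * ln (real d) / (15 * ln (real n)) \<longrightarrow>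
      (\<exists>qs. online_run c (poly p N) (initial_store N E S n d) ps qs \<and>
            connected_disjointly {..<N} E
              (2 * \<lceil>ln (real n / 16) / ln (real d - 1)\<rceil> + 3) ps qs)"
proof (intro exI[of _ "compile round_prog"] exI[of _ "cost round_prog"] allI impI)
  fix N :: nat and E :: "nat set set" and S :: "nat set" and n d :: nat and \<alpha> \<beta> :: real
    and ps :: "(nat \<times> nat) list"
  assume graph: "simple_graph {..<N} E" and d: "3 \<le> d" "d < n" and P: "property_P \<alpha> n d {..<N} E"
    and join: "\<forall>U W. U \<subseteq> {..<N} \<and> W \<subseteq> {..<N} \<and> U \<inter> W = {} \<and>
             real n * (real d - 1) / 16 \<le> real (card U) \<and>
             real n * (real d - 1) / 16 \<le> real (card W)
             \<longrightarrow> (\<exists>u\<in>U. \<exists>w\<in>W. {u, w} \<in> E)"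
    and S: "S \<subseteq> {..<N}" "\<forall>x\<in>{..<N}. real (card (neighbours E x \<inter> S)) \<le> \<beta> * real (vertex_degree E x)"
    and ab: "\<beta> < 2 * \<alpha> - 1" and ps: "disjoint_pairs S ps"
    and m: "real (length ps) \<le> real d * real n * ln (real d) / (15 * ln (real n))"
  show "\<exists>qs. online_run (compile round_prog) (poly (cost round_prog) N) (initial_store N E S n d) ps qs \<and>
            connected_disjointly {..<N} E (2 * \<lceil>ln (real n / 16) / ln (real d - 1)\<rceil> + 3) ps qs"
  \<comment> \<open>If there is a pair, then \<open>S\<close> is nonempty, so \<open>N\<close> is
    positive, and the bound on the number of pairs is at least 1, as \<open>height_ceiling\<close>
    requires.\<close>
  proof (cases "ps = []")
    case True
    then show ?thesis
      by (intro exI[of _ "[]"]) (simp add: online_run_Nil connected_disjointly_def)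
  next
    case False
    then have len: "1 \<le> length ps"
      by (cases ps) auto
    have "S \<noteq> {}"
      using ps False by (cases ps) (auto simp: disjoint_pairs_def Let_def)
    then have "0 < N"
      using S(1) by (cases N) auto
    then interpret network N n d E S
      using network_of_property_P[OF graph P d(1) _ _ S(2) ab S(1)] d by simp
    have q: "real d - 1 = real q"
      using d by simp
    define x where "x = ln (real n / 16) / ln (real q)"
    have "1 \<le> real d * real n * ln (real d) / (15 * ln (real n))"
      using m len by linarith
    from height_ceiling[OF d(2) this] have h: "int height = \<lceil>x\<rceil> + 1"
      by (simp only: x_def)
    then have hx: "2 * real height \<le> 2 * x + 4"
      by linarith
    have "2 * real height * real (length ps) \<le> (2 * x + 4) * real (length ps)"
      using hx by (rule mult_right_mono) simp
    also have "\<dots> \<le> 5 / 8 * (real n * real q)"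
      using hx by (intro path_budget[OF d refl m x_def]) linarith
    finally have "16 * (2 * real height * real (length ps)) \<le> 10 * (real n * real q)"
      by linarith
    then have "real (16 * (2 * height * length ps)) \<le> real (10 * (n * q))"
      by (simp only: of_nat_mult of_nat_numeral)
    then have "16 * (2 * height * length ps) \<le> 10 * (n * q)"
      using of_nat_le_iff by blast
    \<comment> \<open>In sixteenths of \<open>n * q\<close>, all paths together take at most 10 and
      the two trees of the current round 6; \<open>16 * q\<close> covers the overshoot of a last
      level.\<close>
    moreover have "16 * (n * q) + 16 * q \<le> 16 * ((d + 1) * n)"
      using d by (cases d) (auto simp: algebra_simps)
    ultimately have budget: "16 * (card ({} - S) + 2 * height * length ps) + 6 * (n * q) + 16 * q \<le> 16 * ((d + 1) * n)"
      unfolding empty_Diff card.empty add_0 by linarith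
    have join': "\<forall>U W. U \<subseteq> {..<N} \<and> W \<subseteq> {..<N} \<and> U \<inter> W = {} \<and> n * q \<le> 16 * card U \<and>
        n * q \<le> 16 * card W \<longrightarrow> (\<exists>u\<in>U. \<exists>w\<in>W. {u, w} \<in> E)"
    proof (intro allI impI)
      fix U W
      assume UW: "U \<subseteq> {..<N} \<and> W \<subseteq> {..<N} \<and> U \<inter> W = {} \<and> n * q \<le> 16 * card U \<and> n * q \<le> 16 * card W"
      then have "real (n * q) \<le> real (16 * card U)" "real (n * q) \<le> real (16 * card W)"
        using of_nat_le_iff by blast+
      then have "real n * (real d - 1) / 16 \<le> real (card U)" "real n * (real d - 1) / 16 \<le> real (card W)"
        unfolding q by simp_all
      then show "\<exists>u\<in>U. \<exists>w\<in>W. {u, w} \<in> E"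
        using UW join[rule_format, of U W] by blast
    qed
    have "2 * \<lceil>ln (real n / 16) / ln (real d - 1)\<rceil> + 3 = 2 * int height + 1"
      using h unfolding q x_def by simp
    then show ?thesis
      using online_run_exists[OF join' resting_initial _ budget] ps unfolding Diff_empty by metis
  qed
qed

end
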